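(* If $G$ is a prime $3^{+2}$-rank-connected graph with at least $10$ vertices, then $G$ has a prime $3^{+3}$-rank-connected pivot-minor $H$ such that $|V(H)|=|V(G)|-1$.
   Context: All graphs are finite and simple. For a graph $G$ and $X\subseteq V(G)$, the cut-rank $\rho_G(X)$ is the rank over $\mathrm{GF}(2)$ of the $X\times(V(G)-X)$ submatrix of the adjacency matrix of $G$. A partition $(A,B)$ of $V(G)$ is a split if $\rho_G(A)\le 1$ and $\min(|A|,|B|)\ge 2$. A graph is prime if it is connected and has no split. For integers $k,\ell$, $G$ is $k^{+\ell}$-rank-connected if for every $X\subseteq V(G)$ with $\rho_G(X)<k$ we have $\min(|X|,|V(G)-X|)<k+\ell$. Pivoting an edge $vw$ of $G$ produces the graph $G\wedge vw$ as follows: let $S_1=N(v)-N(w)-\{w\}$, $S_2=N(w)-N(v)-\{v\}$, $S_3=N(v)\cap N(w)$; for every pair $x,y$ of vertices lying in two different sets among $S_1,S_2,S_3$, toggle the adjacency of $x$ and $y$; then swap the labels of $v$ and $w$. A graph is pivot-equivalent to $G$ if it is obtained from $G$ by a sequence of pivots. A graph $H$ is a pivot-minor of $G$ if $H$ is an induced subgraph of a graph pivot-equivalent to $G$. *)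

theory Defs
  imports
    "HOL-Library.Z2"
    "HOL-Combinatorics.Transposition"
    "Graph_Theory.Digraph_Component"
    "Jordan_Normal_Form.DL_Rank"
begin

text \<open>
  A finite simple graph is a \<^typ>\<open>'a pair_pre_digraph\<close> satisfying \<^locale>\<open>pair_graph\<close> (finite,
  symmetric, loopless): the edge \<open>xy\<close> is represented by the two arcs \<open>(x, y)\<close> and \<open>(y, x)\<close>.
\<close>

definition nbrs :: "'a pair_pre_digraph \<Rightarrow> 'a \<Rightarrow> 'a set" where
  "nbrs G v = {u. (v, u) \<in> parcs G}"

definition adj_submatrix :: "'a pair_pre_digraph \<Rightarrow> 'a list \<Rightarrow> 'a list \<Rightarrow> bit mat" where
  "adj_submatrix G xs ys =
     mat (length xs) (length ys) (\<lambda>(i, j). of_bool ((xs ! i, ys ! j) \<in> parcs G))"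

text \<open>
  Matrices are indexed by natural numbers, so the rows and columns are numbered by an arbitrary
  enumeration of the sets; the rank does not depend on its choice. The first argument of
  \<^const>\<open>vec_space.rank\<close> is the number of rows.
\<close>

definition enum_of :: "'a set \<Rightarrow> 'a list" where
  "enum_of X = (SOME xs. distinct xs \<and> set xs = X)"

definition cut_rank :: "'a pair_pre_digraph \<Rightarrow> 'a set \<Rightarrow> nat" where
  "cut_rank G X =
     vec_space.rank (card X) (adj_submatrix G (enum_of X) (enum_of (pverts G - X)))"

definition is_split :: "'a pair_pre_digraph \<Rightarrow> 'a set \<Rightarrow> 'a set \<Rightarrow> bool" where
  "is_split G A B \<longleftrightarrow> A \<union> B = pverts G \<and> A \<inter> B = {} \<and>
     cut_rank G A \<le> 1 \<and> min (card A) (card B) \<ge> 2"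

definition prime_graph :: "'a pair_pre_digraph \<Rightarrow> bool" where
  "prime_graph G \<longleftrightarrow> connected G \<and> (\<nexists>A B. is_split G A B)"

definition rank_connected :: "int \<Rightarrow> int \<Rightarrow> 'a pair_pre_digraph \<Rightarrow> bool" where
  "rank_connected k l G \<longleftrightarrow>
     (\<forall>X \<subseteq> pverts G. int (cut_rank G X) < k \<longrightarrow>
        int (min (card X) (card (pverts G - X))) < k + l)"

text \<open>\<open>D\<close> is the set of (ordered) pairs to be toggled; swapping the labels of \<open>v\<close> and \<open>w\<close> is
  applying the transposition to both ends of every arc.\<close>

definition pivot :: "'a pair_pre_digraph \<Rightarrow> 'a \<Rightarrow> 'a \<Rightarrow> 'a pair_pre_digraph" where
  "pivot G v w =
     (let S1 = nbrs G v - nbrs G w - {w};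
          S2 = nbrs G w - nbrs G v - {v};
          S3 = nbrs G v \<inter> nbrs G w;
          T = S1 \<times> S2 \<union> S1 \<times> S3 \<union> S2 \<times> S3;
          D = T \<union> T\<inverse>;
          E = (parcs G - D) \<union> (D - parcs G)
      in \<lparr> pverts = pverts G,
           parcs = map_prod (Transposition.transpose v w) (Transposition.transpose v w) ` E \<rparr>)"

definition pivot_step :: "'a pair_pre_digraph \<Rightarrow> 'a pair_pre_digraph \<Rightarrow> bool" where
  "pivot_step G G' \<longleftrightarrow> (\<exists>v w. (v, w) \<in> parcs G \<and> G' = pivot G v w)"

definition pivot_equivalent :: "'a pair_pre_digraph \<Rightarrow> 'a pair_pre_digraph \<Rightarrow> bool" where
  "pivot_equivalent = pivot_step\<^sup>*\<^sup>*"

definition pivot_minor :: "'a pair_pre_digraph \<Rightarrow> 'a pair_pre_digraph \<Rightarrow> bool" where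
  "pivot_minor H G \<longleftrightarrow> (\<exists>G'. pivot_equivalent G G' \<and> induced_subgraph H G')"

end

theory Submission
  imports Defs "HOL-Library.Function_Algebras" "HOL-Library.Product_Plus"
begin

text \<open>
  The proof replaces \<open>G\<close> by a subspace in which deleting a vertex and pivoting before deleting become
  the same kind of operation. Let \<open>A\<close> be the adjacency matrix over \<open>GF(2)\<close> and \<open>L\<close> the space of all
  vectors \<open>(x, A x)\<close>, viewed as maps from \<open>V(G)\<close> to the plane \<open>GF(2)\<^sup>2\<close>. As \<open>A\<close> is symmetric, any two
  vectors of \<open>L\<close> are orthogonal for the sum of the symplectic forms at the vertices, and \<open>L\<close> has the
  largest dimension that this permits. The cut-rank of \<open>X\<close> is \<open>|X|\<close> minus the dimension of the space of
  vectors of \<open>L\<close> supported by \<open>X\<close> (\<open>cut_rank_eq_rk\<close>). Removing \<open>v\<close> along \<open>p \<noteq> 0\<close> means keeping the vectors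
  whose entry at \<open>v\<close> is 0 or \<open>p\<close> and forgetting that entry. For \<open>p = (0, 1)\<close> this is deletion
  (\<open>gsys_delete\<close>). A pivot exchanges the two components at its two ends (\<open>gsys_pivot\<close>), so \<open>p = (1, 0)\<close>
  amounts to a pivot on an edge at \<open>v\<close> followed by deletion. It remains to show that for any distinct
  nonzero \<open>p\<close> and \<open>q\<close> some vertex can be removed along \<open>p\<close> or \<open>q\<close> so that the result has no split and sets
  of rank at most 2 have at most five elements on one side (\<open>exists_removal\<close>).

  Call a vector with a support of three elements a triple. If the removal of \<open>v\<close> along \<open>p\<close> has a split,
  there is a triple with entry \<open>p\<close> at \<open>v\<close> (\<open>not_prime_removal\<close>). If the removals of \<open>v\<close> along \<open>p\<close> and along
  \<open>q\<close> both have sets of rank at most 2 with at least six elements on both sides, then these two sets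
  cross, and one of the four sides is the disjoint union of two sets of rank at most 2 (\<open>crossing\<close>). There are four cases.

  \<^item> Some 4-set of rank 2 contains the support of a triple. Then one of its elements can be removed along
    every line but one (\<open>fan_removal\<close>).
  \<^item> Some 4-set \<open>F\<close> of rank 2 contains no such support. Then the vectors inside \<open>F\<close> take every value at every
    element of \<open>F\<close>, which makes every element of \<open>F\<close> removable along \<open>p\<close> or \<open>q\<close> (\<open>quad_removal\<close>).
  \<^item> There is neither a 4-set of rank 2 nor a triple. Then a set of rank at most 2 has at most two elements on
    one side, against \<open>crossing\<close>.
  \<^item> There is no 4-set of rank 2, but a triple \<open>t\<close> with support \<open>{a, b, c}\<close>. Remove \<open>a\<close>, \<open>b\<close> or \<open>c\<close> along
    a line that avoids the entry of \<open>t\<close>. No such removal has a split. If all three fail, there are three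
    partitions of the other vertices into sets with at least five elements (\<open>sep_exists\<close>). Dimension
    counts bound the ranks of the corners of any two of them (\<open>opposite_corners\<close>, \<open>side_corners\<close>), so some
    corners are sets of rank 2 with two or three elements. The third partition has to cut these corners
    in such a way that there are two of them with three elements each, two of which they share
    (\<open>three_separations_corner\<close>). Their union is a 4-set of rank 2, which does not exist
    (\<open>no_three_separations\<close>).
\<close>

section \<open>The symplectic plane\<close>

type_synonym 'a kvec = "'a \<Rightarrow> bit \<times> bit"

definition symp :: "bit \<times> bit \<Rightarrow> bit \<times> bit \<Rightarrow> bit" where
  "symp k l = fst k * snd l + snd k * fst l"

lemma kvec_double [simp]: "(k :: bit \<times> bit) + k = 0"
  by (cases k) (simp add: zero_prod_def)

lemma kvec_double_fun [simp]: "(f :: 'a kvec) + f = 0"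
  by (auto simp: fun_eq_iff)

lemma kvec_cancel [simp]: "(f :: 'a kvec) + (f + g) = g"
  by (simp flip: add.assoc)

lemma pair_add_eq_0 [simp]: "(k :: bit \<times> bit) + l = 0 \<longleftrightarrow> k = l"
  by (metis add.right_neutral add.assoc kvec_double)

lemma kvec_add_eq_0 [simp]: "(f :: 'a kvec) + g = 0 \<longleftrightarrow> f = g"
  by (simp add: fun_eq_iff)

lemma symp_sym: "symp k l = symp l k"
  by (simp only: symp_def add.commute mult.commute)

lemma symp_simps [simp]: "symp 0 k = 0" "symp k 0 = 0" "symp k k = 0"
  by (simp_all add: symp_def conj_commute)

lemma symp_add: "symp (k + l) m = symp k m + symp l m" "symp m (k + l) = symp m k + symp m l"
  by (simp_all only: symp_def fst_add snd_add distrib_left distrib_right ac_simps)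

text \<open>
  Two distinct nonzero elements of the plane form a symplectic basis. So an entry orthogonal to
  \<open>p \<noteq> 0\<close> lies on the line \<open>{0, p}\<close>; this is how isotropy is exploited throughout.\<close>

lemma symp_eq_0_iff: "symp k l = 0 \<longleftrightarrow> k = 0 \<or> l = 0 \<or> k = l"
proof (cases k, cases l)
  fix a b c d assume "k = (a, b)" "l = (c, d)"
  then show ?thesis
    by (cases a; cases b; cases c; cases d) (simp_all add: symp_def zero_prod_def)
qed

lemma symp_nondegenerate: "k \<noteq> 0 \<Longrightarrow> \<exists>l. symp k l = 1"
proof (cases k)
  fix a b assume "k \<noteq> 0" "k = (a, b)"
  then have "symp k (0, 1) = 1 \<or> symp k (1, 0) = 1"
    by (cases a; cases b) (simp_all add: symp_def zero_prod_def)
  then show ?thesis by blast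
qed

section \<open>Finite binary vector spaces\<close>

text \<open>
  Over \<open>GF(2)\<close> a linear subspace is nothing but a subgroup; finiteness lets the order measure its
  dimension.\<close>

definition subgrp :: "'a kvec set \<Rightarrow> bool" where
  "subgrp A \<longleftrightarrow> finite A \<and> 0 \<in> A \<and> (\<forall>f\<in>A. \<forall>g\<in>A. f + g \<in> A)"

lemma subgrpD: "subgrp A \<Longrightarrow> finite A" "subgrp A \<Longrightarrow> 0 \<in> A"
  "subgrp A \<Longrightarrow> f \<in> A \<Longrightarrow> g \<in> A \<Longrightarrow> f + g \<in> A"
  by (auto simp: subgrp_def)

lemma subgrp_insert_coset:
  assumes A: "subgrp A" and v: "v \<notin> A"
  shows "subgrp (A \<union> (+) v ` A)" "card (A \<union> (+) v ` A) = 2 * card A"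
proof -
  have "A \<inter> (+) v ` A = {}"
  proof (rule ccontr)
    assume "A \<inter> (+) v ` A \<noteq> {}"
    then obtain f where "f \<in> A" "v + f \<in> A" by auto
    then have "f + (v + f) \<in> A" using subgrpD[OF A] by blast
    also have "f + (v + f) = v" by (simp add: add.left_commute)
    finally show False using v by simp
  qed
  then show "card (A \<union> (+) v ` A) = 2 * card A"
    using subgrpD(1)[OF A] by (simp add: card_Un_disjoint card_image)
  show "subgrp (A \<union> (+) v ` A)"
    unfolding subgrp_def
  proof (intro conjI ballI)
    fix f g assume f: "f \<in> A \<union> (+) v ` A" and g: "g \<in> A \<union> (+) v ` A"
    show "f + g \<in> A \<union> (+) v ` A"
    proof (cases "f \<in> A")
      case True
      show ?thesis
      proof (cases "g \<in> A")
        case False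
        then obtain g' where "g' \<in> A" "g = v + g'" using g by auto
        then have "f + g = v + (f + g')" "f + g' \<in> A" using subgrpD[OF A] True
          by (auto simp: algebra_simps)
        then show ?thesis by auto
      qed (use True subgrpD[OF A] in auto)
    next
      case False
      then obtain f' where f': "f' \<in> A" "f = v + f'" using f by auto
      show ?thesis
      proof (cases "g \<in> A")
        case True
        then have "f + g = v + (f' + g)" "f' + g \<in> A" using subgrpD[OF A] f'
          by (auto simp: algebra_simps)
        then show ?thesis by auto
      next
        case False
        then obtain g' where "g' \<in> A" "g = v + g'" using g by auto
        then have "f + g = f' + g'" "f' + g' \<in> A" using subgrpD[OF A] f'
          by (auto simp: algebra_simps)
        then show ?thesis by auto
      qed
    qed
  qed (use subgrpD[OF A] in auto)
qed

text \<open>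
  Adjoining a coset doubles the order, so a largest subgroup whose order is a power of two is
  already everything.\<close>

lemma card_subgrp_power_2:
  assumes A: "subgrp A"
  shows "\<exists>k. card A = 2 ^ k"
proof -
  define P where "P B \<longleftrightarrow> subgrp B \<and> B \<subseteq> A \<and> (\<exists>k. card B = 2 ^ k)" for B
  have "P {0}" using subgrpD[OF A] unfolding P_def subgrp_def by (auto intro: exI[of _ 0])
  moreover have "\<forall>B. P B \<longrightarrow> card B < Suc (card A)"
    using subgrpD(1)[OF A] unfolding P_def by (auto simp: less_Suc_eq_le intro: card_mono)
  ultimately obtain B where B: "P B" and max: "\<forall>C. P C \<longrightarrow> card C \<le> card B"
    using ex_has_greatest_nat[of P "{0}" card "Suc (card A)"] by (auto simp: less_imp_le)
  have "B = A"
  proof (rule ccontr)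
    assume "B \<noteq> A"
    then obtain v where v: "v \<in> A" "v \<notin> B" using B unfolding P_def by blast
    have sB: "subgrp B" using B by (simp add: P_def)
    have "P (B \<union> (+) v ` B)" unfolding P_def
    proof (intro conjI)
      show "B \<union> (+) v ` B \<subseteq> A" using B v subgrpD(3)[OF A] unfolding P_def by auto
      obtain k where "card B = 2 ^ k" using B unfolding P_def by blast
      then show "\<exists>k. card (B \<union> (+) v ` B) = 2 ^ k"
        using subgrp_insert_coset(2)[OF sB v(2)] by (intro exI[of _ "Suc k"]) simp
    qed (rule subgrp_insert_coset(1)[OF sB v(2)])
    then have "card (B \<union> (+) v ` B) \<le> card B" using max by blast
    moreover have "0 < card B" using subgrpD[OF sB] card_gt_0_iff by blast
    ultimately show False using subgrp_insert_coset(2)[OF sB v(2)] by simp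
  qed
  then show ?thesis using B unfolding P_def by blast
qed

text \<open>
  The dimension over \<open>GF(2)\<close>, read off from the order: all dimension counts below compare numbers of
  elements, and no bases are ever chosen.\<close>

definition dm :: "'a kvec set \<Rightarrow> nat" where
  "dm A = (SOME k. card A = 2 ^ k)"

lemma card_dm: "subgrp A \<Longrightarrow> card A = 2 ^ dm A"
  unfolding dm_def using someI_ex[OF card_subgrp_power_2] by blast

lemma dm_eqI: "card A = 2 ^ k \<Longrightarrow> dm A = k"
  unfolding dm_def by (rule some_equality) auto

lemma dm_mono:
  assumes "subgrp A" "subgrp B" "A \<subseteq> B"
  shows "dm A \<le> dm B"
proof -
  have "card A \<le> card B" using assms by (simp add: card_mono subgrpD)
  then show ?thesis using assms by (simp add: card_dm)
qed

lemma dm_less: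
  assumes "subgrp A" "subgrp B" "A \<subset> B"
  shows "dm A < dm B"
proof -
  have "card A < card B" using assms by (simp add: psubset_card_mono subgrpD)
  then show ?thesis using assms by (simp add: card_dm)
qed

lemma dm_0_iff: "subgrp A \<Longrightarrow> dm A = 0 \<longleftrightarrow> A = {0}"
proof
  assume A: "subgrp A" "dm A = 0"
  then have "card A = 1" by (simp add: card_dm)
  then show "A = {0}" using subgrpD(2)[OF A(1)] by (auto simp: card_1_singleton_iff)
qed (auto intro: dm_eqI)

lemma subgrp_Int: "subgrp A \<Longrightarrow> subgrp B \<Longrightarrow> subgrp (A \<inter> B)"
  by (auto simp: subgrp_def)

lemma card_fibres_le:
  assumes "finite A" "finite C" "\<phi> ` A \<subseteq> C" "\<And>c. c \<in> C \<Longrightarrow> card {a \<in> A. \<phi> a = c} \<le> m"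
  shows "card A \<le> m * card C"
proof -
  have "A = (\<Union>c\<in>C. {a \<in> A. \<phi> a = c})" using assms(3) by auto
  then have "card A \<le> (\<Sum>c\<in>C. card {a \<in> A. \<phi> a = c})"
    using card_UN_le[OF assms(2)] by metis
  also have "\<dots> \<le> (\<Sum>c\<in>C. m)" by (rule sum_mono) (rule assms(4))
  finally show ?thesis by (simp add: mult.commute)
qed

text \<open>
  Each nonempty fibre is a translate of the kernel.\<close>

lemma dm_hom:
  fixes \<phi> :: "'a kvec \<Rightarrow> 'b::ab_group_add"
  assumes A: "subgrp A" and hom: "\<And>f g. f \<in> A \<Longrightarrow> g \<in> A \<Longrightarrow> \<phi> (f + g) = \<phi> f + \<phi> g"
    and C: "finite C" "\<phi> ` A \<subseteq> C"
    and K: "subgrp {f \<in> A. \<phi> f = 0}"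
  shows "card A \<le> 2 ^ dm {f \<in> A. \<phi> f = 0} * card C"
proof (rule card_fibres_le[OF subgrpD(1)[OF A] C])
  fix c assume "c \<in> C"
  show "card {a \<in> A. \<phi> a = c} \<le> 2 ^ dm {f \<in> A. \<phi> f = 0}"
  proof (cases "\<exists>a \<in> A. \<phi> a = c")
    case True
    then obtain a where a: "a \<in> A" "\<phi> a = c" by blast
    have "\<phi> 0 = 0" using hom[of 0 0] subgrpD[OF A] by simp
    then have "\<phi> a + \<phi> a = 0" using hom[of a a] a by simp
    then have "(+) a ` {b \<in> A. \<phi> b = c} \<subseteq> {f \<in> A. \<phi> f = 0}"
      using a hom subgrpD(3)[OF A] by auto
    then have "card ((+) a ` {b \<in> A. \<phi> b = c}) \<le> card {f \<in> A. \<phi> f = 0}"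
      using subgrpD(1)[OF K] by (rule card_mono[rotated])
    then show ?thesis using card_dm[OF K] by (simp add: card_image)
  next
    case False
    then have "{a \<in> A. \<phi> a = c} = {}" by blast
    then show ?thesis by (simp only: card.empty)
  qed
qed

text \<open>
  Addition maps \<open>A \<times> B\<close> into \<open>C\<close>, and the first components of two pairs with the same sum differ by
  an element of \<open>A \<inter> B\<close>.\<close>

lemma dm_modular:
  assumes "subgrp A" "subgrp B" "subgrp C" "\<And>f g. f \<in> A \<Longrightarrow> g \<in> B \<Longrightarrow> f + g \<in> C"
  shows "dm A + dm B \<le> dm (A \<inter> B) + dm C"
proof -
  have "card (A \<times> B) \<le> card (A \<inter> B) * card C"
  proof (rule card_fibres_le[where \<phi> = "\<lambda>(f, g). f + g"])
    fix c
    show "card {p \<in> A \<times> B. (case p of (f, g) \<Rightarrow> f + g) = c} \<le> card (A \<inter> B)"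
    proof (cases "\<exists>f g. f \<in> A \<and> g \<in> B \<and> f + g = c")
      case True
      then obtain f g where fg: "f \<in> A" "g \<in> B" "f + g = c" by blast
      have "inj_on (\<lambda>(f', g'). f + f') {p \<in> A \<times> B. (case p of (f, g) \<Rightarrow> f + g) = c}"
        by (auto simp: inj_on_def)
      moreover have "(\<lambda>(f', g'). f + f') ` {p \<in> A \<times> B. (case p of (f, g) \<Rightarrow> f + g) = c} \<subseteq> A \<inter> B"
      proof
        fix x assume "x \<in> (\<lambda>(f', g'). f + f') ` {p \<in> A \<times> B. (case p of (f, g) \<Rightarrow> f + g) = c}"
        then obtain f' g' where h: "f' \<in> A" "g' \<in> B" "f' + g' = c" "x = f + f'" by auto
        have "(f + g) + (f' + g') = 0" using h(3) fg(3) by simp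
        then have "(f + f') + (g + g') = 0" by (simp only: ac_simps)
        then have "f + f' = g + g'" by (simp only: kvec_add_eq_0)
        then show "x \<in> A \<inter> B" using h fg assms by (metis IntI subgrpD(3))
      qed
      ultimately show ?thesis
        using subgrpD(1)[OF assms(1)] by (meson card_inj_on_le finite_Int)
    next
      case False
      then have "{p \<in> A \<times> B. (case p of (f, g) \<Rightarrow> f + g) = c} = {}" by auto
      then show ?thesis by (simp only: card.empty)
    qed
  qed (use assms in \<open>auto simp: subgrpD\<close>)
  then have "(2::nat) ^ (dm A + dm B) \<le> 2 ^ (dm (A \<inter> B) + dm C)"
    using assms by (simp add: card_cartesian_product card_dm subgrp_Int power_add)
  then show ?thesis by simp
qed

lemma dm_Suc_le:
  assumes A: "subgrp A" and B: "subgrp B" and "A \<subseteq> B" "v \<in> B" "v \<notin> A"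
  shows "Suc (dm A) \<le> dm B"
proof -
  have "A \<subset> B" using assms(3-5) by blast
  then show ?thesis using dm_less[OF A B] by simp
qed

text \<open>
  A vector of \<open>C\<close> outside the sum of \<open>A\<close> and \<open>B\<close> can be adjoined to \<open>A\<close> without enlarging \<open>A \<inter> B\<close>.\<close>

lemma dm_modular_Suc:
  assumes A: "subgrp A" and B: "subgrp B" and C: "subgrp C"
    and sub: "\<And>f g. f \<in> A \<Longrightarrow> g \<in> B \<Longrightarrow> f + g \<in> C"
    and v: "v \<in> C" "\<And>f g. f \<in> A \<Longrightarrow> g \<in> B \<Longrightarrow> v \<noteq> f + g"
  shows "dm A + dm B + 1 \<le> dm (A \<inter> B) + dm C"
proof -
  define A' where "A' = A \<union> (+) v ` A"
  have "v \<notin> A" using v(2)[of v 0] subgrpD(2)[OF B] by auto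
  then have A': "subgrp A'" "card A' = 2 * card A"
    using subgrp_insert_coset[OF A] by (simp_all add: A'_def)
  have "dm A' = Suc (dm A)" by (rule dm_eqI) (simp add: A' card_dm[OF A])
  moreover have "A' \<inter> B = A \<inter> B"
  proof -
    have "v + a \<in> B \<Longrightarrow> a \<in> A \<Longrightarrow> False" for a
      using v(2)[of a "v + a"] by (simp add: add.left_commute)
    then show ?thesis by (auto simp: A'_def)
  qed
  moreover have "f + g \<in> C" if "f \<in> A'" "g \<in> B" for f g
    using that sub v(1) subgrpD(3)[OF C] by (auto simp: A'_def add.assoc)
  ultimately show ?thesis using dm_modular[OF A'(1) B C] by simp
qed

text \<open>
  The map \<open>\<phi>\<close> takes at most two values on \<open>A\<close>, so its kernel has index at most two.\<close>

lemma dm_index2: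
  fixes \<phi> :: "'a kvec \<Rightarrow> 'b::ab_group_add"
  assumes A: "subgrp A" and B: "subgrp B" and hom: "\<And>f g. \<phi> (f + g) = \<phi> f + \<phi> g"
    and two: "\<And>f. f \<in> A \<Longrightarrow> \<phi> f = 0 \<or> \<phi> f = c"
    and sub: "\<And>f. f \<in> A \<Longrightarrow> \<phi> f = 0 \<Longrightarrow> f \<in> B"
  shows "dm A \<le> Suc (dm B)"
proof -
  have "\<phi> 0 = 0" using hom[of 0 0] by simp
  then have K: "subgrp {f \<in> A. \<phi> f = 0}"
    using A hom unfolding subgrp_def by auto
  have "card A \<le> 2 ^ dm {f \<in> A. \<phi> f = 0} * card {0, c}"
    by (rule dm_hom[OF A hom _ _ K]) (use two in auto)
  also have "card {0, c} \<le> 2" by (simp add: card_insert_if)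
  finally have "(2::nat) ^ dm A \<le> 2 ^ Suc (dm {f \<in> A. \<phi> f = 0})"
    by (simp add: card_dm[OF A] mult.commute)
  then have "dm A \<le> Suc (dm {f \<in> A. \<phi> f = 0})"
    by (rule power_le_imp_le_exp[rotated]) simp
  also have "dm {f \<in> A. \<phi> f = 0} \<le> dm B" by (rule dm_mono[OF K B]) (use sub in auto)
  finally show ?thesis by simp
qed

section \<open>Supports and orthogonality\<close>

definition supp :: "'a kvec \<Rightarrow> 'a set" where
  "supp f = {v. f v \<noteq> 0}"

lemma supp_0 [simp]: "supp 0 = {}" by (simp add: supp_def)

lemma supp_empty_iff [simp]: "supp f = {} \<longleftrightarrow> f = 0" by (auto simp: supp_def fun_eq_iff)

lemma supp_add: "supp (f + g) \<subseteq> supp f \<union> supp g"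
  by (auto simp: supp_def)

definition form :: "'a set \<Rightarrow> 'a kvec \<Rightarrow> 'a kvec \<Rightarrow> bit" where
  "form E f g = (\<Sum>v\<in>E. symp (f v) (g v))"

lemma form_add: "form E (f + g) h = form E f h + form E g h" "form E h (f + g) = form E h f + form E h g"
  by (simp_all only: form_def plus_fun_def symp_add sum.distrib)

lemma form_0 [simp]: "form E 0 g = 0" "form E g 0 = 0"
  by (simp_all add: form_def)

lemma form_supp:
  assumes "finite E" "supp f \<inter> supp g \<inter> E \<subseteq> D" "D \<subseteq> E"
  shows "form E f g = form D f g"
  unfolding form_def
  by (rule sum.mono_neutral_right) (use assms in \<open>auto simp: supp_def subset_iff symp_eq_0_iff\<close>)

definition vspace :: "'a set \<Rightarrow> 'a kvec set" where
  "vspace E = {f. supp f \<subseteq> E}"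

lemma vspace_card:
  assumes "finite E"
  shows "finite (vspace E)" "card (vspace E) = 4 ^ card E"
proof -
  have *: "vspace E = (\<lambda>f v. if v \<in> E then f v else 0) ` (E \<rightarrow>\<^sub>E UNIV)"
  proof (intro equalityI subsetI)
    fix f :: "'a kvec" assume "f \<in> vspace E"
    then have "f = (\<lambda>v. if v \<in> E then (restrict f E) v else 0)"
      by (auto simp: vspace_def supp_def fun_eq_iff)
    then show "f \<in> (\<lambda>f v. if v \<in> E then f v else 0) ` (E \<rightarrow>\<^sub>E UNIV)"
      by (rule image_eqI[where x = "restrict f E"]) simp
  qed (auto simp: vspace_def supp_def split: if_splits)
  have inj: "inj_on (\<lambda>f v. if v \<in> E then f v else (0 :: bit \<times> bit)) (E \<rightarrow>\<^sub>E UNIV)"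
  proof (rule inj_onI)
    fix f g :: "'a kvec"
    assume f: "f \<in> E \<rightarrow>\<^sub>E UNIV" and g: "g \<in> E \<rightarrow>\<^sub>E UNIV"
      and eq: "(\<lambda>v. if v \<in> E then f v else 0) = (\<lambda>v. if v \<in> E then g v else 0)"
    show "f = g"
    proof (rule PiE_ext[OF f g])
      fix v assume "v \<in> E" then show "f v = g v" using fun_cong[OF eq, of v] by simp
    qed
  qed
  have "x \<in> {0, 1}" for x :: bit by (cases x) simp_all
  then have "(UNIV :: bit set) = {0, 1}" by blast
  then have U: "card (UNIV :: bit set) = 2" using card_2_iff[of "UNIV :: bit set"] zero_neq_one by blast
  have U4: "card (UNIV :: (bit \<times> bit) set) = 4"
    by (simp add: card_cartesian_product U flip: UNIV_Times_UNIV)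
  have "finite (UNIV :: (bit \<times> bit) set)" using U4 card.infinite by fastforce
  then have "finite (E \<rightarrow>\<^sub>E (UNIV :: (bit \<times> bit) set))" using assms by (rule finite_PiE[rotated])
  then show "finite (vspace E)" unfolding * by blast
  show "card (vspace E) = 4 ^ card E"
    unfolding * card_image[OF inj] by (simp add: card_PiE assms U4)
qed

lemma subgrp_vspace: "finite E \<Longrightarrow> subgrp (vspace E)"
  unfolding subgrp_def using vspace_card(1)[of E] supp_add
  by (fastforce simp: vspace_def)

text \<open>
  The nontrivial character of \<open>GF(2)\<close>.\<close>

definition chi :: "bit \<Rightarrow> int" where "chi b = (if b = 0 then 1 else - 1)"

lemma chi_add: "chi (a + b) = chi a * chi b"
  by (cases a; cases b) (simp_all add: chi_def)

text \<open>
  Translation by \<open>a\<close> permutes the summands and reverses all signs.\<close>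

lemma sum_chi_eq_0:
  assumes A: "subgrp A" and hom: "\<And>f g. \<phi> (f + g) = \<phi> f + \<phi> g" and "a \<in> A" "\<phi> a = 1"
  shows "(\<Sum>f\<in>A. chi (\<phi> f)) = 0"
proof -
  have "(\<Sum>f\<in>A. chi (\<phi> f)) = (\<Sum>f\<in>A. chi (\<phi> (a + f)))"
    by (rule sum.reindex_bij_witness[of _ "(+) a" "(+) a"])
      (use assms(3) subgrpD(3)[OF A] in auto)
  also have "\<dots> = - (\<Sum>f\<in>A. chi (\<phi> f))"
    by (simp only: hom assms(4) chi_add) (simp add: chi_def[of 1] sum_negf)
  finally show ?thesis by simp
qed

text \<open>
  Orthogonal subspaces of a symplectic space have dimensions adding up to at most the dimension of
  the space. Instead of linear algebra with bases, sum the character \<open>chi (form E f k)\<close> over \<open>f \<in> U\<close>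
  and all \<open>k\<close>. For fixed \<open>f \<noteq> 0\<close> the sum over \<open>k\<close> vanishes, as the form is nondegenerate; so the total
  is the size of the whole space. For fixed \<open>k\<close> the sum over \<open>f\<close> is never negative, and for
  \<open>k \<in> W\<close> it is the order of \<open>U\<close>.\<close>

lemma dm_orthogonal:
  assumes E: "finite E" and U: "subgrp U" "U \<subseteq> vspace E" and W: "subgrp W" "W \<subseteq> vspace E"
    and orth: "\<And>f g. f \<in> U \<Longrightarrow> g \<in> W \<Longrightarrow> form E f g = 0"
  shows "dm U + dm W \<le> 2 * card E"
proof -
  let ?S = "\<Sum>f\<in>U. \<Sum>k\<in>vspace E. chi (form E f k)"
  have inner: "(\<Sum>k\<in>vspace E. chi (form E f k)) = (if f = 0 then 4 ^ card E else 0)"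
    if f: "f \<in> U" for f
  proof (cases "f = 0")
    case True
    then show ?thesis by (simp add: chi_def vspace_card E)
  next
    case False
    then obtain v where v: "v \<in> supp f" by (metis all_not_in_conv supp_empty_iff)
    then have vE: "v \<in> E" using U(2) f by (auto simp: vspace_def)
    obtain l where l: "symp (f v) l = 1" using symp_nondegenerate[of "f v"] v unfolding supp_def by blast
    define k where "k = (\<lambda>u. if u = v then l else 0)"
    have "k \<in> vspace E" using vE by (auto simp: k_def vspace_def supp_def)
    moreover have "form E f k = 1"
    proof -
      have "form E f k = form {v} f k"
        by (rule form_supp[OF E]) (use vE in \<open>auto simp: k_def supp_def\<close>)
      then show ?thesis by (simp add: form_def k_def l)
    qed
    ultimately have "(\<Sum>k\<in>vspace E. chi (form E f k)) = 0"
      using sum_chi_eq_0[OF subgrp_vspace[OF E], of "form E f" k] by (simp add: form_add)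
    then show ?thesis using False by simp
  qed
  have "?S = 4 ^ card E"
    using subgrpD[OF U(1)] by (simp add: inner sum.delta)
  moreover have "?S = (\<Sum>k\<in>vspace E. \<Sum>f\<in>U. chi (form E f k))" by (rule sum.swap)
  moreover have "(\<Sum>k\<in>W. \<Sum>f\<in>U. chi (form E f k)) \<le> (\<Sum>k\<in>vspace E. \<Sum>f\<in>U. chi (form E f k))"
  proof (rule sum_mono2[OF vspace_card(1)[OF E] W(2)])
    fix k
    show "0 \<le> (\<Sum>f\<in>U. chi (form E f k))"
    proof (cases "\<exists>f\<in>U. form E f k = 1")
      case True
      then show ?thesis using sum_chi_eq_0[OF U(1), of "\<lambda>f. form E f k"] by (auto simp: form_add)
    next
      case False
      then have "\<forall>f\<in>U. form E f k = 0" by (metis bit_not_one_iff)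
      then show ?thesis by (simp add: chi_def)
    qed
  qed
  moreover have "(\<Sum>k\<in>W. \<Sum>f\<in>U. chi (form E f k)) = int (card W * card U)"
    by (simp add: orth chi_def)
  ultimately have "card W * card U \<le> 4 ^ card E"
    by (metis (mono_tags, lifting) of_nat_le_iff of_nat_numeral of_nat_power)
  also have "(4::nat) ^ card E = 2 ^ (2 * card E)" by (simp add: power_mult)
  finally have "(2::nat) ^ (dm W + dm U) \<le> 2 ^ (2 * card E)"
    by (simp add: card_dm U W power_add)
  then show ?thesis by simp
qed

section \<open>Lagrangian systems and their rank function\<close>

definition inside :: "'a kvec set \<Rightarrow> 'a set \<Rightarrow> 'a kvec set" where
  "inside L X = {f \<in> L. supp f \<subseteq> X}"

definition pin :: "'a kvec set \<Rightarrow> 'a \<Rightarrow> bit \<times> bit \<Rightarrow> 'a set \<Rightarrow> 'a kvec set" where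
  "pin L v p X = {f \<in> inside L X. f v = 0 \<or> f v = p}"

text \<open>
  The minor operation at \<open>v\<close>: confine the entry at \<open>v\<close> to a line, then forget \<open>v\<close>. For the system of a
  graph the line of \<open>(0, 1)\<close> deletes the vertex, and the line of \<open>(1, 0)\<close> pivots on an edge at the
  vertex and then deletes it.\<close>

definition removal :: "'a kvec set \<Rightarrow> 'a \<Rightarrow> bit \<times> bit \<Rightarrow> 'a kvec set" where
  "removal L v p = (\<lambda>f. f(v := 0)) ` {f \<in> L. f v = 0 \<or> f v = p}"

text \<open>
  For the system of a graph this is the cut-rank, see \<open>cut_rank_eq_rk\<close> below.\<close>

definition rk :: "'a kvec set \<Rightarrow> 'a set \<Rightarrow> int" where
  "rk L X = int (card X) - int (dm (inside L X))"

text \<open>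
  The rank of \<open>A\<close> in the removal (see \<open>removal_lagrangian\<close>), expressed through the vectors of \<open>L\<close>
  itself. In this form removals at different vertices and along different lines can be compared
  within one space.\<close>

definition prk :: "'a kvec set \<Rightarrow> 'a \<Rightarrow> bit \<times> bit \<Rightarrow> 'a set \<Rightarrow> int" where
  "prk L v p A = int (card A) - int (dm (pin L v p (insert v A)))"

lemma subgrp_inside: "subgrp L \<Longrightarrow> subgrp (inside L X)"
proof -
  assume L: "subgrp L"
  have "f + g \<in> inside L X" if "f \<in> inside L X" "g \<in> inside L X" for f g
    using that subgrpD(3)[OF L, of f g] supp_add[of f g] by (auto simp: inside_def)
  moreover have "0 \<in> inside L X" "finite (inside L X)"
    using subgrpD[OF L] by (auto simp: inside_def)
  ultimately show ?thesis by (simp add: subgrp_def)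
qed

lemma subgrp_pin: "subgrp L \<Longrightarrow> subgrp (pin L v p X)"
proof -
  assume "subgrp L"
  from subgrp_inside[OF this, of X] show ?thesis
    unfolding subgrp_def pin_def by auto
qed

lemma inside_add:
  assumes "subgrp L" "f \<in> inside L X" "g \<in> inside L Y"
  shows "f + g \<in> inside L (X \<union> Y)"
  using assms(2,3) subgrpD(3)[OF assms(1), of f g] supp_add[of f g] by (auto simp: inside_def)

lemma inside_insert_vanish: "f \<in> inside L (insert v X) \<Longrightarrow> f v = 0 \<Longrightarrow> f \<in> inside L X"
  by (auto simp: inside_def supp_def)

lemma inside_mono: "X \<subseteq> Y \<Longrightarrow> inside L X \<subseteq> inside L Y"
  by (auto simp: inside_def)

lemma inside_Int: "inside L X \<inter> inside L Y = inside L (X \<inter> Y)"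
  by (auto simp: inside_def)

definition cut_to :: "'a set \<Rightarrow> 'a kvec \<Rightarrow> 'a kvec" where
  "cut_to E f = (\<lambda>v. if v \<in> E then f v else 0)"

lemma cut_to_add: "cut_to E (f + g) = cut_to E f + cut_to E g"
  by (auto simp: cut_to_def fun_eq_iff)

lemma cut_to_eq_0_iff: "cut_to E f = 0 \<longleftrightarrow> supp f \<inter> E = {}"
  by (auto simp: cut_to_def fun_eq_iff supp_def)

lemma form_cut_to: "form E (cut_to E f) (cut_to E g) = form E f g"
  unfolding form_def by (rule sum.cong) (auto simp: cut_to_def)

lemma subgrp_image:
  assumes "subgrp A" "\<And>f g. \<phi> (f + g) = \<phi> f + \<phi> g"
  shows "subgrp (\<phi> ` A)"
proof -
  have "\<phi> 0 = 0" using assms(2)[of 0 0] by simp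
  then have "0 \<in> \<phi> ` A" using subgrpD(2)[OF assms(1)] by (metis image_eqI)
  moreover have "\<phi> f + \<phi> g \<in> \<phi> ` A" if "f \<in> A" "g \<in> A" for f g
    using assms(2)[of f g] subgrpD(3)[OF assms(1) that] by (metis image_eqI)
  ultimately show ?thesis using subgrpD(1)[OF assms(1)] by (auto simp: subgrp_def)
qed

lemma dm_image:
  assumes A: "subgrp A" and hom: "\<And>f g. \<phi> (f + g) = \<phi> f + \<phi> g"
    and B: "subgrp B" and sub: "\<And>f. f \<in> A \<Longrightarrow> \<phi> f = 0 \<Longrightarrow> f \<in> B"
  shows "dm A \<le> dm (\<phi> ` A) + dm B"
proof -
  have i: "subgrp (\<phi> ` A)" using A hom by (rule subgrp_image)
  have "\<phi> 0 = 0" using hom[of 0 0] by simp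
  then have K: "subgrp {f \<in> A. \<phi> f = 0}"
    using A hom unfolding subgrp_def by auto
  have "card A \<le> 2 ^ dm {f \<in> A. \<phi> f = 0} * card (\<phi> ` A)"
    by (rule dm_hom[OF A hom _ _ K]) (use subgrpD(1)[OF A] in auto)
  then have "(2::nat) ^ dm A \<le> 2 ^ (dm {f \<in> A. \<phi> f = 0} + dm (\<phi> ` A))"
    by (simp add: card_dm[OF A] card_dm[OF i] power_add)
  then have "dm A \<le> dm {f \<in> A. \<phi> f = 0} + dm (\<phi> ` A)"
    by (rule power_le_imp_le_exp[rotated]) simp
  moreover have "dm {f \<in> A. \<phi> f = 0} \<le> dm B" by (rule dm_mono[OF K B]) (use sub in auto)
  ultimately show ?thesis by simp
qed

lemma dm_inj_image:
  assumes A: "subgrp A" and hom: "\<And>f g. \<phi> (f + g) = \<phi> f + \<phi> g"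
    and inj: "\<And>f. f \<in> A \<Longrightarrow> \<phi> f = 0 \<Longrightarrow> f = 0"
  shows "dm (\<phi> ` A) = dm A"
proof (rule dm_eqI)
  have "inj_on \<phi> A"
  proof (rule inj_onI)
    fix f g assume "f \<in> A" "g \<in> A" "\<phi> f = \<phi> g"
    then have "\<phi> (f + g) = 0" "f + g \<in> A" using hom subgrpD(3)[OF A] by auto
    then have "f + g = 0" using inj by blast
    then show "f = g" by simp
  qed
  then show "card (\<phi> ` A) = 2 ^ dm A" by (simp add: card_image card_dm[OF A])
qed

lemma image_Collect_filter: "{x \<in> h ` S. P x} = h ` {x \<in> S. P (h x)}"
  by blast

text \<open>
  Totally isotropic subspaces of the largest possible dimension, also known as Bouchet's isotropic
  systems. A vector assigns an element of the plane to each vertex.\<close>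

locale lagrangian =
  fixes V :: "'a set" and L :: "'a kvec set"
  assumes fin_V: "finite V" and sub_L: "subgrp L"
    and supp_L: "f \<in> L \<Longrightarrow> supp f \<subseteq> V"
    and isotropic: "f \<in> L \<Longrightarrow> g \<in> L \<Longrightarrow> form V f g = 0"
    and card_L: "card L = 2 ^ card V"
begin

lemma fin: "X \<subseteq> V \<Longrightarrow> finite X"
  using fin_V by (rule finite_subset[rotated])

lemmas sub_inside = subgrp_inside[OF sub_L]
lemmas sub_pin = subgrp_pin[OF sub_L]

lemma inside_V: "inside L V = L"
  using supp_L by (auto simp: inside_def)

lemma dm_L: "dm L = card V"
  by (rule dm_eqI) (rule card_L)

lemma isotropic_on:
  assumes "f \<in> L" "g \<in> L" "supp f \<inter> supp g \<subseteq> D" "finite D"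
  shows "form D f g = 0"
proof -
  have "form D f g = form (D \<inter> V) f g"
    by (rule form_supp) (use assms supp_L in auto)
  also have "\<dots> = form V f g"
    by (rule form_supp[symmetric]) (use assms supp_L fin_V in auto)
  finally show ?thesis using isotropic assms by simp
qed

lemma isotropic_at:
  assumes "f \<in> L" "g \<in> L" "supp f \<inter> supp g \<subseteq> {v}"
  shows "symp (f v) (g v) = 0"
  using isotropic_on[OF assms] by (simp add: form_def)

lemma isotropic_at2:
  assumes "f \<in> L" "g \<in> L" "supp f \<inter> supp g \<subseteq> {u, v}" "u \<noteq> v"
  shows "symp (f u) (g u) = symp (f v) (g v)"
proof -
  have "symp (f u) (g u) + symp (f v) (g v) = 0"
    using isotropic_on[OF assms(1-3)] assms(4) by (simp add: form_def del: add_bit_eq_xor)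
  then show ?thesis by (cases "symp (f u) (g u)"; cases "symp (f v) (g v)") simp_all
qed

text \<open>
  The restrictions of the vectors of \<open>L\<close> to the complement \<open>E\<close> of \<open>X\<close> form a space of dimension
  \<open>card V - dm (inside L X)\<close>. By isotropy it is orthogonal to \<open>inside L E\<close>, and \<open>dm_orthogonal\<close>
  bounds the sum of the two dimensions.\<close>

lemma rk_sym_le:
  assumes X: "X \<subseteq> V"
  shows "rk L X \<le> rk L (V - X)"
proof -
  let ?E = "V - X"
  have fE: "finite ?E" using fin_V by simp
  have P: "subgrp (cut_to ?E ` L)" by (rule subgrp_image[OF sub_L cut_to_add])
  have "dm L \<le> dm (cut_to ?E ` L) + dm (inside L X)"
    by (rule dm_image[OF sub_L cut_to_add sub_inside])
      (use supp_L in \<open>auto simp: cut_to_eq_0_iff inside_def\<close>)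
  moreover have "dm (cut_to ?E ` L) + dm (inside L ?E) \<le> 2 * card ?E"
  proof (rule dm_orthogonal[OF fE P _ sub_inside])
    fix f g assume "f \<in> cut_to ?E ` L" and g: "g \<in> inside L ?E"
    then obtain h where h: "h \<in> L" "f = cut_to ?E h" by auto
    have "cut_to ?E g = g" using g by (auto simp: cut_to_def inside_def supp_def fun_eq_iff)
    then have "form ?E f g = form ?E h g" by (metis h(2) form_cut_to)
    also have "\<dots> = 0" by (rule isotropic_on) (use h g fE in \<open>auto simp: inside_def\<close>)
    finally show "form ?E f g = 0" .
  qed (auto simp: vspace_def inside_def cut_to_def supp_def split: if_splits)
  moreover have "card ?E = card V - card X" "card X \<le> card V"
    using X fin_V fin[OF X] by (simp_all add: card_Diff_subset card_mono)
  ultimately show ?thesis by (simp add: rk_def dm_L)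
qed

lemma rk_sym:
  assumes X: "X \<subseteq> V"
  shows "rk L (V - X) = rk L X"
proof -
  have "V - (V - X) = X" using X by auto
  then show ?thesis using rk_sym_le[OF X] rk_sym_le[of "V - X"] by simp
qed

lemma rk_submodular:
  assumes "X \<subseteq> V" "Y \<subseteq> V"
  shows "rk L (X \<inter> Y) + rk L (X \<union> Y) \<le> rk L X + rk L Y"
proof -
  have "dm (inside L X) + dm (inside L Y) \<le> dm (inside L X \<inter> inside L Y) + dm (inside L (X \<union> Y))"
    by (rule dm_modular[OF sub_inside sub_inside sub_inside])
      (rule inside_add[OF sub_L])
  then have "dm (inside L X) + dm (inside L Y) \<le> dm (inside L (X \<inter> Y)) + dm (inside L (X \<union> Y))"
    by (simp add: inside_Int)
  moreover have "card X + card Y = card (X \<union> Y) + card (X \<inter> Y)"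
    by (rule card_Un_Int) (use assms fin in auto)
  ultimately show ?thesis by (simp add: rk_def)
qed

text \<open>
  Confining the entry at \<open>v\<close> to a line costs at most one dimension, and forgetting \<open>v\<close> costs nothing
  since no nonzero vector lives on \<open>v\<close> alone. The result is isotropic, because entries on one line
  are orthogonal; hence its dimension cannot exceed \<open>card V - 1\<close> either.\<close>

lemma removal_lagrangian:
  assumes v: "v \<in> V" and p: "p \<noteq> 0" and ns: "\<And>f. f \<in> L \<Longrightarrow> supp f \<subseteq> {v} \<Longrightarrow> f = 0"
  shows "lagrangian (V - {v}) (removal L v p)"
    and "A \<subseteq> V - {v} \<Longrightarrow> rk (removal L v p) A = prk L v p A"
proof -
  let ?\<phi> = "\<lambda>f :: 'a kvec. f(v := 0)"
  have arith: "d = c" if "d = e" "n \<le> Suc e" "d + d \<le> 2 * c" "n = Suc c" for c d e n :: nat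
    using that by linarith
  have hom: "?\<phi> (f + g) = ?\<phi> f + ?\<phi> g" for f g by (auto simp: fun_eq_iff)
  have P: "removal L v p = ?\<phi> ` pin L v p V"
    by (auto simp: removal_def pin_def inside_V)
  have inj: "f = 0" if "f \<in> L" "?\<phi> f = 0" for f
  proof (rule ns[OF that(1)])
    show "supp f \<subseteq> {v}"
    proof
      fix u assume u: "u \<in> supp f"
      show "u \<in> {v}"
      proof (rule ccontr)
        assume "u \<notin> {v}"
        then have "?\<phi> f u = f u" by simp
        then show False using u that(2) by (simp add: supp_def)
      qed
    qed
  qed
  have sub: "subgrp (removal L v p)" unfolding P by (rule subgrp_image[OF sub_pin hom])
  have supp: "supp f \<subseteq> V - {v}" if f: "f \<in> removal L v p" for f
  proof -
    obtain g where g: "g \<in> L" "f = ?\<phi> g" using f unfolding removal_def by blast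
    then show ?thesis using supp_L[OF g(1)] by (auto simp: supp_def)
  qed
  have iso: "form (V - {v}) f g = 0" if fg: "f \<in> removal L v p" "g \<in> removal L v p" for f g
  proof -
    obtain f' g' where f': "f' \<in> L" "f' v = 0 \<or> f' v = p" "f = ?\<phi> f'"
      and g': "g' \<in> L" "g' v = 0 \<or> g' v = p" "g = ?\<phi> g'" using fg by (auto simp: removal_def)
    have "symp (f' v) (g' v) = 0" using f'(2) g'(2) by auto
    then have "form V f' g' = form (V - {v}) f' g'"
      unfolding form_def sum.remove[OF fin_V v] by simp
    moreover have "form (V - {v}) f' g' = form (V - {v}) f g"
      unfolding form_def by (rule sum.cong) (auto simp: f' g')
    ultimately show ?thesis using isotropic f'(1) g'(1) by simp
  qed
  have "dm L \<le> Suc (dm (pin L v p V))"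
  proof -
    obtain q where q: "symp p q = 1" using symp_nondegenerate[OF p] by blast
    show ?thesis
    proof (rule dm_index2[OF sub_L sub_pin, of "\<lambda>f. symp (f v) p" 1])
      fix f show "symp (f v) p = 0 \<or> symp (f v) p = 1" by (cases "symp (f v) p") auto
    next
      fix f assume "f \<in> L" "symp (f v) p = 0"
      then show "f \<in> pin L v p V" using p by (auto simp: pin_def inside_V symp_eq_0_iff)
    qed (simp only: plus_fun_def symp_add)
  qed
  have dm_\<phi>: "dm (?\<phi> ` pin L v p X) = dm (pin L v p X)" for X
  proof (rule dm_inj_image[OF sub_pin hom])
    fix f assume "f \<in> pin L v p X" "?\<phi> f = 0"
    moreover from this have "f \<in> L" by (simp add: pin_def inside_def)
    ultimately show "f = 0" using inj by blast
  qed
  have "dm (removal L v p) = dm (pin L v p V)" unfolding P by (rule dm_\<phi>)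
  moreover note \<open>dm L \<le> Suc (dm (pin L v p V))\<close>
  moreover have "dm (removal L v p) + dm (removal L v p) \<le> 2 * card (V - {v})"
  proof -
    have s: "removal L v p \<subseteq> vspace (V - {v})" using supp unfolding vspace_def by blast
    have fv: "finite (V - {v})" using fin_V by simp
    show ?thesis
    proof (rule dm_orthogonal[OF fv sub s sub s])
      fix f g assume "f \<in> removal L v p" "g \<in> removal L v p"
      then show "form (V - {v}) f g = 0" by (rule iso)
    qed
  qed
  moreover have "card V = Suc (card (V - {v}))" by (rule card.remove[OF fin_V v])
  ultimately have d: "dm (removal L v p) = card (V - {v})" unfolding dm_L by (rule arith)
  have c: "card (removal L v p) = 2 ^ card (V - {v})" using card_dm[OF sub] unfolding d .
  show "lagrangian (V - {v}) (removal L v p)"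
  proof (rule lagrangian.intro[OF finite_Diff[OF fin_V] sub _ _ c])
    fix f g assume "f \<in> removal L v p" "g \<in> removal L v p"
    then show "form (V - {v}) f g = 0" by (rule iso)
  qed (rule supp)
  assume A: "A \<subseteq> V - {v}"
  have "inside (removal L v p) A = ?\<phi> ` pin L v p (insert v A)"
  proof -
    have s: "supp (?\<phi> f) \<subseteq> A \<longleftrightarrow> supp f \<subseteq> insert v A" for f
      using A by (auto simp: supp_def)
    have "inside (removal L v p) A = ?\<phi> ` {f \<in> {f \<in> L. f v = 0 \<or> f v = p}. supp (?\<phi> f) \<subseteq> A}"
      unfolding inside_def removal_def by (rule image_Collect_filter)
    also have "{f \<in> {f \<in> L. f v = 0 \<or> f v = p}. supp (?\<phi> f) \<subseteq> A} = pin L v p (insert v A)"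
      unfolding s inside_def pin_def by blast
    finally show ?thesis .
  qed
  with dm_\<phi>[of "insert v A"] show "rk (removal L v p) A = prk L v p A" by (simp add: rk_def prk_def)
qed

end

section \<open>Weakly connected systems and their removals\<close>

lemma dm_pos_obtain:
  assumes "subgrp A" "0 < dm A"
  obtains f where "f \<in> A" "f \<noteq> 0"
proof -
  have "A \<noteq> {0}" using dm_0_iff[OF assms(1)] assms(2) by simp
  then show ?thesis using subgrpD(2)[OF assms(1)] that by blast
qed

lemma two_le_card: "finite X \<Longrightarrow> x \<in> X \<Longrightarrow> y \<in> X \<Longrightarrow> x \<noteq> y \<Longrightarrow> 2 \<le> card X"
  using card_mono[of X "{x, y}"] by simp

text \<open>
  The rank conditions that primeness and \<open>3\<^sup>+\<^sup>2\<close>-rank-connectedness impose on the system of a graph: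
  a set of rank at most 1 has fewer than 2 elements on one side, and a set of rank at most 2 has
  fewer than 5.\<close>

locale weakly_connected_system = lagrangian +
  assumes card_V: "10 \<le> card V"
    and rk_ge2: "\<lbrakk>X \<subseteq> V; 2 \<le> card X; 2 \<le> card (V - X)\<rbrakk> \<Longrightarrow> 2 \<le> rk L X"
    and rk_ge3: "\<lbrakk>X \<subseteq> V; 5 \<le> card X; 5 \<le> card (V - X)\<rbrakk> \<Longrightarrow> 3 \<le> rk L X"
begin

lemma card_compl: "X \<subseteq> V \<Longrightarrow> card (V - X) = card V - card X"
  by (simp add: card_Diff_subset fin)

lemma card_add_compl: "X \<subseteq> V \<Longrightarrow> card X + card (V - X) = card V"
  using card_compl[of X] card_mono[OF fin_V, of X] by simp

lemma in_Diff:
  assumes "A \<subseteq> V - {v}"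
  shows "A \<subseteq> V" "finite A" "v \<notin> A"
proof -
  show "A \<subseteq> V" "v \<notin> A" using assms by auto
  then show "finite A" using fin by blast
qed

text \<open>
  A nonzero vector inside a 2-set would give that set rank at most 1.\<close>

lemma supp_card_ge3:
  assumes f: "f \<in> L" "f \<noteq> 0"
  shows "3 \<le> card (supp f)"
proof (rule ccontr)
  assume "\<not> 3 \<le> card (supp f)"
  then obtain X where X: "supp f \<subseteq> X" "X \<subseteq> V" "card X = 2"
    using exists_subset_between[of "supp f" 2 V] supp_L[OF f(1)] fin_V card_V by auto
  then have "2 \<le> rk L X" using rk_ge2[of X] card_V card_compl[of X] by simp
  then have "dm (inside L X) = 0" using X(3) by (simp add: rk_def)
  then have "inside L X = {0}" using dm_0_iff sub_inside by blast
  moreover have "f \<in> inside L X" using f(1) X(1) by (simp add: inside_def)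
  ultimately show False using f(2) by simp
qed

lemma no_single: "f \<in> L \<Longrightarrow> supp f \<subseteq> {v} \<Longrightarrow> f = 0"
  using supp_card_ge3[of f] card_mono[of "{v}" "supp f"] by fastforce

lemma inside_card3:
  assumes "f \<in> inside L X" "f \<noteq> 0" "card X = 3"
  shows "supp f = X"
proof (rule card_seteq)
  show "finite X" using assms(3) by (simp add: card_ge_0_finite)
  show "supp f \<subseteq> X" "card X \<le> card (supp f)"
    using assms supp_card_ge3[of f] by (auto simp: inside_def)
qed

text \<open>
  A \<^emph>\<open>triple\<close> is a vector of \<open>L\<close> with a support of three elements, the least possible size. By this
  lemma and the next one, the supports of triples are precisely the 3-sets of rank at most 2.\<close>

lemma rk_triple:
  assumes "f \<in> L" "card (supp f) = 3"
  shows "rk L (supp f) \<le> 2"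
proof -
  have "f \<in> inside L (supp f)" using assms by (simp add: inside_def)
  moreover have "f \<noteq> 0" using assms by auto
  ultimately have "dm (inside L (supp f)) \<noteq> 0" using dm_0_iff[OF sub_inside] by blast
  then show ?thesis using assms(2) by (simp add: rk_def)
qed

lemma rk_card3_triple:
  assumes "card X = 3" "rk L X \<le> 2"
  obtains f where "f \<in> L" "supp f = X"
proof -
  have "0 < dm (inside L X)" using assms by (simp add: rk_def)
  then obtain f where f: "f \<in> inside L X" "f \<noteq> 0" using dm_pos_obtain[OF sub_inside] by blast
  show ?thesis by (rule that[OF _ inside_card3[OF f assms(1)]]) (use f in \<open>simp add: inside_def\<close>)
qed

text \<open>
  This is how several contradictions arise: if all vectors inside a set of rank at most 3 miss one
  of its elements, then dropping that element leaves a set of rank at most 2.\<close>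

lemma rk_remove_vanishing:
  assumes "e \<in> X" "X \<subseteq> V" "\<And>f. f \<in> inside L X \<Longrightarrow> f e = 0"
  shows "rk L (X - {e}) = rk L X - 1"
proof -
  have "inside L (X - {e}) = inside L X"
  proof
    show "inside L X \<subseteq> inside L (X - {e})"
      using assms(3) by (auto simp: inside_def supp_def)
  qed (rule inside_mono, blast)
  moreover have "card X = Suc (card (X - {e}))" by (rule card.remove[OF fin[OF assms(2)] assms(1)])
  ultimately show ?thesis by (simp add: rk_def)
qed

text \<open>
  Uncrossing: the intersection has rank at least 2, so submodularity leaves at most 2 for the
  union.\<close>

lemma rk2_Un:
  assumes "X \<subseteq> V" "Y \<subseteq> V" "rk L X \<le> 2" "rk L Y \<le> 2" "2 \<le> card (X \<inter> Y)" "card (X \<inter> Y) + 2 \<le> card V"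
  shows "rk L (X \<union> Y) \<le> 2"
proof -
  have "X \<inter> Y \<subseteq> V" using assms by blast
  then have "2 \<le> rk L (X \<inter> Y)" using assms(5,6) card_compl[of "X \<inter> Y"] by (intro rk_ge2) linarith+
  then show ?thesis using rk_submodular[OF assms(1,2)] assms(3,4) by simp
qed

lemma rk2_Un_small:
  assumes "X \<subseteq> V" "Y \<subseteq> V" "rk L X \<le> 2" "rk L Y \<le> 2" "2 \<le> card (X \<inter> Y)" "card (X \<union> Y) + 5 \<le> card V"
  shows "card (X \<union> Y) \<le> 4"
proof (rule ccontr)
  assume "\<not> card (X \<union> Y) \<le> 4"
  moreover have "card (X \<inter> Y) \<le> card (X \<union> Y)"
    using assms fin by (intro card_mono) auto
  then have "rk L (X \<union> Y) \<le> 2" using assms by (intro rk2_Un) auto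
  moreover have "X \<union> Y \<subseteq> V" using assms by blast
  ultimately show False
    using rk_ge3[of "X \<union> Y"] assms(6) card_compl[of "X \<union> Y"] by linarith
qed

lemma prk_sym:
  assumes "v \<in> V" "p \<noteq> 0" "A \<subseteq> V - {v}"
  shows "prk L v p (V - {v} - A) = prk L v p A"
proof -
  interpret R: lagrangian "V - {v}" "removal L v p"
    by (rule removal_lagrangian(1)[OF assms(1,2)]) (rule no_single)
  have r: "rk (removal L v p) X = prk L v p X" if "X \<subseteq> V - {v}" for X
    by (rule removal_lagrangian(2)[OF assms(1,2) _ that]) (rule no_single)
  show ?thesis using R.rk_sym[OF assms(3)] r[OF assms(3)] r[of "V - {v} - A"] by simp
qed

lemma rk_insert_le_prk:
  assumes "v \<in> V" "A \<subseteq> V - {v}"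
  shows "rk L (insert v A) \<le> prk L v p A + 1"
proof -
  have "dm (pin L v p (insert v A)) \<le> dm (inside L (insert v A))"
    by (rule dm_mono[OF sub_pin sub_inside]) (auto simp: pin_def)
  moreover have "finite A" "v \<notin> A" using assms fin by auto
  ultimately show ?thesis by (simp add: rk_def prk_def)
qed

lemma dm_pin_le:
  assumes "v \<notin> A"
  shows "dm (pin L v p (insert v A)) \<le> Suc (dm (inside L A))"
proof (rule dm_index2[OF sub_pin sub_inside, where \<phi> = "\<lambda>f. f v" and c = p])
  fix f assume "f \<in> pin L v p (insert v A)" "f v = 0"
  then show "f \<in> inside L A" by (auto simp: pin_def inside_def supp_def)
qed (auto simp: pin_def)

lemma rk_le_prk:
  assumes "v \<in> V" "A \<subseteq> V - {v}"
  shows "rk L A \<le> prk L v p A + 1"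
  using dm_pin_le[OF in_Diff(3)[OF assms(2)], of p] by (simp add: rk_def prk_def)

lemma rk_insert_le_prk_strict:
  assumes "v \<in> V" "A \<subseteq> V - {v}" "f \<in> L" "supp f \<subseteq> insert v A" "f v \<noteq> 0" "f v \<noteq> p"
  shows "rk L (insert v A) \<le> prk L v p A"
proof -
  have "Suc (dm (pin L v p (insert v A))) \<le> dm (inside L (insert v A))"
    by (rule dm_Suc_le[OF sub_pin sub_inside, of _ _ _ _ f])
      (use assms in \<open>auto simp: pin_def inside_def\<close>)
  moreover have "finite A" "v \<notin> A" using assms fin by auto
  ultimately show ?thesis by (simp add: rk_def prk_def)
qed

text \<open>
  Two distinct lines at \<open>v\<close> meet in 0 only. So a vector that counts for \<open>A\<close> along \<open>p\<close> and for \<open>C\<close> along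
  \<open>q\<close> vanishes at \<open>v\<close> and lives on \<open>A \<inter> C\<close>. This is the exchange between the two removals of one
  vertex.\<close>

lemma prk_cross:
  assumes v: "v \<in> V" and pq: "p \<noteq> q" and A: "A \<subseteq> V - {v}" and C: "C \<subseteq> V - {v}"
  shows "rk L (A \<inter> C) + rk L (V - {v} - (A \<union> C)) \<le> prk L v p A + prk L v q C + 1"
proof -
  have "dm (pin L v p (insert v A)) + dm (pin L v q (insert v C))
      \<le> dm (pin L v p (insert v A) \<inter> pin L v q (insert v C)) + dm (inside L (insert v (A \<union> C)))"
  proof (rule dm_modular[OF sub_pin sub_pin sub_inside])
    fix f g assume "f \<in> pin L v p (insert v A)" "g \<in> pin L v q (insert v C)"
    then have "f + g \<in> inside L (insert v A \<union> insert v C)"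
      by (intro inside_add[OF sub_L]) (auto simp: pin_def)
    then show "f + g \<in> inside L (insert v (A \<union> C))" by simp
  qed
  moreover have "dm (pin L v p (insert v A) \<inter> pin L v q (insert v C)) \<le> dm (inside L (A \<inter> C))"
    by (rule dm_mono[OF subgrp_Int[OF sub_pin sub_pin] sub_inside])
      (use pq A C in \<open>auto simp: pin_def inside_def supp_def\<close>)
  moreover have "V - insert v (A \<union> C) = V - {v} - (A \<union> C)" by auto
  then have "rk L (V - {v} - (A \<union> C)) = rk L (insert v (A \<union> C))"
    using rk_sym[of "insert v (A \<union> C)"] A C v by auto
  moreover have "finite A" "finite C" "v \<notin> A" "v \<notin> C" using in_Diff[OF A] in_Diff[OF C] by auto
  moreover from this have "card A + card C = card (A \<union> C) + card (A \<inter> C)" by (intro card_Un_Int)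
  ultimately show ?thesis by (simp add: rk_def prk_def)
qed

definition prime_removal :: "'a \<Rightarrow> bit \<times> bit \<Rightarrow> bool" where
  "prime_removal v p \<longleftrightarrow> (\<forall>A \<subseteq> V - {v}. 2 \<le> card A \<longrightarrow> 2 \<le> card (V - {v} - A) \<longrightarrow> 2 \<le> prk L v p A)"

text \<open>
  The bound of four elements on the smaller side of a set of rank at most 2 worsens by at most one.\<close>

definition weak_removal :: "'a \<Rightarrow> bit \<times> bit \<Rightarrow> bool" where
  "weak_removal v p \<longleftrightarrow> (\<forall>A \<subseteq> V - {v}. 6 \<le> card A \<longrightarrow> 6 \<le> card (V - {v} - A) \<longrightarrow> 3 \<le> prk L v p A)"

lemma card_removal_compl:
  assumes "v \<in> V" "A \<subseteq> V - {v}"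
  shows "card A + card (V - {v} - A) + 1 = card V"
proof -
  have "card (V - {v} - A) = card (V - {v}) - card A" using assms(2) fin by (intro card_Diff_subset) auto
  moreover have "card A \<le> card (V - {v})" using assms(2) fin_V by (intro card_mono) auto
  moreover have "card V = Suc (card (V - {v}))" by (rule card.remove[OF fin_V assms(1)])
  ultimately show ?thesis by simp
qed

text \<open>
  As \<open>t\<close> and \<open>m\<close> are orthogonal and the three values \<open>symp (t e) (m e)\<close> over the support of \<open>t\<close> sum to
  0, one of them is 0. At that \<open>e\<close> the entry of \<open>m\<close> is 0 or that of \<open>t\<close>, so \<open>m\<close> or \<open>t + m\<close> vanishes
  there and is a triple.\<close>

lemma triple_shrink:
  assumes t: "t \<in> L" "card (supp t) = 3" and m: "m \<in> L" "supp m \<subseteq> insert d (supp t)"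
    and d: "d \<notin> supp t" "m d \<noteq> 0"
  obtains g where "g \<in> L" "card (supp g) = 3" "g d = m d" "supp g \<subseteq> insert d (supp t)"
proof -
  have fin_T: "finite (supp t)" using t(2) by (simp add: card_ge_0_finite)
  obtain a b c where T: "supp t = {a, b, c}" "a \<noteq> b" "a \<noteq> c" "b \<noteq> c"
    using t(2) card_3_iff by metis
  have "form (supp t) t m = 0" by (rule isotropic_on[OF t(1) m(1) _ fin_T]) blast
  then have "symp (t a) (m a) + (symp (t b) (m b) + symp (t c) (m c)) = 0"
    using T by (simp add: form_def del: add_bit_eq_xor)
  then have "\<exists>e\<in>supp t. symp (t e) (m e) = 0"
    unfolding T(1) by (cases "symp (t a) (m a)"; cases "symp (t b) (m b)"; cases "symp (t c) (m c)") auto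
  then obtain e where e: "e \<in> supp t" "m e = 0 \<or> m e = t e"
    unfolding symp_eq_0_iff supp_def by (metis mem_Collect_eq)
  define g where "g = (if m e = 0 then m else t + m)"
  have td: "t d = 0" using d(1) by (simp add: supp_def)
  have gL: "g \<in> L" using t(1) m(1) subgrpD(3)[OF sub_L] by (simp add: g_def)
  have gd: "g d = m d" using td by (simp add: g_def)
  have ge: "g e = 0" using e(2) by (auto simp: g_def)
  have gs: "supp g \<subseteq> insert d (supp t)" using m(2) supp_add[of t m] by (auto simp: g_def)
  then have "supp g \<subseteq> insert d (supp t) - {e}" using ge by (auto simp: supp_def)
  then have "card (supp g) \<le> card (insert d (supp t) - {e})" using fin_T by (intro card_mono) auto
  also have "\<dots> = 3" using e(1) fin_T t(2) d(1) by (simp add: card_Diff_singleton)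
  finally have "card (supp g) \<le> 3" .
  moreover have "g \<noteq> 0" using gd d(2) by auto
  then have "3 \<le> card (supp g)" by (rule supp_card_ge3[OF gL])
  ultimately show ?thesis using that gL gd gs by simp
qed

text \<open>
  A side \<open>A\<close> with two elements directly yields a vector supported by \<open>A\<close> and \<open>v\<close>. With three elements
  there are two independent vectors: a triple on \<open>A\<close> and a vector through \<open>v\<close>, which
  \<open>triple_shrink\<close> combines into a triple through \<open>v\<close>.\<close>

lemma not_prime_removal_small:
  assumes v: "v \<in> V" and A: "A \<subseteq> V - {v}" "2 \<le> card A" "card A \<le> 3" and r: "prk L v p A \<le> 1"
  shows "\<exists>f\<in>L. card (supp f) = 3 \<and> f v = p"
proof -
  have fA: "finite A" "v \<notin> A" using A fin by auto
  consider "card A = 2" | "card A = 3" using A by linarith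
  then show ?thesis
  proof cases
    case 1
    have "0 < dm (pin L v p (insert v A))" using r 1 by (simp add: prk_def)
    then obtain f where f: "f \<in> pin L v p (insert v A)" "f \<noteq> 0" using dm_pos_obtain[OF sub_pin] by blast
    then have "supp f = insert v A"
      using inside_card3[of f "insert v A"] 1 fA by (simp add: pin_def)
    then show ?thesis using f 1 fA by (auto simp: pin_def inside_def supp_def intro!: bexI[of _ f])
  next
    case 3: 2
    have p2: "2 \<le> dm (pin L v p (insert v A))" using r 3 by (simp add: prk_def)
    have "2 \<le> rk L A" using in_Diff[OF A(1)] 3 card_V card_compl[of A] by (intro rk_ge2) linarith+
    then have i1: "dm (inside L A) \<le> 1" using 3 by (simp add: rk_def)
    have "\<exists>f\<in>pin L v p (insert v A). f v = p \<and> f v \<noteq> 0"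
    proof (rule ccontr)
      assume "\<not> ?thesis"
      then have "pin L v p (insert v A) \<subseteq> inside L A" by (auto simp: pin_def inside_def supp_def)
      then have "dm (pin L v p (insert v A)) \<le> dm (inside L A)" by (rule dm_mono[OF sub_pin sub_inside])
      then show False using p2 i1 by simp
    qed
    then obtain m where m: "m \<in> L" "supp m \<subseteq> insert v A" "m v = p" "p \<noteq> 0" by (auto simp: pin_def inside_def)
    have "0 < dm (inside L A)" using dm_pin_le[OF fA(2), of p] p2 by simp
    then obtain t where t: "t \<in> inside L A" "t \<noteq> 0" using dm_pos_obtain[OF sub_inside] by blast
    have tA: "supp t = A" by (rule inside_card3[OF t 3])
    have mv: "m v \<noteq> 0" using m by simp
    have "t \<in> L" "card (supp t) = 3" "supp m \<subseteq> insert v (supp t)" "v \<notin> supp t"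
      using t m(2) 3 fA(2) by (simp_all add: tA) (simp add: inside_def)
    from triple_shrink[OF this(1,2) m(1) this(3,4) mv] show ?thesis using m(3) by metis
  qed
qed

text \<open>
  If neither side of a split of the removal has at most three elements, then adding \<open>v\<close> to one of
  them gives a set of rank at most 2 with at least five elements on both sides.\<close>

lemma not_prime_removal:
  assumes v: "v \<in> V" and p: "p \<noteq> 0" and np: "\<not> prime_removal v p"
  obtains f where "f \<in> L" "card (supp f) = 3" "f v = p"
proof -
  obtain A where A: "A \<subseteq> V - {v}" "2 \<le> card A" "2 \<le> card (V - {v} - A)" "prk L v p A \<le> 1"
    using np by (force simp: prime_removal_def)
  let ?B = "V - {v} - A"
  have B: "?B \<subseteq> V - {v}" "prk L v p ?B \<le> 1" using A prk_sym[OF v p A(1)] by auto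
  note s = card_removal_compl[OF v A(1)]
  have VB: "V - insert v A = ?B" "V - insert v ?B = A" using A(1) v by auto
  have cA: "card (insert v A) = card A + 1" "card (insert v ?B) = card ?B + 1"
    using in_Diff[OF A(1)] in_Diff[OF B(1)] by simp_all
  have "card A \<le> 3 \<or> card ?B \<le> 4"
  proof (rule ccontr)
    assume "\<not> ?thesis"
    then have "3 \<le> rk L (insert v A)" using cA VB A(1) v by (intro rk_ge3) auto
    then show False using rk_insert_le_prk[OF v A(1), of p] A(4) by simp
  qed
  moreover have "card ?B \<le> 3 \<or> card A \<le> 4"
  proof (rule ccontr)
    assume "\<not> ?thesis"
    then have "3 \<le> rk L (insert v ?B)" using cA VB B(1) v by (intro rk_ge3) auto
    then show False using rk_insert_le_prk[OF v B(1), of p] B(2) by simp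
  qed
  ultimately have "card A \<le> 3 \<or> card ?B \<le> 3" using s card_V by linarith
  then show ?thesis
    using not_prime_removal_small[OF v A(1,2) _ A(4)] not_prime_removal_small[OF v B(1) A(3) _ B(2)] that
    by blast
qed

lemma not_weak_removal:
  assumes "v \<in> V" "\<not> weak_removal v p"
  obtains A where "A \<subseteq> V - {v}" "6 \<le> card A" "6 \<le> card (V - {v} - A)" "prk L v p A \<le> 2"
  using assms by (force simp: weak_removal_def)

text \<open>
  A vector supported by \<open>insert v A\<close> that is not confined to the line at \<open>v\<close> is one that the removal
  does not count, so it lowers the rank of \<open>insert v A\<close> to at most 2.\<close>

lemma weak_removal_fail_rk:
  assumes v: "v \<in> V" and A: "A \<subseteq> V - {v}" "6 \<le> card A" "6 \<le> card (V - {v} - A)" "prk L v p A \<le> 2"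
    and f: "f \<in> L" "f v \<noteq> 0" "f v \<noteq> p"
  shows "\<not> supp f \<subseteq> insert v A"
proof
  assume "supp f \<subseteq> insert v A"
  then have "rk L (insert v A) \<le> 2"
    using rk_insert_le_prk_strict[OF v A(1) f(1) _ f(2,3)] A(4) by simp
  moreover have "3 \<le> rk L (insert v A)"
  proof (rule rk_ge3)
    have "V - insert v A = V - {v} - A" by auto
    then show "5 \<le> card (V - insert v A)" using A(3) by simp
    show "insert v A \<subseteq> V" using v A(1) by auto
    show "5 \<le> card (insert v A)" using A(2) card_insert_le[of A v] by linarith
  qed
  ultimately show False by simp
qed

text \<open>
  Take a set of rank at most 2 in each of the two removals. By \<open>prk_cross\<close> the ranks of two opposite
  corners of the two partitions sum to at most 5, so each of the two pairs of opposite corners has a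
  corner of rank at most 2. Two such corners are adjacent: together they make up one side of one of
  the two partitions.\<close>

lemma crossing:
  assumes v: "v \<in> V" and pq: "p \<noteq> q" "p \<noteq> 0" "q \<noteq> 0"
    and np: "\<not> weak_removal v p" and nq: "\<not> weak_removal v q"
  obtains r A C where "r = p \<or> r = q" "A \<subseteq> V - {v}" "6 \<le> card A" "6 \<le> card (V - {v} - A)"
    "prk L v r A \<le> 2" "rk L (A \<inter> C) \<le> 2" "rk L (A - C) \<le> 2"
proof -
  obtain A where A: "A \<subseteq> V - {v}" "6 \<le> card A" "6 \<le> card (V - {v} - A)" "prk L v p A \<le> 2"
    using not_weak_removal[OF v np] .
  obtain C where C: "C \<subseteq> V - {v}" "6 \<le> card C" "6 \<le> card (V - {v} - C)" "prk L v q C \<le> 2"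
    using not_weak_removal[OF v nq] .
  define B where "B = V - {v} - A"
  define D where "D = V - {v} - C"
  have B: "B \<subseteq> V - {v}" "6 \<le> card B" "6 \<le> card (V - {v} - B)" "prk L v p B \<le> 2"
    and D: "D \<subseteq> V - {v}" "6 \<le> card D" "6 \<le> card (V - {v} - D)" "prk L v q D \<le> 2"
    using A C prk_sym[OF v pq(2) A(1)] prk_sym[OF v pq(3) C(1)] double_diff[OF A(1)] double_diff[OF C(1)]
    by (auto simp: B_def D_def)
  have e: "V - {v} - (A \<union> C) = B \<inter> D" "V - {v} - (A \<union> D) = B \<inter> C" "A \<inter> D = A - C" "D - A = D \<inter> B"
    "B - C = B \<inter> D" "C - A = C \<inter> B"
    using A(1) C(1) by (auto simp: B_def D_def)
  have "rk L (A \<inter> C) + rk L (B \<inter> D) \<le> 5" "rk L (A \<inter> D) + rk L (B \<inter> C) \<le> 5"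
    using prk_cross[OF v pq(1) A(1) C(1)] prk_cross[OF v pq(1) A(1) D(1)] A(4) C(4) D(4) e by auto
  then consider "rk L (A \<inter> C) \<le> 2" "rk L (A \<inter> D) \<le> 2" | "rk L (A \<inter> C) \<le> 2" "rk L (B \<inter> C) \<le> 2"
    | "rk L (B \<inter> D) \<le> 2" "rk L (A \<inter> D) \<le> 2" | "rk L (B \<inter> D) \<le> 2" "rk L (B \<inter> C) \<le> 2"
    by linarith
  then show ?thesis
  proof cases
    case 1 then show ?thesis using that[of p A C] A e by simp
  next
    case 2 then show ?thesis using that[of q C A] C e by (simp add: Int_commute)
  next
    case 3 then show ?thesis using that[of q D A] D e by (simp add: Int_commute)
  next
    case 4 then show ?thesis using that[of p B C] B e by simp
  qed
qed

section \<open>Sets of four elements and rank two\<close>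

lemma isotropic_other:
  assumes "f \<in> L" "g \<in> L" "symp (f v) (g v) \<noteq> 0"
  obtains e where "e \<noteq> v" "e \<in> supp f" "e \<in> supp g"
proof -
  have "\<not> supp f \<inter> supp g \<subseteq> {v}" using isotropic_at[OF assms(1,2)] assms(3) by blast
  then show ?thesis using that by blast
qed

text \<open>
  Being orthogonal, \<open>f\<close> and \<open>g\<close> cannot have a conflict, that is entries that are not orthogonal, at \<open>v\<close>
  alone. So the support of \<open>g\<close> meets \<open>F\<close> in at
  least two elements, and the two sets of rank 2 can be uncrossed.\<close>

lemma conflicting_triple:
  assumes F: "F \<subseteq> V" "card F \<le> 4" "rk L F \<le> 2" and f: "f \<in> L" "supp f \<subseteq> F"
    and g: "g \<in> L" "card (supp g) = 3" "symp (f v) (g v) \<noteq> 0"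
  shows "card (supp g \<union> F) \<le> 4"
proof (rule rk2_Un_small[OF supp_L[OF g(1)] F(1) rk_triple[OF g(1,2)] F(3)])
  have fF: "finite F" using F fin by auto
  obtain e where e: "e \<noteq> v" "e \<in> supp f" "e \<in> supp g" using isotropic_other[OF f(1) g(1,3)] .
  have "v \<in> supp f" "v \<in> supp g" using g(3) by (auto simp: supp_def)
  then show c: "2 \<le> card (supp g \<inter> F)" using e f(2) fF by (intro two_le_card[of _ e v]) auto
  have "card (supp g) + card F = card (supp g \<union> F) + card (supp g \<inter> F)"
    using fF fin[OF supp_L[OF g(1)]] by (intro card_Un_Int)
  then show "card (supp g \<union> F) + 5 \<le> card V" using c F(2) g(2) card_V by linarith
qed

text \<open>
  The triple \<open>t\<close> misses an element \<open>d\<close> of \<open>F\<close>. Inside \<open>F\<close> there is a second triple \<open>t'\<close> through \<open>d\<close>; it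
  misses an element \<open>c\<close>, and the two triples differ on both common elements \<open>a\<close> and \<open>b\<close>. Remove \<open>c\<close>
  along any line \<open>q\<close> not containing \<open>t c\<close>. A triple with entry \<open>q\<close> at \<open>c\<close> would conflict with \<open>t\<close>, hence lie inside \<open>F\<close>, where there is no
  room for a third independent vector; so the removal is prime. If it were not weak, then by
  \<open>weak_removal_fail_rk\<close> the two sides would separate \<open>a\<close> from \<open>b\<close>, and the side that contains \<open>d\<close>
  could absorb all of \<open>F\<close> without exceeding rank 2.\<close>

lemma fan_removal:
  assumes F: "F \<subseteq> V" "card F = 4" "rk L F \<le> 2" and t: "t \<in> L" "card (supp t) = 3" "supp t \<subseteq> F"
  shows "\<exists>c\<in>V. \<forall>q. q \<noteq> 0 \<longrightarrow> q \<noteq> t c \<longrightarrow> prime_removal c q \<and> weak_removal c q"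
proof -
  have fF: "finite F" using F fin by auto
  have "card (F - supp t) = 1" using F t fF by (simp add: card_Diff_subset finite_subset)
  then obtain d where d: "F - supp t = {d}" using card_1_singletonE by blast
  have dF: "d \<in> F" "d \<notin> supp t" "F = insert d (supp t)" using d t(3) by auto
  have "2 \<le> rk L (supp t)" using supp_L[OF t(1)] t(2) card_V card_compl[of "supp t"]
    by (intro rk_ge2) linarith+
  then have "dm (inside L (supp t)) < dm (inside L F)" using F t(2) by (simp add: rk_def)
  then have "\<not> inside L F \<subseteq> inside L (supp t)"
    using dm_mono[OF sub_inside sub_inside] by (meson leD)
  then obtain m where m: "m \<in> inside L F" "m \<notin> inside L (supp t)" by blast
  have md: "m \<in> L" "supp m \<subseteq> insert d (supp t)" "m d \<noteq> 0"
    using m dF by (auto simp: inside_def supp_def)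
  obtain t' where t': "t' \<in> L" "card (supp t') = 3" "t' d = m d" "supp t' \<subseteq> F"
    using triple_shrink[OF t(1,2) md(1,2) dF(2) md(3)] dF(3) by metis
  have "card (F - supp t') = 1" using F t' fF by (simp add: card_Diff_subset finite_subset)
  then obtain c where c: "F - supp t' = {c}" using card_1_singletonE by blast
  have cd: "c \<noteq> d" "c \<in> supp t" "c \<in> F" "c \<in> V" using c t'(3) md(3) dF F by (auto simp: supp_def)
  have "card (F - {c, d}) = 2" using F cd dF fF by (simp add: card_Diff_subset)
  then obtain a b where ab: "F - {c, d} = {a, b}" "a \<noteq> b" by (meson card_2_iff)
  have Fe: "F = {a, b, c, d}" "a \<noteq> c" "a \<noteq> d" "b \<noteq> c" "b \<noteq> d" using ab cd dF by auto
  have st: "supp t = {a, b, c}" using d Fe cd t(3) by auto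
  have st': "supp t' = {a, b, d}" using c Fe cd t'(4) by auto
  have nz: "t a \<noteq> 0" "t b \<noteq> 0" "t c \<noteq> 0" "t' a \<noteq> 0" "t' b \<noteq> 0" "t' d \<noteq> 0"
    using st st' unfolding supp_def by blast+
  have z: "t d = 0" "t' c = 0" using dF(2) c unfolding supp_def by blast+
  have tt': "t a \<noteq> t' a" "t b \<noteq> t' b"
  proof -
    have eq: "symp (t a) (t' a) = symp (t b) (t' b)"
      by (rule isotropic_at2[OF t(1) t'(1) _ ab(2)]) (use st st' cd in auto)
    have "t a \<noteq> t' a \<or> t b \<noteq> t' b"
    proof (rule ccontr)
      assume "\<not> ?thesis"
      then have "supp (t + t') \<subseteq> {c, d}" using supp_add[of t t'] st st' by (auto simp: supp_def)
      then have "card (supp (t + t')) \<le> 2" using card_mono[of "{c, d}" "supp (t + t')"] cd by simp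
      moreover have "(t + t') c \<noteq> 0" using z nz by simp
      then have "t + t' \<noteq> 0" by auto
      ultimately show False using supp_card_ge3[of "t + t'"] t t' subgrpD(3)[OF sub_L] by fastforce
    qed
    then show "t a \<noteq> t' a" "t b \<noteq> t' b" using eq nz by (metis symp_eq_0_iff)+
  qed
  show ?thesis
  proof (intro bexI[OF _ cd(4)] allI impI)
    fix q assume q: "q \<noteq> 0" "q \<noteq> t c"
    have no_triple: "g c \<noteq> q" if g: "g \<in> L" "card (supp g) = 3" for g
    proof
      assume gc: "g c = q"
      have conf: "symp (t c) (g c) \<noteq> 0" using gc q nz by (auto simp: symp_eq_0_iff)
      have "card (supp g \<union> F) \<le> card F"
        using conflicting_triple[OF F(1) _ F(3) t(1,3) g conf] F(2) by simp
      then have "F = supp g \<union> F" using fF fin[OF supp_L[OF g(1)]] by (intro card_seteq) auto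
      then have gF: "supp g \<subseteq> F" by blast
      have "0 < dm (inside L (supp t'))" using rk_triple[OF t'(1,2)] t'(2) by (simp add: rk_def)
      moreover have "Suc (dm (inside L (supp t'))) \<le> dm (pin L c (t c) F)"
        by (rule dm_Suc_le[OF sub_inside sub_pin, of _ _ _ _ t])
          (use st st' t t' z cd in \<open>auto simp: inside_def pin_def supp_def\<close>)
      moreover have "Suc (dm (pin L c (t c) F)) \<le> dm (inside L F)"
        by (rule dm_Suc_le[OF sub_pin sub_inside, of _ _ _ _ g])
          (use g gF gc q in \<open>auto simp: inside_def pin_def\<close>)
      moreover have "dm (inside L F) \<le> 2"
        using rk_ge2[of F] F card_V card_compl[OF F(1)] by (simp add: rk_def)
      ultimately show False by linarith
    qed
    \<comment> \<open>The side containing \<open>d\<close> absorbs \<open>F\<close>: the vectors inside \<open>F\<close> are independent of those counted before.\<close>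
    have key: False if A: "A \<subseteq> V - {c}" "6 \<le> card A" "6 \<le> card (V - {c} - A)" "prk L c q A \<le> 2"
      and xy: "x \<in> A" "d \<in> A" "y \<notin> A" "{x, y} = {a, b}" for A x y
    proof -
      have yV: "y \<in> V" "y \<noteq> c" and xy': "x \<noteq> y" "x \<noteq> c" using xy Fe F ab(2) by (auto simp: doubleton_eq_iff)
      let ?Y = "insert y (insert c A)"
      have "dm (pin L c q (insert c A)) + dm (inside L F)
          \<le> dm (pin L c q (insert c A) \<inter> inside L F) + dm (inside L ?Y)"
      proof (rule dm_modular[OF sub_pin sub_inside sub_inside])
        fix f g assume "f \<in> pin L c q (insert c A)" "g \<in> inside L F"
        then have "f + g \<in> inside L (insert c A \<union> F)"
          by (intro inside_add[OF sub_L]) (auto simp: pin_def)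
        moreover have "insert c A \<union> F = ?Y" using Fe xy by (auto simp: doubleton_eq_iff)
        ultimately show "f + g \<in> inside L ?Y" by simp
      qed
      moreover have "pin L c q (insert c A) \<inter> inside L F = {0}"
      proof -
        have "f = 0" if f: "f \<in> pin L c q (insert c A)" "f \<in> inside L F" for f
        proof (rule ccontr)
          assume nz: "f \<noteq> 0"
          have "f \<in> inside L {x, c, d}"
            using f xy Fe by (auto simp: inside_def pin_def doubleton_eq_iff)
          moreover have "card {x, c, d} = 3" using xy' cd xy(4) Fe by (auto simp: doubleton_eq_iff)
          ultimately have s: "supp f = {x, c, d}" "card (supp f) = 3" using inside_card3 nz by auto
          have "f c = q" using s(1) f(1) by (auto simp: pin_def supp_def)
          then show False using no_triple[of f] s f by (auto simp: inside_def)
        qed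
        then show ?thesis using subgrpD(2)[OF sub_pin] subgrpD(2)[OF sub_inside] by blast
      qed
      then have "dm (pin L c q (insert c A) \<inter> inside L F) = 0"
        using dm_0_iff[OF subgrp_Int[OF sub_pin sub_inside]] by blast
      moreover have cY: "card ?Y = card A + 2"
        using in_Diff[OF A(1)] xy(3) yV by simp
      ultimately have "rk L ?Y \<le> 2" using A(4) F by (simp add: rk_def prk_def)
      moreover have "3 \<le> rk L ?Y"
      proof (rule rk_ge3)
        show "?Y \<subseteq> V" using A(1) cd yV by auto
        then show "5 \<le> card (V - ?Y)" using card_compl[of ?Y] cY card_removal_compl[OF cd(4) A(1)] A(3) by simp
        show "5 \<le> card ?Y" using cY A(2) by simp
      qed
      ultimately show False by simp
    qed
    show "prime_removal c q \<and> weak_removal c q"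
    proof
      show "prime_removal c q"
        using not_prime_removal[OF cd(4) q(1)] no_triple by metis
      show "weak_removal c q"
      proof (rule ccontr)
        assume nw: "\<not> weak_removal c q"
        obtain A where A: "A \<subseteq> V - {c}" "6 \<le> card A" "6 \<le> card (V - {c} - A)" "prk L c q A \<le> 2"
          using not_weak_removal[OF cd(4) nw] .
        define B where "B = V - {c} - A"
        have B: "B \<subseteq> V - {c}" "6 \<le> card B" "6 \<le> card (V - {c} - B)" "prk L c q B \<le> 2"
          using A prk_sym[OF cd(4) q(1) A(1)] double_diff[OF A(1)] by (auto simp: B_def)
        have "\<not> supp t \<subseteq> insert c A" "\<not> supp t \<subseteq> insert c B"
          using weak_removal_fail_rk[OF cd(4) A t(1) nz(3) q(2)[symmetric]]
            weak_removal_fail_rk[OF cd(4) B t(1) nz(3) q(2)[symmetric]] by auto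
        moreover have "x \<in> A \<or> x \<in> B" if "x \<in> {a, b, d}" for x
          using that Fe cd F(1) by (auto simp: B_def)
        moreover have "A \<inter> B = {}" by (auto simp: B_def)
        ultimately have "(a \<in> A \<and> b \<in> B \<or> b \<in> A \<and> a \<in> B) \<and> (d \<in> A \<or> d \<in> B)" unfolding st by blast
        then show False
          using key[OF A, of a b] key[OF A, of b a] key[OF B, of a b] key[OF B, of b a] \<open>A \<inter> B = {}\<close> by blast
      qed
    qed
  qed
qed

text \<open>
  A nonzero vector inside \<open>F\<close> has full support, as \<open>F\<close> contains no triple. Hence it is determined by its
  entry at any single element of \<open>F\<close>, and by counting all four entries occur (\<open>onto\<close>). So a vector
  of \<open>L\<close> that meets \<open>F\<close> in at most one element vanishes there (\<open>vanish\<close>), and a triple through an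
  element of \<open>F\<close> conflicts with a vector inside \<open>F\<close>, which makes all removals prime.

  If neither removal at \<open>v\<close> is weak, \<open>crossing\<close> divides a side \<open>A\<close> into two sets of rank at most 2.
  Such a set that meets \<open>F\<close> has at most two elements (\<open>small\<close>), any other one at most four. So \<open>A\<close> has
  exactly six elements and meets \<open>F\<close> in one or two of them. In the first case dropping the common
  element, in the second adding \<open>F\<close> produces a set of rank at most 2 that is too large.\<close>

lemma quad_removal:
  assumes F: "F \<subseteq> V" "card F = 4" "rk L F \<le> 2"
    and nt: "\<And>t. t \<in> L \<Longrightarrow> card (supp t) = 3 \<Longrightarrow> \<not> supp t \<subseteq> F"
    and v: "v \<in> F" and pq: "p \<noteq> q" "p \<noteq> 0" "q \<noteq> 0"
  shows "\<exists>r\<in>{p, q}. prime_removal v r \<and> weak_removal v r"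
proof -
  have fF: "finite F" using F fin by auto
  have vV: "v \<in> V" using v F by auto
  have zero: "f = 0" if f: "f \<in> inside L F" "supp f \<subseteq> X" "card X \<le> 3" "finite X" for f X
  proof (rule ccontr)
    assume "f \<noteq> 0"
    then have "card (supp f) = 3"
      using supp_card_ge3[of f] card_mono[OF f(4,2)] f by (auto simp: inside_def)
    then show False using nt[of f] f by (auto simp: inside_def)
  qed
  have onto: "\<exists>f\<in>inside L F. f u = k" if u: "u \<in> F" for u k
  proof -
    have "inj_on (\<lambda>f. f u) (inside L F)"
    proof (rule inj_onI)
      fix f g assume fg: "f \<in> inside L F" "g \<in> inside L F" "f u = g u"
      then have "f + g \<in> inside L F" using subgrpD(3)[OF sub_inside] by blast
      moreover from this have "supp (f + g) \<subseteq> F - {u}" using fg(3) by (auto simp: inside_def supp_def)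
      ultimately have "f + g = 0" using zero[of "f + g" "F - {u}"] u F(2) fF by simp
      then show "f = g" by simp
    qed
    then have "card ((\<lambda>f. f u) ` inside L F) = card (inside L F)" by (rule card_image)
    moreover have "2 \<le> dm (inside L F)" using F by (simp add: rk_def)
    then have "(2::nat) ^ 2 \<le> card (inside L F)"
      unfolding card_dm[OF sub_inside] by (rule power_increasing) simp
    moreover have "vspace {u} = (\<lambda>k x. if x = u then k else 0) ` UNIV"
    proof (intro equalityI subsetI)
      fix f :: "'a kvec" assume "f \<in> vspace {u}"
      then have "f = (\<lambda>x. if x = u then f u else 0)" by (auto simp: vspace_def supp_def fun_eq_iff)
      then show "f \<in> (\<lambda>k x. if x = u then k else 0) ` UNIV" by (rule image_eqI) simp
    qed (auto simp: vspace_def supp_def split: if_splits)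
    then have "card ((\<lambda>k x. if x = u then k else (0 :: bit \<times> bit)) ` UNIV) = 4"
      using vspace_card(2)[of "{u}"] by simp
    moreover have "inj (\<lambda>k x. if x = u then k else (0 :: bit \<times> bit))"
      by (rule injI) (metis (full_types))
    ultimately have c: "card (UNIV :: (bit \<times> bit) set) \<le> card ((\<lambda>f. f u) ` inside L F)"
      by (simp add: card_image)
    have "card (UNIV :: (bit \<times> bit) set) = 4"
      using \<open>card ((\<lambda>k x. if x = u then k else (0 :: bit \<times> bit)) ` UNIV) = 4\<close>
        card_image[OF \<open>inj (\<lambda>k x. if x = u then k else (0 :: bit \<times> bit))\<close>] by simp
    then have "finite (UNIV :: (bit \<times> bit) set)" by (intro card_ge_0_finite) simp
    then have "(\<lambda>f. f u) ` inside L F = UNIV" using c by (intro card_seteq) auto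
    then show ?thesis by (metis UNIV_I imageE)
  qed
  have vanish: "g u = 0" if g: "g \<in> L" "supp g \<inter> F \<subseteq> {u}" "u \<in> F" for g u
  proof (rule ccontr)
    assume "g u \<noteq> 0"
    then obtain k where "symp (g u) k = 1" using symp_nondegenerate by blast
    moreover obtain f where "f \<in> inside L F" "f u = k" using onto[OF g(3)] by blast
    moreover from this have "symp (g u) (f u) = 0"
      using g by (intro isotropic_at) (auto simp: inside_def)
    ultimately show False by simp
  qed
  have prime: "prime_removal v r" if r: "r \<noteq> 0" for r
  proof (rule ccontr)
    assume "\<not> prime_removal v r"
    then obtain g where g: "g \<in> L" "card (supp g) = 3" "g v = r" using not_prime_removal[OF vV r] by blast
    obtain k where k: "symp (g v) k = 1" using symp_nondegenerate[of "g v"] r g(3) by blast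
    obtain f where f: "f \<in> inside L F" "f v = k" using onto[OF v] by blast
    have "card (supp g \<union> F) \<le> card F"
      using conflicting_triple[OF F(1) _ F(3), of f g v] F(2) f g k symp_sym[of k] by (simp add: inside_def)
    then have "F = supp g \<union> F" using fF fin[OF supp_L[OF g(1)]] by (intro card_seteq) auto
    then show False using nt[OF g(1,2)] by blast
  qed
  have "weak_removal v p \<or> weak_removal v q"
  proof (rule ccontr)
    assume "\<not> ?thesis"
    then obtain r A C where r: "r = p \<or> r = q" and A: "A \<subseteq> V - {v}" "6 \<le> card A" "6 \<le> card (V - {v} - A)"
      "prk L v r A \<le> 2" and AC: "rk L (A \<inter> C) \<le> 2" "rk L (A - C) \<le> 2"
      using crossing[OF vV pq] by blast
    have r0: "r \<noteq> 0" using r pq by auto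
    note n = card_removal_compl[OF vV A(1)] and fA = in_Diff[OF A(1)]
    have small: "card Z \<le> 2" if Z: "Z \<subseteq> A" "rk L Z \<le> 2" "Z \<inter> F \<noteq> {}" for Z
    proof (rule ccontr)
      assume c: "\<not> card Z \<le> 2"
      have ZV: "Z \<subseteq> V" and fZ: "finite Z" using Z fA finite_subset by auto
      have "card Z \<le> card A" using Z(1) fA(2) by (rule card_mono[rotated])
      then have "5 \<le> card (V - Z)" using card_add_compl[OF ZV] n A(3) by linarith
      then have "\<not> 5 \<le> card Z" using rk_ge3[OF ZV] Z(2) by linarith
      then have c4: "card Z \<le> 4" by simp
      obtain u where u: "u \<in> Z" "u \<in> F" using Z(3) by blast
      have "\<not> Z \<inter> F \<subseteq> {u}"
      proof
        assume "Z \<inter> F \<subseteq> {u}"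
        then have "rk L (Z - {u}) = rk L Z - 1"
          using vanish[of _ u] u by (intro rk_remove_vanishing[OF _ ZV]) (auto simp: inside_def)
        moreover have "2 \<le> rk L (Z - {u})"
        proof (rule rk_ge2)
          show s: "Z - {u} \<subseteq> V" using ZV by blast
          show "2 \<le> card (Z - {u})" using c u fZ by simp
          have "card (Z - {u}) \<le> 4" using c4 u fZ by simp
          then show "2 \<le> card (V - (Z - {u}))" using card_add_compl[OF s] card_V by linarith
        qed
        ultimately show False using Z(2) by simp
      qed
      then obtain w where "w \<in> Z" "w \<in> F" "w \<noteq> u" by blast
      then have c2: "2 \<le> card (Z \<inter> F)" using u fZ by (intro two_le_card[of _ u w]) auto
      have "card Z + card F = card (Z \<union> F) + card (Z \<inter> F)" using fZ fF by (rule card_Un_Int)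
      then have "card (Z \<union> F) \<le> card F"
        using rk2_Un_small[OF ZV F(1) Z(2) F(3) c2] c2 F(2) c4 n A by simp
      then have "F = Z \<union> F" using fF fZ by (intro card_seteq) auto
      then have ZF: "Z \<subseteq> F" by blast
      moreover have "Z \<noteq> F" using v Z(1) fA(3) by auto
      ultimately have "card Z < card F" using fF by (intro psubset_card_mono) auto
      then have "card Z = 3" using c F(2) by simp
      then obtain f where "f \<in> L" "supp f = Z" using rk_card3_triple Z(2) by blast
      then show False using nt[of f] ZF \<open>card Z = 3\<close> by simp
    qed
    obtain f where f: "f \<in> inside L F" "f v = (if r = p then q else p)" using onto[OF v] by blast
    have "\<not> supp f \<subseteq> insert v (V - {v} - A)"
    proof (rule weak_removal_fail_rk[OF vV])
      show "6 \<le> card (V - {v} - (V - {v} - A))" using A(2) double_diff[OF A(1)] by simp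
      show "prk L v r (V - {v} - A) \<le> 2" using A(4) prk_sym[OF vV r0 A(1)] by simp
    qed (use A f pq r in \<open>auto simp: inside_def\<close>)
    then have AF: "A \<inter> F \<noteq> {}" using f supp_L[of f] by (auto simp: inside_def)
    have ex: "\<exists>Q. A \<inter> F \<subseteq> Q \<and> Q \<subseteq> A \<and> card Q = 2 \<and> card A = 6"
    proof -
      have cA: "card (A \<inter> C) + card (A - C) = card A"
        using fA(2) by (metis Int_Diff_Un Int_Diff_disjoint card_Un_disjoint finite_Diff finite_Int)
      have c4: "card Z \<le> 4" if Z: "Z \<subseteq> A" "rk L Z \<le> 2" for Z
      proof (rule ccontr)
        assume "\<not> card Z \<le> 4"
        moreover have "card Z \<le> card A" using Z(1) fA(2) by (rule card_mono[rotated])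
        moreover have ZV: "Z \<subseteq> V" using Z fA by auto
        ultimately have "5 \<le> card Z" "5 \<le> card (V - Z)" using card_add_compl[OF ZV] n A(3) by linarith+
        then show False using rk_ge3[OF ZV] Z(2) by linarith
      qed
      have "A \<inter> C \<inter> F \<noteq> {} \<or> (A - C) \<inter> F \<noteq> {}" using AF by blast
      then show ?thesis
      proof
        assume h: "A \<inter> C \<inter> F \<noteq> {}"
        have a: "card (A \<inter> C) \<le> 2" using small[OF _ AC(1) h] by blast
        moreover have b: "card (A - C) \<le> 4" using c4[OF _ AC(2)] by blast
        ultimately have c: "card (A \<inter> C) = 2" "card (A - C) = 4" "card A = 6" using cA A(2) by auto
        have "(A - C) \<inter> F = {}" using small[OF _ AC(2)] c by fastforce
        then have "A \<inter> F \<subseteq> A \<inter> C" by blast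
        then show ?thesis using c by blast
      next
        assume h: "(A - C) \<inter> F \<noteq> {}"
        have a: "card (A - C) \<le> 2" using small[OF _ AC(2) h] by blast
        moreover have b: "card (A \<inter> C) \<le> 4" using c4[OF _ AC(1)] by blast
        ultimately have c: "card (A - C) = 2" "card (A \<inter> C) = 4" "card A = 6" using cA A(2) by auto
        have "A \<inter> C \<inter> F = {}" using small[OF _ AC(1)] c by fastforce
        then have "A \<inter> F \<subseteq> A - C" by blast
        then show ?thesis using c by blast
      qed
    qed
    then obtain Q where Q: "A \<inter> F \<subseteq> Q" "card Q = 2" and cA: "card A = 6" by blast
    have fAF: "finite (A \<inter> F)" using fF by simp
    have "card (A \<inter> F) \<le> 2"
      using card_mono[OF _ Q(1)] Q(2) by (metis card_ge_0_finite zero_less_numeral)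
    moreover have "0 < card (A \<inter> F)" using AF fAF by (simp add: card_gt_0_iff)
    ultimately consider "card (A \<inter> F) = 1" | "card (A \<inter> F) = 2" by linarith
    then show False
    proof cases
      case 1
      then obtain u where u: "A \<inter> F = {u}" using card_1_singletonE by blast
      have "rk L (A - {u}) = rk L A - 1"
        using vanish[of _ u] u by (intro rk_remove_vanishing[OF _ fA(1)]) (auto simp: inside_def)
      moreover have "3 \<le> rk L (A - {u})"
      proof (rule rk_ge3)
        show s: "A - {u} \<subseteq> V" using fA by auto
        show c5: "5 \<le> card (A - {u})" using u cA fA(2) by (simp add: card_Diff_singleton_if)
        show "5 \<le> card (V - (A - {u}))"
          using card_compl[OF s] n A(3) card_mono[of A "A - {u}"] fA(2) by auto
      qed
      ultimately show False using rk_le_prk[OF vV A(1), of r] A(4) by simp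
    next
      case 2
      have "dm (pin L v r (insert v A)) + dm (inside L F)
          \<le> dm (pin L v r (insert v A) \<inter> inside L F) + dm (inside L (A \<union> F))"
      proof (rule dm_modular[OF sub_pin sub_inside sub_inside])
        fix f g assume "f \<in> pin L v r (insert v A)" "g \<in> inside L F"
        then have "f + g \<in> inside L (insert v A \<union> F)"
          by (intro inside_add[OF sub_L]) (auto simp: pin_def)
        then show "f + g \<in> inside L (A \<union> F)" using v by (simp add: insert_absorb)
      qed
      moreover have "f = 0" if "f \<in> pin L v r (insert v A)" "f \<in> inside L F" for f
        by (rule zero[OF that(2), of "insert v (A \<inter> F)"])
          (use that 2 fAF fA(3) in \<open>auto simp: pin_def inside_def\<close>)
      then have "pin L v r (insert v A) \<inter> inside L F = {0}"
        using subgrpD(2)[OF sub_pin] subgrpD(2)[OF sub_inside] by blast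
      then have "dm (pin L v r (insert v A) \<inter> inside L F) = 0"
        using dm_0_iff[OF subgrp_Int[OF sub_pin sub_inside]] by blast
      moreover have cU: "card (A \<union> F) = 8" using card_Un_Int[OF fA(2) fF] 2 cA F(2) by simp
      ultimately have "rk L (A \<union> F) \<le> 2" using A(4) F cA by (simp add: rk_def prk_def)
      moreover have "3 \<le> rk L (A \<union> F)"
        using cU card_compl[of "A \<union> F"] fA(1) F(1) n cA A(3) by (intro rk_ge3) auto
      ultimately show False by simp
    qed
  qed
  then show ?thesis using prime pq by blast
qed

end

section \<open>Triples without four-element sets of rank two\<close>

text \<open>
  The remaining case: there is a triple \<open>t\<close> but no 4-set of rank 2. At each \<open>v\<close> in the support of \<open>t\<close> one
  removal is tried, along the line of some \<open>q v\<close> off the line of \<open>t v\<close>.\<close>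

locale triangle_system = weakly_connected_system +
  fixes t :: "'a kvec" and q :: "'a \<Rightarrow> bit \<times> bit"
  assumes no_rk2_4set: "\<lbrakk>F \<subseteq> V; card F = 4\<rbrakk> \<Longrightarrow> \<not> rk L F \<le> 2"
    and t_L: "t \<in> L" and card_t: "card (supp t) = 3"
    and q_nz: "v \<in> supp t \<Longrightarrow> q v \<noteq> 0" and q_neq: "v \<in> supp t \<Longrightarrow> q v \<noteq> t v"
begin

abbreviation T :: "'a set" where "T \<equiv> supp t"

lemma T_V: "T \<subseteq> V" by (rule supp_L[OF t_L])

text \<open>
  Without 4-sets of rank 2 the bound 5 improves to 4.\<close>

lemma rk_ge3':
  assumes "X \<subseteq> V" "4 \<le> card X" "4 \<le> card (V - X)"
  shows "3 \<le> rk L X"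
proof (rule ccontr)
  assume "\<not> 3 \<le> rk L X"
  then have r: "rk L X \<le> 2" "rk L (V - X) \<le> 2" using rk_sym[OF assms(1)] by auto
  then have "card X \<noteq> 4" "card (V - X) \<noteq> 4" using no_rk2_4set[of X] no_rk2_4set[of "V - X"] assms(1) by auto
  then show False using rk_ge3[OF assms(1)] assms r by simp
qed

text \<open>
  A triple with entry \<open>q v\<close> at \<open>v\<close> conflicts with \<open>t\<close>. Since no 4-set has rank 2, uncrossing forces
  both supports to coincide, but a 3-set of rank at least 2 carries only one triple.\<close>

lemma prime_at_triple:
  assumes "v \<in> T"
  shows "prime_removal v (q v)"
proof (rule ccontr)
  have vV: "v \<in> V" using assms T_V by blast
  assume "\<not> prime_removal v (q v)"
  then obtain g where g: "g \<in> L" "card (supp g) = 3" "g v = q v"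
    using not_prime_removal[OF vV q_nz[OF assms]] by blast
  have fin_gT: "finite (supp g)" "finite T" using fin supp_L g(1) t_L by auto
  have tv: "t v \<noteq> 0" using assms by (simp add: supp_def)
  have conf: "symp (t v) (g v) \<noteq> 0"
    using q_nz[OF assms] q_neq[OF assms] g(3) tv by (auto simp: symp_eq_0_iff)
  have rT: "rk L T \<le> 2" by (rule rk_triple[OF t_L card_t])
  have c: "card (supp g \<union> T) \<le> 4"
    using conflicting_triple[OF T_V _ rT t_L subset_refl g(1,2) conf] card_t by simp
  obtain e where e: "e \<noteq> v" "e \<in> T" "e \<in> supp g" using isotropic_other[OF t_L g(1) conf] .
  have "v \<in> supp g" using conf by (auto simp: supp_def)
  then have c2: "2 \<le> card (supp g \<inter> T)" using e assms fin_gT by (intro two_le_card[of _ e v]) auto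
  have sUT: "supp g \<union> T \<subseteq> V" using T_V supp_L[OF g(1)] by blast
  have "card (supp g \<inter> T) \<le> 3" using card_mono[of T "supp g \<inter> T"] fin_gT card_t by auto
  then have "rk L (supp g \<union> T) \<le> 2"
    using card_V by (intro rk2_Un[OF supp_L[OF g(1)] T_V rk_triple[OF g(1,2)] rT c2]) auto
  then have "card (supp g \<union> T) \<noteq> 4" using no_rk2_4set[OF sUT] by blast
  then have "card (supp g \<union> T) \<le> card T" using c card_t by simp
  then have "T = supp g \<union> T" using fin_gT by (intro card_seteq) auto
  then have gT: "supp g \<subseteq> T" by blast
  have "0 < dm (pin L v (t v) T)"
  proof -
    have "t \<in> pin L v (t v) T" using t_L by (simp add: pin_def inside_def)
    moreover have "t \<noteq> 0" using tv by auto
    ultimately show ?thesis using dm_0_iff[OF sub_pin] by (metis neq0_conv singletonD)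
  qed
  moreover have "Suc (dm (pin L v (t v) T)) \<le> dm (inside L T)"
    by (rule dm_Suc_le[OF sub_pin sub_inside, of _ _ _ _ g])
      (use g gT q_nz[OF assms] q_neq[OF assms] in \<open>auto simp: pin_def inside_def\<close>)
  moreover have "2 \<le> rk L T"
    using rk_ge2[OF T_V] card_t card_add_compl[OF T_V] card_V by linarith
  ultimately show False using card_t by (simp add: rk_def)
qed

text \<open>
  A failure of the removal at \<open>a\<close> to be weak. The sides of the failing partition are \<open>insert b U\<close> and
  \<open>insert c W\<close>; the two inequalities say that their ranks \<open>prk\<close> are at most 2.\<close>

definition sep :: "'a \<Rightarrow> 'a \<Rightarrow> 'a \<Rightarrow> 'a set \<Rightarrow> 'a set \<Rightarrow> bool" where
  "sep a b c U W \<longleftrightarrow> T = {a, b, c} \<and> a \<noteq> b \<and> a \<noteq> c \<and> b \<noteq> c \<and> U \<union> W = V - T \<and> U \<inter> W = {} \<and>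
     5 \<le> card U \<and> 5 \<le> card W \<and>
     card U \<le> dm (pin L a (q a) (insert a (insert b U))) + 1 \<and>
     card W \<le> dm (pin L a (q a) (insert a (insert c W))) + 1"

lemma sep_sym: "sep a b c U W \<Longrightarrow> sep a c b W U"
  unfolding sep_def by (auto simp: Int_commute Un_commute)

text \<open>
  By \<open>weak_removal_fail_rk\<close> for the vector \<open>t\<close>, the elements \<open>b\<close> and \<open>c\<close> cannot be on the same side.\<close>

lemma sep_exists:
  assumes T: "T = {a, b, c}" "a \<noteq> b" "a \<noteq> c" "b \<noteq> c" and nw: "\<not> weak_removal a (q a)"
  shows "\<exists>U W. sep a b c U W"
proof -
  have aT: "a \<in> T" and aV: "a \<in> V" using T T_V by auto
  have ta: "t a \<noteq> 0" using aT by (simp add: supp_def)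
  obtain A where A: "A \<subseteq> V - {a}" "6 \<le> card A" "6 \<le> card (V - {a} - A)" "prk L a (q a) A \<le> 2"
    using not_weak_removal[OF aV nw] .
  define B where "B = V - {a} - A"
  have B: "B \<subseteq> V - {a}" "6 \<le> card B" "6 \<le> card (V - {a} - B)" "prk L a (q a) B \<le> 2"
    using A prk_sym[OF aV q_nz[OF aT] A(1)] double_diff[OF A(1)] by (auto simp: B_def)
  have "\<not> T \<subseteq> insert a A" "\<not> T \<subseteq> insert a B"
    using weak_removal_fail_rk[OF aV A t_L ta q_neq[OF aT, symmetric]]
      weak_removal_fail_rk[OF aV B t_L ta q_neq[OF aT, symmetric]] by auto
  moreover have AB: "A \<union> B = V - {a}" "A \<inter> B = {}" using A(1) by (auto simp: B_def)
  moreover have "b \<in> A \<union> B" "c \<in> A \<union> B" using AB T T_V by auto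
  ultimately have bc: "b \<in> A \<and> c \<in> B \<or> b \<in> B \<and> c \<in> A" unfolding T(1) by blast
  have "sep a b c (X - {b}) (Y - {c})"
    if X: "X \<subseteq> V - {a}" "6 \<le> card X" "prk L a (q a) X \<le> 2" and Y: "Y \<subseteq> V - {a}" "6 \<le> card Y" "prk L a (q a) Y \<le> 2"
      and XY: "X \<union> Y = V - {a}" "X \<inter> Y = {}" and bc: "b \<in> X" "c \<in> Y" for X Y
  proof -
    have c1: "card X = card (X - {b}) + 1" "card Y = card (Y - {c}) + 1"
      using card.remove[OF in_Diff(2)[OF X(1)] bc(1)] card.remove[OF in_Diff(2)[OF Y(1)] bc(2)] by auto
    have i: "insert b (X - {b}) = X" "insert c (Y - {c}) = Y" using bc by auto
    have "(X - {b}) \<union> (Y - {c}) = V - T" using XY T bc by auto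
    moreover have "(X - {b}) \<inter> (Y - {c}) = {}" using XY(2) by blast
    moreover have "5 \<le> card (X - {b})" "5 \<le> card (Y - {c})" using c1 X(2) Y(2) by linarith+
    moreover have "card (X - {b}) \<le> dm (pin L a (q a) (insert a X)) + 1"
      "card (Y - {c}) \<le> dm (pin L a (q a) (insert a Y)) + 1"
      using X(3) Y(3) c1 unfolding prk_def by linarith+
    ultimately show ?thesis unfolding sep_def i using T by blast
  qed
  note mk = this
  have BA: "B \<union> A = V - {a}" "B \<inter> A = {}" using AB by blast+
  show ?thesis using bc mk[OF A(1,2,4) B(1,2,4) AB] mk[OF B(1,2,4) A(1,2,4) BA] by blast
qed

context
  fixes a b c U W assumes s: "sep a b c U W"
begin

lemma sepD:
  shows "T = {a, b, c}" "a \<noteq> b" "a \<noteq> c" "b \<noteq> c" "U \<union> W = V - T" "U \<inter> W = {}"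
    "5 \<le> card U" "5 \<le> card W"
    "card U \<le> dm (pin L a (q a) (insert a (insert b U))) + 1"
    "card W \<le> dm (pin L a (q a) (insert a (insert c W))) + 1"
  using s by (auto simp: sep_def)

lemma sep_in: "a \<in> V" "b \<in> V" "c \<in> V" "a \<notin> U" "b \<notin> U" "c \<notin> U" "a \<notin> W" "b \<notin> W" "c \<notin> W" "U \<subseteq> V" "W \<subseteq> V"
  "finite U" "finite W" "a \<in> T" "b \<in> T" "c \<in> T" "t a \<noteq> 0" "t b \<noteq> 0" "t c \<noteq> 0"
proof -
  show abc: "a \<in> T" "b \<in> T" "c \<in> T" using sepD(1) by blast+
  then show "a \<in> V" "b \<in> V" "c \<in> V" using T_V by blast+
  show "a \<notin> U" "b \<notin> U" "c \<notin> U" "a \<notin> W" "b \<notin> W" "c \<notin> W" using sepD(5) abc by blast+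
  show UW: "U \<subseteq> V" "W \<subseteq> V" using sepD(5) by blast+
  show "finite U" "finite W" using UW fin by blast+
  show "t a \<noteq> 0" "t b \<noteq> 0" "t c \<noteq> 0" using abc by (simp_all add: supp_def)
qed

lemma sep_disjoint: "U \<inter> T = {}" "W \<inter> T = {}"
  using sepD(5) by blast+

end

lemma at_triple:
  assumes "f \<in> L" "v \<in> T" "supp f \<inter> T \<subseteq> {v}"
  shows "f v = 0 \<or> f v = t v"
proof -
  have "symp (f v) (t v) = 0" using isotropic_at[OF assms(1) t_L assms(3)] .
  then show ?thesis using assms(2) by (auto simp: symp_eq_0_iff supp_def)
qed

text \<open>
  The rank of \<open>W\<close> is at least 3 and \<open>sep\<close> allows no slack: adding \<open>c\<close> to \<open>W\<close>, and then \<open>a\<close>, must each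
  provide a new vector. The two vectors obtained here control the entries at \<open>a\<close> and \<open>c\<close> of all vectors
  that avoid \<open>W\<close>.\<close>

lemma sep_corner:
  assumes s: "sep a b c U W"
  shows "rk L W = 3" "card W \<le> dm (inside L (insert c W)) + 2"
    "\<exists>w\<in>L. supp w \<subseteq> insert a (insert c W) \<and> w a = q a"
    "\<exists>w\<in>L. supp w \<subseteq> insert c W \<and> w c = t c"
proof -
  note d = sepD[OF s] and i = sep_in[OF s] and j = sep_disjoint[OF s]
  have c1: "dm (pin L a (q a) (insert a (insert c W))) \<le> Suc (dm (inside L (insert c W)))"
    by (rule dm_pin_le) (use d i in auto)
  have pt: "f c = 0 \<or> f c = t c" if "f \<in> inside L (insert c W)" for f
    using that j by (intro at_triple) (auto simp: inside_def i)
  then have "pin L c (t c) (insert c W) = inside L (insert c W)" by (auto simp: pin_def)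
  then have c2: "dm (inside L (insert c W)) \<le> Suc (dm (inside L W))"
    using dm_pin_le[OF i(9), of "t c"] by simp
  have UV: "card U + card W + 3 = card V"
    using card_add_compl[OF T_V] card_t card_Un_disjoint[OF i(12,13) d(6)] d(5) by simp
  have r3: "3 \<le> rk L W" using card_add_compl[OF i(11)] UV d by (intro rk_ge3' i) linarith+
  then show "rk L W = 3" using c1 c2 d(10) by (simp add: rk_def)
  show c3: "card W \<le> dm (inside L (insert c W)) + 2" using c1 d(10) by linarith
  have cc: "card (insert c W) = card W + 1" using i by simp
  have "insert c W \<subseteq> V" using i by blast
  then have "3 \<le> rk L (insert c W)"
    using card_add_compl[of "insert c W"] UV d cc by (intro rk_ge3') linarith+
  then have lt: "dm (inside L (insert c W)) < dm (pin L a (q a) (insert a (insert c W)))"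
    using d(10) cc by (simp add: rk_def)
  show "\<exists>w\<in>L. supp w \<subseteq> insert a (insert c W) \<and> w a = q a"
  proof (rule ccontr)
    assume "\<not> ?thesis"
    then have "pin L a (q a) (insert a (insert c W)) \<subseteq> inside L (insert c W)"
      by (auto simp: pin_def inside_def supp_def)
    then show False using dm_mono[OF sub_pin sub_inside] lt by (meson leD)
  qed
  show "\<exists>w\<in>L. supp w \<subseteq> insert c W \<and> w c = t c"
  proof (rule ccontr)
    assume "\<not> ?thesis"
    then have "inside L (insert c W) \<subseteq> inside L W"
      using pt by (force simp: inside_def supp_def)
    then have "dm (inside L (insert c W)) \<le> dm (inside L W)" by (rule dm_mono[OF sub_inside sub_inside])
    then show False using c3 r3 by (simp add: rk_def)
  qed
qed

lemma form_T:
  assumes "f \<in> L" "T = {a, b, c}" "a \<noteq> b" "a \<noteq> c" "b \<noteq> c"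
  shows "symp (f a) (t a) + (symp (f b) (t b) + symp (f c) (t c)) = 0"
proof -
  have "form T f t = 0" by (rule isotropic_on[OF assms(1) t_L]) (use fin T_V in auto)
  then show ?thesis using assms(2-5) by (simp add: form_def del: add_bit_eq_xor)
qed

text \<open>
  The vectors supplied by \<open>sep_corner\<close> live on \<open>W1\<close>, \<open>W2\<close> and \<open>T\<close>, so they meet \<open>f\<close> in \<open>T\<close> only.
  Isotropy then puts the entry of \<open>f\<close> at each element of \<open>T\<close> on the line of \<open>t\<close> and shows that the
  three entries are zero or nonzero together.\<close>

lemma two_separations_link:
  assumes s1: "sep a b c U1 W1" and s2: "sep b c a U2 W2"
    and f: "f \<in> L" "supp f \<subseteq> (U1 \<inter> U2) \<union> T"
  shows "(f a = 0 \<and> f b = 0 \<and> f c = 0) \<or> (f a = t a \<and> f b = t b \<and> f c = t c)"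
proof -
  note d1 = sepD[OF s1] and i1 = sep_in[OF s1] and d2 = sepD[OF s2] and i2 = sep_in[OF s2]
  note j1 = sep_disjoint[OF s1] and j2 = sep_disjoint[OF s2]
  have qt: "symp (q v) (t v) \<noteq> 0" if "v \<in> T" for v
    using q_nz[OF that] q_neq[OF that] that by (simp add: symp_eq_0_iff supp_def)
  obtain w1 where w1: "w1 \<in> L" "supp w1 \<subseteq> insert a (insert c W1)" "w1 a = q a"
    using sep_corner(3)[OF s1] by blast
  obtain w1' where w1': "w1' \<in> L" "supp w1' \<subseteq> insert c W1" "w1' c = t c"
    using sep_corner(4)[OF s1] by blast
  obtain w2 where w2: "w2 \<in> L" "supp w2 \<subseteq> insert b (insert a W2)" "w2 b = q b"
    using sep_corner(3)[OF s2] by blast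
  obtain w2' where w2': "w2' \<in> L" "supp w2' \<subseteq> insert a W2" "w2' a = t a"
    using sep_corner(4)[OF s2] by blast
  have "symp (f c) (w1' c) = 0"
    by (rule isotropic_at[OF f(1) w1'(1)]) (use f(2) w1'(2) d1(6) j1(2) in blast)
  then have fc: "f c = 0 \<or> f c = t c" unfolding w1'(3) symp_eq_0_iff using i1(19) by blast
  have "symp (f a) (w2' a) = 0"
    by (rule isotropic_at[OF f(1) w2'(1)]) (use f(2) w2'(2) d2(6) j2(2) in blast)
  then have fa: "f a = 0 \<or> f a = t a" unfolding w2'(3) symp_eq_0_iff using i1(17) by blast
  have "symp (f b) (t b) = 0" using form_T[OF f(1) d1(1-4)] fa fc by auto
  then have fb: "f b = 0 \<or> f b = t b" unfolding symp_eq_0_iff using i1(18) by blast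
  have e1: "symp (f a) (q a) = symp (f c) (w1 c)"
    unfolding w1(3)[symmetric]
    by (rule isotropic_at2[OF f(1) w1(1) _ d1(3)]) (use f(2) w1(2) d1(6) j1(2) in blast)
  have "symp (w1 a) (t a) = symp (w1 c) (t c)"
    by (rule isotropic_at2[OF w1(1) t_L _ d1(3)]) (use w1(2) j1(2) in blast)
  then have "symp (w1 c) (t c) \<noteq> 0" using qt[OF i1(14)] w1(3) by simp
  then have x1: "symp (t c) (w1 c) \<noteq> 0" by (simp add: symp_sym)
  have e2: "symp (f b) (q b) = symp (f a) (w2 a)"
    unfolding w2(3)[symmetric]
    by (rule isotropic_at2[OF f(1) w2(1) _ d2(3)]) (use f(2) w2(2) d2(6) j2(2) in blast)
  have "symp (w2 b) (t b) = symp (w2 a) (t a)"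
    by (rule isotropic_at2[OF w2(1) t_L _ d2(3)]) (use w2(2) j2(2) in blast)
  then have "symp (w2 a) (t a) \<noteq> 0" using qt[OF i1(15)] w2(3) by simp
  then have x2: "symp (t a) (w2 a) \<noteq> 0" by (simp add: symp_sym)
  have y: "symp (t a) (q a) \<noteq> 0" "symp (t b) (q b) \<noteq> 0"
    using qt[OF i1(14)] qt[OF i1(15)] by (simp_all add: symp_sym)
  show ?thesis using fa fb fc e1 e2 x1 x2 y by (metis symp_simps(1))
qed

lemma two_separations_link':
  assumes s1: "sep a b c U1 W1" and s2: "sep b c a U2 W2"
    and f: "f \<in> L" "supp f \<subseteq> (W1 \<inter> W2) \<union> T"
  shows "(f a = 0 \<and> f b = 0 \<and> f c = 0) \<or> (f a = t a \<and> f b = t b \<and> f c = t c)"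
  using two_separations_link[OF sep_sym[OF s2] sep_sym[OF s1] f(1)] f(2) by (auto simp: Int_commute)

text \<open>
  Apply the modular inequality to the side with \<open>b\<close> of the first separation and the side with \<open>c\<close> of
  the second. A vector common to both has its entry at \<open>b\<close> on the two different lines of \<open>t b\<close> and
  \<open>q b\<close>, so it vanishes there and lives on \<open>U1 \<inter> U2\<close>. The vector \<open>t\<close> is not a sum of vectors from
  the two sides, because the entry of such a sum at \<open>a\<close> is 0 or \<open>q a\<close>; this gains one dimension.\<close>

lemma opposite_corners:
  assumes s1: "sep a b c U1 W1" and s2: "sep b c a U2 W2"
  shows "rk L (U1 \<inter> U2) + rk L (W1 \<inter> W2) \<le> 4"
proof -
  note d1 = sepD[OF s1] and i1 = sep_in[OF s1] and d2 = sepD[OF s2] and i2 = sep_in[OF s2]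
  let ?A = "pin L a (q a) (insert a (insert b U1))" and ?B = "pin L b (q b) (insert b (insert c U2))"
  let ?Y = "U1 \<union> U2 \<union> T"
  have "dm ?A + dm ?B + 1 \<le> dm (?A \<inter> ?B) + dm (inside L ?Y)"
  proof (rule dm_modular_Suc[OF sub_pin sub_pin sub_inside])
    fix f g assume fg: "f \<in> ?A" "g \<in> ?B"
    then have "f + g \<in> inside L (insert a (insert b U1) \<union> insert b (insert c U2))"
      by (intro inside_add[OF sub_L]) (auto simp: pin_def)
    moreover have "insert a (insert b U1) \<union> insert b (insert c U2) = ?Y" using d1(1) by auto
    ultimately show "f + g \<in> inside L ?Y" by simp
    have "a \<notin> supp g" using fg(2) d1(2,3) i2(6) unfolding pin_def inside_def by blast
    then have "g a = 0" by (simp add: supp_def)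
    moreover have "f a \<noteq> t a" using fg(1) q_neq[OF i1(14)] i1(17) unfolding pin_def by auto
    ultimately show "t \<noteq> f + g" by auto
  next
    show "t \<in> inside L ?Y" using t_L by (simp add: inside_def)
  qed
  moreover have "?A \<inter> ?B \<subseteq> inside L (U1 \<inter> U2)"
  proof
    fix f assume f: "f \<in> ?A \<inter> ?B"
    then have f': "f \<in> L" "supp f \<subseteq> insert b (U1 \<inter> U2)" "f b = 0 \<or> f b = q b"
      using d1(2,3) i1(6) i2(6) unfolding pin_def inside_def by blast+
    have "f b = 0 \<or> f b = t b"
      by (rule at_triple[OF f'(1) i1(15)]) (use f'(2) sep_disjoint(1)[OF s1] in blast)
    then have "f b = 0" using f'(3) q_neq[OF i1(15)] by auto
    moreover have "f \<in> inside L (insert b (U1 \<inter> U2))" using f'(1,2) by (simp add: inside_def)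
    ultimately show "f \<in> inside L (U1 \<inter> U2)" by (metis inside_insert_vanish)
  qed
  then have "dm (?A \<inter> ?B) \<le> dm (inside L (U1 \<inter> U2))"
    by (rule dm_mono[OF subgrp_Int[OF sub_pin sub_pin] sub_inside])
  moreover have VY: "V - ?Y = W1 \<inter> W2" using d1(5,6) d2(5,6) by blast
  have YV: "?Y \<subseteq> V" using i1(10) i2(10) T_V by blast
  have "rk L (W1 \<inter> W2) = rk L ?Y" using rk_sym[OF YV] VY by simp
  moreover have "card ?Y = card (U1 \<union> U2) + 3"
  proof -
    have "(U1 \<union> U2) \<inter> T = {}" using sep_disjoint(1)[OF s1] sep_disjoint(1)[OF s2] by blast
    then show ?thesis using card_Un_disjoint[of "U1 \<union> U2" T] i1(12) i2(12) card_t fin[OF T_V] by simp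
  qed
  moreover have "card U1 + card U2 = card (U1 \<union> U2) + card (U1 \<inter> U2)"
    by (rule card_Un_Int[OF i1(12) i2(12)])
  ultimately show ?thesis using d1(9) d2(9) unfolding rk_def by linarith
qed

text \<open>
  Restrict the vectors of the side with
  \<open>c\<close> of the first separation and of the side with \<open>a\<close> of the second to the common corner
  \<open>W1 \<inter> W2\<close>. The restrictions are orthogonal, since the vectors meet nowhere else, so
  \<open>dm_orthogonal\<close> bounds their dimensions. The kernels of the restrictions live on the two side
  corners, apart from at most one vector each, namely those described by \<open>linked\<close> and \<open>linked'\<close>.\<close>

lemma side_corners:
  assumes s1: "sep a b c U1 W1" and s2: "sep b c a U2 W2"
  defines "linked \<equiv> \<exists>s\<in>L. supp s \<subseteq> insert a (insert b (U1 \<inter> W2)) \<and> s a = q a \<and> s b = q b"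
    and "linked' \<equiv> \<exists>s\<in>L. supp s \<subseteq> insert c (W1 \<inter> U2) \<and> s c \<noteq> 0"
  shows "rk L (U1 \<inter> W2) + rk L (W1 \<inter> U2) \<le> 3 + of_bool linked + of_bool linked'"
proof -
  note d1 = sepD[OF s1] and i1 = sep_in[OF s1] and d2 = sepD[OF s2] and i2 = sep_in[OF s2]
  note j1 = sep_disjoint[OF s1] and j2 = sep_disjoint[OF s2]
  let ?\<alpha> = "U1 \<inter> W2" and ?\<delta> = "W1 \<inter> U2" and ?\<gamma> = "W1 \<inter> W2"
  let ?M = "inside L (insert c W1)" and ?N = "pin L b (q b) (insert b (insert a W2))"
  have f\<gamma>: "finite ?\<gamma>" using i1(13) by simp
  have orth: "dm (cut_to ?\<gamma> ` ?M) + dm (cut_to ?\<gamma> ` ?N) \<le> 2 * card ?\<gamma>"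
  proof (rule dm_orthogonal[OF f\<gamma> subgrp_image[OF sub_inside cut_to_add] _ subgrp_image[OF sub_pin cut_to_add]])
    fix f g assume "f \<in> cut_to ?\<gamma> ` ?M" "g \<in> cut_to ?\<gamma> ` ?N"
    then obtain f' g' where f': "f' \<in> ?M" "f = cut_to ?\<gamma> f'" and g': "g' \<in> ?N" "g = cut_to ?\<gamma> g'" by blast
    have "f' \<in> L" "supp f' \<subseteq> insert c W1" "g' \<in> L" "supp g' \<subseteq> insert b (insert a W2)"
      using f'(1) g'(1) by (simp_all add: inside_def pin_def)
    moreover from this have "supp f' \<inter> supp g' \<subseteq> ?\<gamma>" using d1(3,4) i1(7,8) i2(8) by blast
    ultimately have "form ?\<gamma> f' g' = 0" using isotropic_on f\<gamma> by blast
    then show "form ?\<gamma> f g = 0" by (simp add: f' g' form_cut_to)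
  qed (auto simp: vspace_def cut_to_def supp_def split: if_splits)
  have kerM: "dm ?M \<le> dm (cut_to ?\<gamma> ` ?M) + dm (inside L (insert c ?\<delta>))"
  proof (rule dm_image[OF sub_inside cut_to_add sub_inside])
    fix f assume "f \<in> ?M" "cut_to ?\<gamma> f = 0"
    then show "f \<in> inside L (insert c ?\<delta>)"
      using i1(11) d1(5) d2(5) unfolding cut_to_eq_0_iff inside_def by blast
  qed
  obtain w1 where w1: "w1 \<in> L" "supp w1 \<subseteq> insert a (insert c W1)" "w1 a = q a"
    using sep_corner(3)[OF s1] by blast
  have ab: "(f a = 0 \<or> f a = q a) \<and> (f a = 0 \<longleftrightarrow> f b = 0)"
    if f: "f \<in> L" "supp f \<subseteq> insert b (insert a ?\<alpha>)" "f b = 0 \<or> f b = q b" for f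
  proof -
    have "symp (f a) (w1 a) = 0"
      by (rule isotropic_at[OF f(1) w1(1)]) (use f(2) w1(2) d1 i1(5,8) in blast)
    then have fa: "f a = 0 \<or> f a = q a" unfolding w1(3) symp_eq_0_iff using q_nz[OF i1(14)] by blast
    have "symp (f a) (t a) = symp (f b) (t b)"
      by (rule isotropic_at2[OF f(1) t_L _ d1(2)]) (use f(2) j1(1) in blast)
    moreover have "symp (q a) (t a) \<noteq> 0" "symp (q b) (t b) \<noteq> 0"
      unfolding symp_eq_0_iff using q_nz q_neq i1(14,15,17,18) by blast+
    ultimately show ?thesis using fa f(3) by (metis symp_simps(1))
  qed
  have kerN: "dm ?N \<le> dm (cut_to ?\<gamma> ` ?N) + dm (pin L b (q b) (insert b (insert a ?\<alpha>)))"
  proof (rule dm_image[OF sub_pin cut_to_add sub_pin])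
    fix f assume "f \<in> ?N" "cut_to ?\<gamma> f = 0"
    then show "f \<in> pin L b (q b) (insert b (insert a ?\<alpha>))"
      using d1(5) d2(5) i1 unfolding cut_to_eq_0_iff inside_def pin_def by blast
  qed
  have l: "dm (pin L b (q b) (insert b (insert a ?\<alpha>))) \<le> dm (inside L ?\<alpha>) + of_bool linked"
  proof (cases linked)
    case True
    have "dm (pin L b (q b) (insert b (insert a ?\<alpha>))) \<le> Suc (dm (inside L ?\<alpha>))"
    proof (rule dm_index2[OF sub_pin sub_inside, where \<phi> = "\<lambda>f. f b" and c = "q b"])
      fix f assume f: "f \<in> pin L b (q b) (insert b (insert a ?\<alpha>))" "f b = 0"
      then have "f a = 0" using ab[of f] by (auto simp: pin_def inside_def)
      then show "f \<in> inside L ?\<alpha>" using f by (auto simp: pin_def inside_def supp_def)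
    qed (auto simp: pin_def)
    then show ?thesis using True by simp
  next
    case False
    have "pin L b (q b) (insert b (insert a ?\<alpha>)) \<subseteq> inside L ?\<alpha>"
    proof
      fix f assume f: "f \<in> pin L b (q b) (insert b (insert a ?\<alpha>))"
      then have f': "f \<in> L" "supp f \<subseteq> insert b (insert a ?\<alpha>)" "f b = 0 \<or> f b = q b"
        by (auto simp: pin_def inside_def)
      then have "f a = 0 \<and> f b = 0"
        using ab[OF f'] False unfolding linked_def by (metis insert_commute)
      then show "f \<in> inside L ?\<alpha>" using f' by (auto simp: inside_def supp_def)
    qed
    from dm_mono[OF sub_pin sub_inside this] show ?thesis by simp
  qed
  have l': "dm (inside L (insert c ?\<delta>)) \<le> dm (inside L ?\<delta>) + of_bool linked'"
  proof (cases linked')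
    case True
    have "dm (inside L (insert c ?\<delta>)) \<le> Suc (dm (inside L ?\<delta>))"
    proof (rule dm_index2[OF sub_inside sub_inside, where \<phi> = "\<lambda>f. f c" and c = "t c"])
      fix f assume "f \<in> inside L (insert c ?\<delta>)"
      then have "f \<in> L" "supp f \<inter> T \<subseteq> {c}" using j1(2) unfolding inside_def by blast+
      then show "f c = 0 \<or> f c = t c" by (rule at_triple[OF _ i1(16)])
    next
      fix f assume "f \<in> inside L (insert c ?\<delta>)" "f c = 0"
      then show "f \<in> inside L ?\<delta>" by (rule inside_insert_vanish)
    qed simp
    with True show ?thesis by simp
  next
    case False
    have "inside L (insert c ?\<delta>) \<subseteq> inside L ?\<delta>"
    proof
      fix f assume f: "f \<in> inside L (insert c ?\<delta>)"
      then have "f c = 0" using False by (auto simp: linked'_def inside_def)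
      with f show "f \<in> inside L ?\<delta>" by (rule inside_insert_vanish)
    qed
    from dm_mono[OF sub_inside sub_inside this] show ?thesis by simp
  qed
  have "W1 \<subseteq> V - T" "W2 \<subseteq> V - T" using d1(5) d2(5) by blast+
  then have sub: "W1 \<subseteq> U2 \<union> W2" "W2 \<subseteq> U1 \<union> W1" by (simp_all only: d1(5) d2(5))
  have W: "?\<gamma> \<union> ?\<delta> = W1" "?\<gamma> \<union> ?\<alpha> = W2" using sub by blast+
  have W': "?\<gamma> \<inter> ?\<delta> = {}" "?\<gamma> \<inter> ?\<alpha> = {}" using d1(6) d2(6) by blast+
  have "card W1 = card ?\<gamma> + card ?\<delta>" "card W2 = card ?\<gamma> + card ?\<alpha>"
  proof -
    have "finite ?\<gamma>" "finite ?\<delta>" "finite ?\<alpha>" using i1(12,13) by simp_all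
    then show "card W1 = card ?\<gamma> + card ?\<delta>" "card W2 = card ?\<gamma> + card ?\<alpha>"
      using card_Un_disjoint[OF _ _ W'(1)] card_Un_disjoint[OF _ _ W'(2)] unfolding W by blast+
  qed
  moreover have "card W1 \<le> dm ?M + 2" by (rule sep_corner(2)[OF s1])
  ultimately show ?thesis
    using orth kerM kerN l l' d2(10) unfolding rk_def by (cases linked; cases linked'; simp)
qed

lemma rk_le2_card:
  assumes "X \<subseteq> V" "rk L X \<le> 2" "4 \<le> card (V - X)"
  shows "card X \<le> 3"
  using rk_ge3'[OF assms(1) _ assms(3)] assms(2) by linarith

lemma sep_card_compl:
  assumes s: "sep a b c U W" and X: "X \<subseteq> V - T" "X \<inter> U = {} \<or> X \<inter> W = {}"
  shows "8 \<le> card (V - X)"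
proof -
  note d = sepD[OF s] and i = sep_in[OF s] and j = sep_disjoint[OF s]
  have "card (U \<union> T) = card U + 3" "card (W \<union> T) = card W + 3"
    using card_Un_disjoint[OF i(12) fin[OF T_V] j(1)] card_Un_disjoint[OF i(13) fin[OF T_V] j(2)] card_t by simp_all
  moreover have "U \<union> T \<subseteq> V - X \<or> W \<union> T \<subseteq> V - X" using X i(10,11) T_V by blast
  then have "card (U \<union> T) \<le> card (V - X) \<or> card (W \<union> T) \<le> card (V - X)"
    using card_mono[of "V - X"] fin_V by blast
  ultimately show ?thesis using d(7,8) by linarith
qed

lemma corners_card:
  assumes s1: "sep a b c U1 W1" and s2: "sep b c a U2 W2"
  shows "card U1 = card (U1 \<inter> U2) + card (U1 \<inter> W2)" "card W1 = card (W1 \<inter> W2) + card (W1 \<inter> U2)"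
    "card U2 = card (U1 \<inter> U2) + card (W1 \<inter> U2)" "card W2 = card (W1 \<inter> W2) + card (U1 \<inter> W2)"
proof -
  note d1 = sepD[OF s1] and d2 = sepD[OF s2] and i1 = sep_in[OF s1] and i2 = sep_in[OF s2]
  have part: "card X = card (Y \<inter> X) + card (Z \<inter> X)"
    if "finite X" "X \<subseteq> V - T" "Y \<union> Z = V - T" "Y \<inter> Z = {}" for X Y Z :: "'a set"
  proof -
    have "X = (Y \<inter> X) \<union> (Z \<inter> X)" using that by blast
    moreover have "(Y \<inter> X) \<inter> (Z \<inter> X) = {}" using that by blast
    ultimately show ?thesis using card_Un_disjoint[of "Y \<inter> X" "Z \<inter> X"] that(1) by simp
  qed
  have sub: "U1 \<subseteq> V - T" "W1 \<subseteq> V - T" "U2 \<subseteq> V - T" "W2 \<subseteq> V - T" using d1(5) d2(5) by blast+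
  show "card U1 = card (U1 \<inter> U2) + card (U1 \<inter> W2)"
    using part[OF i1(12) sub(1) d2(5,6)] by (simp add: Int_commute)
  show "card W1 = card (W1 \<inter> W2) + card (W1 \<inter> U2)"
    using part[OF i1(13) sub(2) d2(5,6)] by (simp add: Int_commute)
  show "card U2 = card (U1 \<inter> U2) + card (W1 \<inter> U2)" using part[OF i2(12) sub(3) d1(5,6)] .
  show "card W2 = card (W1 \<inter> W2) + card (U1 \<inter> W2)" using part[OF i2(13) sub(4) d1(5,6)] by simp
qed

text \<open>
  The predicates \<open>link\<close> and \<open>hook\<close> name the two exceptional vectors of \<open>side_corners\<close>.\<close>

definition link :: "'a \<Rightarrow> 'a \<Rightarrow> 'a set \<Rightarrow> bool" where
  "link a b X \<longleftrightarrow> (\<exists>s\<in>L. supp s \<subseteq> insert a (insert b X) \<and> s a = q a \<and> s b = q b)"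

definition hook :: "'a \<Rightarrow> 'a set \<Rightarrow> bool" where
  "hook c X \<longleftrightarrow> (\<exists>s\<in>L. supp s \<subseteq> insert c X \<and> s c \<noteq> 0)"

text \<open>
  A set that avoids \<open>T\<close> and one side of a separation has at most three elements if its rank is at
  most 2. The ranks of the side corners sum to at most 5, so one of these corners has at most three
  elements. As all \<open>U\<close> and \<open>W\<close> have at least five, \<open>U1 \<inter> U2\<close> and \<open>W1 \<inter> W2\<close> have at least two
  elements. So their ranks are at least 2, hence equal to 2 by \<open>opposite_corners\<close>, and they have at most
  three elements. Therefore the side corners have at least two elements and rank at least 2 as well,
  and one of the two exceptional vectors of \<open>side_corners\<close> must exist. A hook at a corner with
  three elements would make a 4-set of rank 2.\<close>

lemma corner_types:
  assumes s1: "sep a b c U1 W1" and s2: "sep b c a U2 W2"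
  shows "rk L (U1 \<inter> U2) \<le> 2" "card (U1 \<inter> U2) \<le> 3"
    "(rk L (U1 \<inter> W2) \<le> 2 \<and> link a b (U1 \<inter> W2) \<and> 2 \<le> card (U1 \<inter> W2) \<and> card (U1 \<inter> W2) \<le> 3) \<or>
     (card (W1 \<inter> U2) = 2 \<and> hook c (W1 \<inter> U2))"
proof -
  note d1 = sepD[OF s1] and d2 = sepD[OF s2] and i1 = sep_in[OF s1] and i2 = sep_in[OF s2]
  note cc = corners_card[OF s1 s2]
  let ?\<alpha> = "U1 \<inter> W2" and ?\<beta> = "U1 \<inter> U2" and ?\<gamma> = "W1 \<inter> W2" and ?\<delta> = "W1 \<inter> U2"
  have sub: "?\<alpha> \<subseteq> V" "?\<beta> \<subseteq> V" "?\<gamma> \<subseteq> V" "?\<delta> \<subseteq> V" using i1 by blast+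
  have big: "8 \<le> card (V - ?\<alpha>)" "8 \<le> card (V - ?\<beta>)" "8 \<le> card (V - ?\<gamma>)" "8 \<le> card (V - ?\<delta>)"
    using d1(5,6) by (intro sep_card_compl[OF s1]; blast)+
  have le3: "card X \<le> 3" if "X \<subseteq> V" "8 \<le> card (V - X)" "rk L X \<le> 2" for X
    using rk_le2_card[OF that(1,3)] that(2) by linarith
  have ge2: "2 \<le> rk L X" if "X \<subseteq> V" "8 \<le> card (V - X)" "2 \<le> card X" for X
    using rk_ge2[OF that(1,3)] that(2) by linarith
  have one: "rk L ?\<beta> + rk L ?\<gamma> \<le> 4" by (rule opposite_corners[OF s1 s2])
  have two: "rk L ?\<alpha> + rk L ?\<delta> \<le> 3 + of_bool (link a b ?\<alpha>) + of_bool (hook c ?\<delta>)"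
    using side_corners[OF s1 s2] unfolding link_def hook_def .
  then have "rk L ?\<alpha> + rk L ?\<delta> \<le> 5"
    by (cases "link a b ?\<alpha>"; cases "hook c ?\<delta>"; simp)
  then have "rk L ?\<alpha> \<le> 2 \<or> rk L ?\<delta> \<le> 2" by linarith
  then have "card ?\<alpha> \<le> 3 \<or> card ?\<delta> \<le> 3" using le3 sub big by blast
  then have "2 \<le> card ?\<beta>" "2 \<le> card ?\<gamma>" using cc d1(7,8) d2(7,8) by linarith+
  then have "rk L ?\<beta> \<le> 2" "rk L ?\<gamma> \<le> 2" using one ge2[OF sub(2) big(2)] ge2[OF sub(3) big(3)] by linarith+
  then have c3: "card ?\<beta> \<le> 3" "card ?\<gamma> \<le> 3" using le3 sub big by blast+
  show "rk L ?\<beta> \<le> 2" "card ?\<beta> \<le> 3" by fact+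
  have c2: "2 \<le> card ?\<alpha>" "2 \<le> card ?\<delta>" using c3 cc d1(7,8) by linarith+
  have r2: "2 \<le> rk L ?\<alpha>" "2 \<le> rk L ?\<delta>"
    using ge2[OF sub(1) big(1) c2(1)] ge2[OF sub(4) big(4) c2(2)] by auto
  consider "rk L ?\<alpha> \<le> 2" "link a b ?\<alpha>" | "rk L ?\<delta> \<le> 2" "hook c ?\<delta>"
    using two r2 by (cases "link a b ?\<alpha>"; cases "hook c ?\<delta>") force+
  then show "(rk L ?\<alpha> \<le> 2 \<and> link a b ?\<alpha> \<and> 2 \<le> card ?\<alpha> \<and> card ?\<alpha> \<le> 3) \<or> (card ?\<delta> = 2 \<and> hook c ?\<delta>)"
  proof cases
    case 1
    then show ?thesis using le3[OF sub(1) big(1)] c2 by blast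
  next
    case 2
    have "card ?\<delta> \<noteq> 3"
    proof
      assume c: "card ?\<delta> = 3"
      obtain s where s: "s \<in> L" "supp s \<subseteq> insert c ?\<delta>" "s c \<noteq> 0" using 2(2) by (auto simp: hook_def)
      have "Suc (dm (inside L ?\<delta>)) \<le> dm (inside L (insert c ?\<delta>))"
        by (rule dm_Suc_le[OF sub_inside sub_inside, of _ _ s])
          (use s i1(9) in \<open>auto simp: inside_def supp_def\<close>)
      moreover have ci: "card (insert c ?\<delta>) = 4" using c i1(9,13) by simp
      ultimately have "rk L (insert c ?\<delta>) \<le> 2" using 2(1) c by (simp add: rk_def)
      then show False using no_rk2_4set[OF _ ci] i1(3) sub(4) by blast
    qed
    then show ?thesis using le3[OF sub(4) big(4) 2(1)] c2(2) 2(2) by linarith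
  qed
qed

text \<open>
  On \<open>X\<close> there is a triple and, by the link, a further vector. Seen from \<open>R\<close>, both meet the vectors
  inside \<open>R\<close> in \<open>e\<close> only, and \<open>free\<close> forces their entries at \<open>e\<close> to be nonzero and distinct. So all
  vectors inside \<open>R\<close> vanish at \<open>e\<close>, and \<open>R - {e}\<close> is too large for its rank.\<close>

lemma link_triple_split:
  assumes ab: "a \<in> T" "b \<in> T" and X: "X \<subseteq> V - T" "card X = 3" "rk L X \<le> 2" "link a b X"
    and e: "X \<inter> R = {e}" and R: "R \<subseteq> V - T" "5 \<le> card R" "4 \<le> card (V - R)" "rk L R \<le> 3"
    and free: "\<And>f. f \<in> L \<Longrightarrow> supp f \<subseteq> (X - {e}) \<union> T \<Longrightarrow> f a = 0 \<or> f a = t a"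
  shows False
proof -
  obtain \<tau> where \<tau>: "\<tau> \<in> L" "supp \<tau> = X" using rk_card3_triple[OF X(2,3)] .
  obtain s where s: "s \<in> L" "supp s \<subseteq> insert a (insert b X)" "s a = q a" using X(4) by (auto simp: link_def)
  have eX: "e \<in> X" "e \<in> R" using e by blast+
  have \<tau>e: "\<tau> e \<noteq> 0" using eX(1) \<tau>(2) by (auto simp: supp_def)
  have sa: "s a \<noteq> 0" "s a \<noteq> t a" using s(3) q_nz[OF ab(1)] q_neq[OF ab(1)] by simp_all
  have "a \<notin> supp \<tau>" using \<tau>(2) X(1) ab by blast
  then have \<tau>a: "\<tau> a = 0" by (simp add: supp_def)
  have se: "s e \<noteq> 0"
  proof
    assume "s e = 0"
    then have "supp s \<subseteq> (X - {e}) \<union> T" using s(2) ab by (auto simp: supp_def)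
    then show False using free[OF s(1)] sa by blast
  qed
  have s\<tau>: "s e \<noteq> \<tau> e"
  proof
    assume eq: "s e = \<tau> e"
    have "e \<notin> supp (s + \<tau>)" by (simp add: supp_def eq)
    moreover have "supp (s + \<tau>) \<subseteq> X \<union> T" using supp_add[of s \<tau>] s(2) \<tau>(2) ab by blast
    ultimately have "supp (s + \<tau>) \<subseteq> (X - {e}) \<union> T" by blast
    moreover have "s + \<tau> \<in> L" using subgrpD(3)[OF sub_L s(1) \<tau>(1)] .
    ultimately have "(s + \<tau>) a = 0 \<or> (s + \<tau>) a = t a" by (metis free)
    then show False using sa \<tau>a by simp
  qed
  have van: "f e = 0" if "f \<in> inside L R" for f
  proof -
    have f: "f \<in> L" "supp f \<subseteq> R" using that by (simp_all add: inside_def)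
    have "symp (f e) (\<tau> e) = 0" by (rule isotropic_at[OF f(1) \<tau>(1)]) (use f(2) \<tau>(2) e in blast)
    moreover have "symp (f e) (s e) = 0"
      by (rule isotropic_at[OF f(1) s(1)]) (use f(2) s(2) e R(1) ab in blast)
    ultimately show ?thesis using \<tau>e se s\<tau> by (metis symp_eq_0_iff)
  qed
  have RV: "R \<subseteq> V" "finite R" using R(1) fin by blast+
  have "rk L (R - {e}) = rk L R - 1" 
  proof (rule rk_remove_vanishing[OF eX(2) RV(1)])
    fix f assume "f \<in> inside L R" then show "f e = 0" by (rule van)
  qed
  moreover have "3 \<le> rk L (R - {e})"
  proof (rule rk_ge3')
    show "4 \<le> card (R - {e})" using R(2) eX(2) RV(2) by simp
    have "card (V - R) \<le> card (V - (R - {e}))" using fin_V by (intro card_mono) auto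
    then show "4 \<le> card (V - (R - {e}))" using R(3) by linarith
  qed (use RV in blast)
  ultimately show False using R(4) by simp
qed

text \<open>
  The link or hook that \<open>corner_types\<close> provides for the first two separations cannot live on one side
  of the third, by \<open>two_separations_link\<close> for the third separation with one of the others. So the
  third separation cuts that corner properly. A linked corner with three elements would have a single
  element cut off, which \<open>link_triple_split\<close> excludes. So the corner has two elements, one on each
  side, and five elements in \<open>U1\<close> or \<open>U2\<close> leave at least three for \<open>U1 \<inter> U2\<close>.\<close>

lemma three_separations_corner:
  assumes s1: "sep a b c U1 W1" and s2: "sep b c a U2 W2" and s3: "sep c a b U3 W3"
  shows "card (U1 \<inter> U2) = 3 \<and> (card (U1 \<inter> W2 \<inter> U3) = 1 \<or> card (W1 \<inter> U2 \<inter> U3) = 1)"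
proof -
  note d1 = sepD[OF s1] and d2 = sepD[OF s2] and d3 = sepD[OF s3]
  note i1 = sep_in[OF s1] and i2 = sep_in[OF s2] and i3 = sep_in[OF s3]
  let ?\<alpha> = "U1 \<inter> W2" and ?\<delta> = "W1 \<inter> U2"
  \<comment> \<open>For \<open>U1 \<inter> U3\<close> this comes from the third and the first separation, for \<open>W2 \<inter> W3\<close> from the second and the third.\<close>
  have free: "f a = 0 \<or> f a = t a" if f: "f \<in> L" "supp f \<subseteq> Y \<union> T" and Y: "Y \<subseteq> U1 \<inter> U3 \<or> Y \<subseteq> W2 \<inter> W3" for f Y
  proof (use Y in \<open>elim disjE\<close>)
    assume "Y \<subseteq> U1 \<inter> U3"
    then have "supp f \<subseteq> (U3 \<inter> U1) \<union> T" using f(2) by blast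
    from two_separations_link[OF s3 s1 f(1) this] show ?thesis by blast
  next
    assume "Y \<subseteq> W2 \<inter> W3"
    then have "supp f \<subseteq> (W2 \<inter> W3) \<union> T" using f(2) by blast
    from two_separations_link'[OF s2 s3 f(1) this] show ?thesis by blast
  qed
  have \<alpha>sub: "?\<alpha> \<subseteq> V - T" "?\<delta> \<subseteq> V - T" using d1(5) by blast+
  then have \<alpha>part: "?\<alpha> \<subseteq> U3 \<union> W3" "?\<delta> \<subseteq> U3 \<union> W3" using d3(5) by blast+
  have split: "card X = card (X \<inter> U3) + card (X \<inter> W3)" if "X \<subseteq> U3 \<union> W3" "finite X" for X
  proof -
    have "X = (X \<inter> U3) \<union> (X \<inter> W3)" "(X \<inter> U3) \<inter> (X \<inter> W3) = {}" using that d3(6) by blast+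
    then show ?thesis using card_Un_disjoint[of "X \<inter> U3" "X \<inter> W3"] that(2) by simp
  qed
  have f\<alpha>: "finite ?\<alpha>" "finite ?\<delta>" using i1(12,13) by simp_all
  from corner_types(3)[OF s1 s2] show ?thesis
  proof (elim disjE conjE)
    assume r: "rk L ?\<alpha> \<le> 2" and l: "link a b ?\<alpha>" and c: "2 \<le> card ?\<alpha>" "card ?\<alpha> \<le> 3"
    obtain g where g: "g \<in> L" "supp g \<subseteq> insert a (insert b ?\<alpha>)" "g a = q a" using l by (auto simp: link_def)
    have meets: "?\<alpha> \<inter> U3 \<noteq> {}" "?\<alpha> \<inter> W3 \<noteq> {}"
    proof -
      have no: "\<not> ?\<alpha> \<subseteq> Y" if "Y \<subseteq> U1 \<inter> U3 \<or> Y \<subseteq> W2 \<inter> W3" for Y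
      proof
        assume "?\<alpha> \<subseteq> Y"
        then have "supp g \<subseteq> Y \<union> T" using g(2) i1(14,15) by blast
        then show False using free[OF g(1) _ that] g(3) q_nz[OF i1(14)] q_neq[OF i1(14)] by auto
      qed
      show "?\<alpha> \<inter> U3 \<noteq> {}" using no[of "W2 \<inter> W3"] \<alpha>part(1) by blast
      show "?\<alpha> \<inter> W3 \<noteq> {}" using no[of "U1 \<inter> U3"] \<alpha>part(1) by blast
    qed
    then have pos: "0 < card (?\<alpha> \<inter> U3)" "0 < card (?\<alpha> \<inter> W3)" using f\<alpha> by (simp_all add: card_gt_0_iff)
    have "card ?\<alpha> \<noteq> 3"
    proof
      assume c3: "card ?\<alpha> = 3"
      then have "card (?\<alpha> \<inter> U3) = 1 \<or> card (?\<alpha> \<inter> W3) = 1" using split[OF \<alpha>part(1) f\<alpha>(1)] pos by linarith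
      then show False
      proof
        assume "card (?\<alpha> \<inter> U3) = 1"
        then obtain e where e: "?\<alpha> \<inter> U3 = {e}" using card_1_singletonE by blast
        show False
        proof (rule link_triple_split[OF i1(14,15) \<alpha>sub(1) c3 r l e])
          show "U3 \<subseteq> V - T" using d3(5) by blast
          have "U3 \<subseteq> V - T" "U3 \<inter> W3 = {}" using d3(5,6) by blast+
          then have "8 \<le> card (V - U3)" by (intro sep_card_compl[OF s3]) simp_all
          then show "4 \<le> card (V - U3)" by linarith
          show "rk L U3 \<le> 3" using sep_corner(1)[OF sep_sym[OF s3]] by simp
          fix f assume f: "f \<in> L" "supp f \<subseteq> (?\<alpha> - {e}) \<union> T"
          show "f a = 0 \<or> f a = t a" by (rule free[OF f]) (use e \<alpha>part(1) in blast)
        qed (rule d3(7))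
      next
        assume "card (?\<alpha> \<inter> W3) = 1"
        then obtain e where e: "?\<alpha> \<inter> W3 = {e}" using card_1_singletonE by blast
        show False
        proof (rule link_triple_split[OF i1(14,15) \<alpha>sub(1) c3 r l e])
          show "W3 \<subseteq> V - T" using d3(5) by blast
          have "W3 \<subseteq> V - T" "W3 \<inter> U3 = {}" using d3(5,6) by blast+
          then have "8 \<le> card (V - W3)" by (intro sep_card_compl[OF s3]) simp_all
          then show "4 \<le> card (V - W3)" by linarith
          show "rk L W3 \<le> 3" using sep_corner(1)[OF s3] by simp
          fix f assume f: "f \<in> L" "supp f \<subseteq> (?\<alpha> - {e}) \<union> T"
          show "f a = 0 \<or> f a = t a" by (rule free[OF f]) (use e \<alpha>part(1) in blast)
        qed (rule d3(8))
      qed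
    qed
    then have c2: "card ?\<alpha> = 2" using c by linarith
    then have "card (U1 \<inter> U2) = 3" using corners_card(1)[OF s1 s2] d1(7) corner_types(2)[OF s1 s2] by linarith
    moreover have "card (?\<alpha> \<inter> U3) = 1" using split[OF \<alpha>part(1) f\<alpha>(1)] pos c2 by linarith
    ultimately show ?thesis by blast
  next
    assume c2: "card ?\<delta> = 2" and h: "hook c ?\<delta>"
    obtain g where g: "g \<in> L" "supp g \<subseteq> insert c ?\<delta>" "g c \<noteq> 0" using h by (auto simp: hook_def)
    have "a \<notin> supp g" using g(2) d1(3) i1(7) by blast
    then have ga: "g a = 0" by (simp add: supp_def)
    have meets: "?\<delta> \<inter> U3 \<noteq> {}" "?\<delta> \<inter> W3 \<noteq> {}"
    proof -
      have "\<not> ?\<delta> \<subseteq> W1 \<inter> W3"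
      proof
        assume "?\<delta> \<subseteq> W1 \<inter> W3"
        then have "supp g \<subseteq> (W3 \<inter> W1) \<union> T" using g(2) i1(16) by blast
        from two_separations_link'[OF s3 s1 g(1) this] show False using ga g(3) i1(17) by auto
      qed
      then show "?\<delta> \<inter> U3 \<noteq> {}" using \<alpha>part(2) by blast
      have "\<not> ?\<delta> \<subseteq> U2 \<inter> U3"
      proof
        assume "?\<delta> \<subseteq> U2 \<inter> U3"
        then have "supp g \<subseteq> (U2 \<inter> U3) \<union> T" using g(2) i1(16) by blast
        from two_separations_link[OF s2 s3 g(1) this] show False using ga g(3) i1(17) by auto
      qed
      then show "?\<delta> \<inter> W3 \<noteq> {}" using \<alpha>part(2) by blast
    qed
    then have pos: "0 < card (?\<delta> \<inter> U3)" "0 < card (?\<delta> \<inter> W3)" using f\<alpha> by (simp_all add: card_gt_0_iff)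
    have "card (U1 \<inter> U2) = 3" using corners_card(3)[OF s1 s2] d2(7) corner_types(2)[OF s1 s2] c2 by linarith
    moreover have "card (?\<delta> \<inter> U3) = 1" using split[OF \<alpha>part(2) f\<alpha>(2)] pos c2 by linarith
    ultimately show ?thesis by blast
  qed
qed

text \<open>
  By \<open>three_separations_corner\<close> and its cyclic images the three sets \<open>U1 \<inter> U2\<close>, \<open>U2 \<inter> U3\<close>, \<open>U3 \<inter> U1\<close>
  all have three elements and rank at most 2, and two of them share exactly two elements. Uncrossing
  these gives a 4-set of rank 2.\<close>

lemma no_three_separations:
  assumes s1: "sep a b c U1 W1" and s2: "sep b c a U2 W2" and s3: "sep c a b U3 W3"
  shows False
proof -
  note d1 = sepD[OF s1] and d2 = sepD[OF s2] and d3 = sepD[OF s3]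
  note i1 = sep_in[OF s1] and i2 = sep_in[OF s2] and i3 = sep_in[OF s3]
  have c: "card (U1 \<inter> U2) = 3" "card (U2 \<inter> U3) = 3" "card (U3 \<inter> U1) = 3"
    using three_separations_corner[OF s1 s2 s3] three_separations_corner[OF s2 s3 s1]
      three_separations_corner[OF s3 s1 s2] by blast+
  have r: "rk L (U1 \<inter> U2) \<le> 2" "rk L (U2 \<inter> U3) \<le> 2" "rk L (U3 \<inter> U1) \<le> 2"
    using corner_types(1)[OF s1 s2] corner_types(1)[OF s2 s3] corner_types(1)[OF s3 s1] by blast+
  have key: False if XY: "X \<subseteq> V - T" "Y \<subseteq> V - T" "card X = 3" "card Y = 3" "rk L X \<le> 2" "rk L Y \<le> 2"
    "card (X \<inter> Y) = 2" for X Y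
  proof -
    have V: "X \<subseteq> V" "Y \<subseteq> V" using XY by blast+
    have "card (X \<union> Y) = 4" using card_Un_Int[OF fin[OF V(1)] fin[OF V(2)]] XY by simp
    moreover have "rk L (X \<union> Y) \<le> 2" using XY card_V by (intro rk2_Un[OF V]) auto
    ultimately show False using no_rk2_4set[of "X \<union> Y"] V by blast
  qed
  have sub: "U1 \<inter> U2 \<subseteq> V - T" "U2 \<inter> U3 \<subseteq> V - T" "U3 \<inter> U1 \<subseteq> V - T" using d1(5) d2(5) by blast+
  from three_separations_corner[OF s1 s2 s3] show False
  proof (elim conjE disjE)
    assume a: "card (U1 \<inter> W2 \<inter> U3) = 1"
    have e: "(U1 \<inter> U2) \<inter> (U3 \<inter> U1) \<union> U1 \<inter> W2 \<inter> U3 = U3 \<inter> U1"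
      using d1(5) d2(5) by blast
    have "((U1 \<inter> U2) \<inter> (U3 \<inter> U1)) \<inter> (U1 \<inter> W2 \<inter> U3) = {}" using d2(6) by blast
    then have "card (U3 \<inter> U1) = card ((U1 \<inter> U2) \<inter> (U3 \<inter> U1)) + card (U1 \<inter> W2 \<inter> U3)"
      using i1(12) by (subst e[symmetric], intro card_Un_disjoint) auto
    then have "card ((U1 \<inter> U2) \<inter> (U3 \<inter> U1)) = 2" using a c by linarith
    then show False by (rule key[OF sub(1,3) c(1,3) r(1,3)])
  next
    assume a: "card (W1 \<inter> U2 \<inter> U3) = 1"
    have e: "(U1 \<inter> U2) \<inter> (U2 \<inter> U3) \<union> W1 \<inter> U2 \<inter> U3 = U2 \<inter> U3"
      using d1(5) d2(5) by blast
    have "((U1 \<inter> U2) \<inter> (U2 \<inter> U3)) \<inter> (W1 \<inter> U2 \<inter> U3) = {}" using d1(6) by blast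
    then have "card (U2 \<inter> U3) = card ((U1 \<inter> U2) \<inter> (U2 \<inter> U3)) + card (W1 \<inter> U2 \<inter> U3)"
      using i2(12) by (subst e[symmetric], intro card_Un_disjoint) auto
    then have "card ((U1 \<inter> U2) \<inter> (U2 \<inter> U3)) = 2" using a c by linarith
    then show False by (rule key[OF sub(1,2) c(1,2) r(1,2)])
  qed
qed

lemma triple_removal: "\<exists>v\<in>T. prime_removal v (q v) \<and> weak_removal v (q v)"
proof (rule ccontr)
  assume "\<not> ?thesis"
  then have nw: "\<not> weak_removal v (q v)" if "v \<in> T" for v using prime_at_triple that by blast
  obtain a b c where T: "T = {a, b, c}" "a \<noteq> b" "a \<noteq> c" "b \<noteq> c"
    using card_t card_3_iff by metis
  have T': "T = {b, c, a}" "T = {c, a, b}" using T(1) by auto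
  have in_T: "a \<in> T" "b \<in> T" "c \<in> T" using T(1) by blast+
  obtain U1 W1 where s1: "sep a b c U1 W1" using sep_exists[OF T nw[OF in_T(1)]] by blast
  obtain U2 W2 where s2: "sep b c a U2 W2"
    using sep_exists[OF T'(1) T(4) T(2)[symmetric] T(3)[symmetric] nw[OF in_T(2)]] by blast
  obtain U3 W3 where s3: "sep c a b U3 W3"
    using sep_exists[OF T'(2) T(3)[symmetric] T(4)[symmetric] T(2) nw[OF in_T(3)]] by blast
  from s1 s2 s3 show False by (rule no_three_separations)
qed

end

section \<open>Existence of a good removal\<close>

context weakly_connected_system
begin

text \<open>
  If there is a 4-set of rank 2, it is a fan or a quad according to whether it contains a triple.
  Otherwise, if there is any triple, one of its three elements works. If there is none, all removals
  are prime, and for any \<open>v\<close> at all one of the two is weak: \<open>crossing\<close> would divide a set of at least six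
  elements into two sets of rank at most 2, which now have at most two elements each.\<close>

lemma exists_removal:
  assumes pq: "p \<noteq> q" "p \<noteq> 0" "q \<noteq> 0"
  shows "\<exists>v\<in>V. \<exists>r\<in>{p, q}. prime_removal v r \<and> weak_removal v r"
proof (cases "\<exists>F\<subseteq>V. card F = 4 \<and> rk L F \<le> 2")
  case True
  then obtain F where F: "F \<subseteq> V" "card F = 4" "rk L F \<le> 2" by blast
  show ?thesis
  proof (cases "\<exists>t\<in>L. card (supp t) = 3 \<and> supp t \<subseteq> F")
    case True
    then obtain t where t: "t \<in> L" "card (supp t) = 3" "supp t \<subseteq> F" by blast
    obtain c where c: "c \<in> V" "\<forall>r. r \<noteq> 0 \<longrightarrow> r \<noteq> t c \<longrightarrow> prime_removal c r \<and> weak_removal c r"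
      using fan_removal[OF F t] by blast
    define r where "r = (if p = t c then q else p)"
    have "r \<in> {p, q}" "r \<noteq> 0" "r \<noteq> t c" using pq by (auto simp: r_def)
    then show ?thesis using c by blast
  next
    case False
    then have nt: "\<not> supp t \<subseteq> F" if "t \<in> L" "card (supp t) = 3" for t using that by blast
    have "F \<noteq> {}" using F by auto
    then obtain v where v: "v \<in> F" by blast
    have "\<exists>r\<in>{p, q}. prime_removal v r \<and> weak_removal v r"
      by (rule quad_removal[OF F _ v pq]) (rule nt)
    then show ?thesis using v F(1) by blast
  qed
next
  case no4: False
  show ?thesis
  proof (cases "\<exists>t\<in>L. card (supp t) = 3")
    case True
    then obtain t where t: "t \<in> L" "card (supp t) = 3" by blast
    define d where "d v = (if t v = p then q else p)" for v
    interpret triangle_system V L t d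
    proof unfold_locales
      show "\<not> rk L F \<le> 2" if "F \<subseteq> V" "card F = 4" for F using no4 that by blast
      show "d v \<noteq> 0" "d v \<noteq> t v" for v using pq by (auto simp: d_def)
    qed (rule t)+
    obtain v where v: "v \<in> supp t" "prime_removal v (d v) \<and> weak_removal v (d v)"
      using triple_removal by blast
    have "d v \<in> {p, q}" by (simp add: d_def)
    moreover have "v \<in> V" using v(1) supp_L[OF t(1)] by blast
    ultimately show ?thesis using v(2) by blast
  next
    case no3: False
    have "V \<noteq> {}" using card_V by auto
    then obtain v where v: "v \<in> V" by blast
    have prime: "prime_removal v r" if r: "r \<noteq> 0" for r
    proof (rule ccontr)
      assume "\<not> prime_removal v r"
      then obtain f where "f \<in> L" "card (supp f) = 3" using not_prime_removal[OF v r] by blast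
      then show False using no3 by blast
    qed
    have "weak_removal v p \<or> weak_removal v q"
    proof (rule ccontr)
      assume "\<not> ?thesis"
      then have nw: "\<not> weak_removal v p" "\<not> weak_removal v q" by blast+
      obtain r A C where "r = p \<or> r = q" and A: "A \<subseteq> V - {v}" "6 \<le> card A" "6 \<le> card (V - {v} - A)"
        and "prk L v r A \<le> 2" and AC: "rk L (A \<inter> C) \<le> 2" "rk L (A - C) \<le> 2"
        using crossing[OF v pq nw] .
      note fA = in_Diff[OF A(1)]
      have small: "card Z \<le> 2" if Z: "Z \<subseteq> A" "rk L Z \<le> 2" for Z
      proof -
        have ZV: "Z \<subseteq> V" using Z fA by blast
        have "card Z \<le> card A" using Z(1) fA(2) by (rule card_mono[rotated])
        then have "5 \<le> card (V - Z)" using card_add_compl[OF ZV] card_removal_compl[OF v A(1)] A(3) by linarith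
        then have "\<not> 5 \<le> card Z" using rk_ge3[OF ZV] Z(2) by linarith
        moreover have "card Z \<noteq> 4" using no4 ZV Z(2) by blast
        moreover have "card Z \<noteq> 3"
        proof
          assume c: "card Z = 3"
          obtain f where "f \<in> L" "supp f = Z" using rk_card3_triple[OF c Z(2)] .
          then show False using no3 c by blast
        qed
        ultimately show ?thesis by linarith
      qed
      have "card A = card (A \<inter> C) + card (A - C)"
        using card_Un_disjoint[of "A \<inter> C" "A - C"] fA(2) by (simp add: Int_Diff_Un Int_Diff_disjoint)
      moreover have "card (A \<inter> C) \<le> 2" "card (A - C) \<le> 2"
        by (rule small[OF _ AC(1)], blast) (rule small[OF _ AC(2)], blast)
      ultimately show False using A(2) by linarith
    qed
    then show ?thesis using v prime[OF pq(2)] prime[OF pq(3)] by blast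
  qed
qed

end

section \<open>The system of a graph\<close>

lemma card_bit_vec: "finite (carrier_vec n :: bit vec set)" "card (carrier_vec n :: bit vec set) = 2 ^ n"
proof -
  have "x \<in> {0, 1}" for x :: bit by (cases x) simp_all
  then have U: "(UNIV :: bit set) = {0, 1}" by blast
  have b: "bij_betw list_of_vec (carrier_vec n) {xs :: bit list. set xs \<subseteq> {0, 1} \<and> length xs = n}"
  proof (rule bij_betwI[where g = vec_of_list])
    show "list_of_vec \<in> carrier_vec n \<rightarrow> {xs :: bit list. set xs \<subseteq> {0, 1} \<and> length xs = n}"
      using U by auto
  qed (auto simp: vec_list list_vec intro!: carrier_vecI)
  have c: "card {xs :: bit list. set xs \<subseteq> {0, 1} \<and> length xs = n} = 2 ^ n"
  proof -
    have "card {0, 1 :: bit} = 2" by simp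
    then show ?thesis using card_lists_length_eq[of "{0, 1 :: bit}" n] by (simp only: finite.intros)
  qed
  show "card (carrier_vec n :: bit vec set) = 2 ^ n" using bij_betw_same_card[OF b] c by simp
  have "finite {xs :: bit list. set xs \<subseteq> {0, 1} \<and> length xs = n}" by (rule finite_lists_length_eq) simp
  then show "finite (carrier_vec n :: bit vec set)" using bij_betw_finite[OF b] by simp
qed

text \<open>
  All nonempty fibres of the linear map are translates of its kernel.\<close>

lemma card_image_kernel:
  fixes A :: "bit mat"
  assumes A: "A \<in> carrier_mat nr nc"
  shows "card ((*\<^sub>v) A ` carrier_vec nc) * card {x \<in> carrier_vec nc. A *\<^sub>v x = 0\<^sub>v nr} = 2 ^ nc"
proof -
  let ?C = "carrier_vec nc :: bit vec set" and ?K = "{x \<in> carrier_vec nc. A *\<^sub>v x = 0\<^sub>v nr}"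
  have fib: "card {x \<in> ?C. A *\<^sub>v x = y} = card ?K" if y: "y \<in> (*\<^sub>v) A ` ?C" for y
  proof -
    obtain x0 where x0: "x0 \<in> ?C" "A *\<^sub>v x0 = y" using y by auto
    have yc: "y \<in> carrier_vec nr" using A x0 by auto
    have "bij_betw (\<lambda>x. x - x0) {x \<in> ?C. A *\<^sub>v x = y} ?K"
    proof (rule bij_betwI[where g = "\<lambda>x. x + x0"])
      show "(\<lambda>x. x - x0) \<in> {x \<in> ?C. A *\<^sub>v x = y} \<rightarrow> ?K"
        using A x0 yc by (auto simp: mult_minus_distrib_mat_vec)
      show "(\<lambda>x. x + x0) \<in> ?K \<rightarrow> {x \<in> ?C. A *\<^sub>v x = y}"
        using A x0 yc by (auto simp: mult_add_distrib_mat_vec)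
    next
      fix x assume "x \<in> {x \<in> ?C. A *\<^sub>v x = y}"
      then show "x - x0 + x0 = x" using x0 by (intro eq_vecI) auto
    next
      fix x assume "x \<in> ?K"
      then show "x + x0 - x0 = x" using x0 by (intro eq_vecI) auto
    qed
    then show ?thesis by (rule bij_betw_same_card)
  qed
  have "card ?C = (\<Sum>y\<in>(*\<^sub>v) A ` ?C. card {x \<in> ?C. A *\<^sub>v x = y})"
    using card_bit_vec(1) by (subst card_eq_sum, subst sum.image_gen[of _ _ "(*\<^sub>v) A"]) auto
  also have "\<dots> = card ((*\<^sub>v) A ` ?C) * card ?K" using fib by simp
  finally show ?thesis using card_bit_vec(2)[of nc] by simp
qed

text \<open>
  A maximal independent set of columns forms a matrix with the same image and trivial kernel.\<close>

lemma card_image_rank: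
  fixes A :: "bit mat"
  assumes A: "A \<in> carrier_mat nr nc"
  shows "card ((*\<^sub>v) A ` carrier_vec nc) = 2 ^ vec_space.rank nr A"
proof -
  interpret vec_space "TYPE(bit)" nr .
  have im: "(*\<^sub>v) B ` carrier_vec k = span (set (cols B))" if B: "B \<in> carrier_mat nr k" for B k
  proof -
    have "span (set (cols B)) = {y \<in> carrier_vec nr. \<exists>x\<in>carrier_vec k. B *\<^sub>v x = y}"
      using col_space_eq[OF B] unfolding carrier_matD[OF B] col_space_def .
    also have "\<dots> = (*\<^sub>v) B ` carrier_vec k" using mult_mat_vec_carrier[OF B] by blast
    finally show ?thesis by (rule sym)
  qed
  have cA: "set (cols A) \<subseteq> carrier_vec nr" using cols_dim A by blast
  have "lin_indpt {}" unfolding lin_dep_def by blast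
  then have "\<exists>S. finite S \<and> maximal S (\<lambda>T. T \<subseteq> set (cols A) \<and> lin_indpt T) \<and> {} \<subseteq> S"
    by (intro maximal_exists_superset[of "set (cols A)"]) blast+
  then obtain S where S: "finite S" "maximal S (\<lambda>T. T \<subseteq> set (cols A) \<and> lin_indpt T)" by blast
  have Ssub: "S \<subseteq> set (cols A)" and Sli: "lin_indpt S" using S(2) unfolding maximal_def by blast+
  have rk: "rank A = card S" by (rule rank_card_indpt[OF A S(2)])
  have Sc: "S \<subseteq> carrier_vec nr" using Ssub cA by blast
  have "set (cols A) \<subseteq> span S"
  proof
    fix s assume s: "s \<in> set (cols A)"
    show "s \<in> span S"
    proof (rule ccontr)
      assume ns: "s \<notin> span S"
      then have sS: "s \<notin> S" using span_mem[OF Sc] by blast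
      have sc: "s \<in> carrier_vec nr" using s cA by blast
      from ns have "lin_indpt (S \<union> {s})"
        using lin_dep_iff_in_span[OF Sc Sli sc sS] by blast
      moreover have "S \<union> {s} \<noteq> S" using sS by blast
      ultimately show False using S(2) Ssub s unfolding maximal_def by blast
    qed
  qed
  then have "span (set (cols A)) \<subseteq> span S"
    by (rule span_is_subset) (rule span_is_submodule[OF Sc])
  then have sp: "span (set (cols A)) = span S" using span_is_monotone[OF Ssub] by blast
  obtain ss where ss: "set ss = S" "distinct ss" using finite_distinct_list[OF S(1)] by blast
  define B where "B = mat_of_cols nr ss"
  have B: "B \<in> carrier_mat nr (length ss)" by (simp add: B_def)
  have cB: "cols B = ss" unfolding B_def using ss Ssub cA by (intro cols_mat_of_cols) auto
  have "x = 0\<^sub>v (length ss)" if x: "x \<in> carrier_vec (length ss)" "B *\<^sub>v x = 0\<^sub>v nr" for x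
    using lin_depI[OF B x(1) _ x(2)] Sli unfolding cB ss(1) using ss(2) by blast
  then have "{x \<in> carrier_vec (length ss). B *\<^sub>v x = 0\<^sub>v nr} = {0\<^sub>v (length ss)}"
    using B by auto
  then have "card ((*\<^sub>v) B ` carrier_vec (length ss)) = 2 ^ length ss"
    using card_image_kernel[OF B] by simp
  moreover have "length ss = rank A" using distinct_card[OF ss(2)] unfolding rk ss(1) by (rule sym)
  moreover have "(*\<^sub>v) B ` carrier_vec (length ss) = (*\<^sub>v) A ` carrier_vec nc"
    unfolding im[OF A] im[OF B] cB ss(1) sp ..
  ultimately show ?thesis by (simp only:)
qed

lemma card_kernel_rank:
  fixes A :: "bit mat"
  assumes "A \<in> carrier_mat nr nc"
  shows "card {x \<in> carrier_vec nc. A *\<^sub>v x = 0\<^sub>v nr} * 2 ^ vec_space.rank nr A = 2 ^ nc"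
  using card_image_kernel[OF assms] card_image_rank[OF assms] by (simp add: mult.commute)

lemma bit_double [simp]: "(a :: bit) + a = 0"
  by (cases a) simp_all

definition adj :: "'a pair_pre_digraph \<Rightarrow> 'a \<Rightarrow> 'a \<Rightarrow> bit" where
  "adj G u v = of_bool ((u, v) \<in> parcs G)"

text \<open>
  Extension by zero makes a vector indexed by \<open>E\<close> a unique function, so that such vectors can be counted.\<close>

definition vanish_off :: "'a set \<Rightarrow> ('a \<Rightarrow> bit) set" where
  "vanish_off E = {x. \<forall>v. v \<notin> E \<longrightarrow> x v = 0}"

text \<open>
  The vector \<open>(x, A x)\<close> for the adjacency matrix \<open>A\<close> of \<open>G\<close>.\<close>

definition gvec :: "'a pair_pre_digraph \<Rightarrow> ('a \<Rightarrow> bit) \<Rightarrow> 'a kvec" where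
  "gvec G x = (\<lambda>v. if v \<in> pverts G then (x v, \<Sum>u\<in>pverts G. adj G v u * x u) else 0)"

definition gsys :: "'a pair_pre_digraph \<Rightarrow> 'a kvec set" where
  "gsys G = gvec G ` vanish_off (pverts G)"

lemma pair_graphD:
  assumes "pair_graph G"
  shows "finite (pverts G)" "(u, v) \<in> parcs G \<Longrightarrow> (v, u) \<in> parcs G" "(u, v) \<in> parcs G \<Longrightarrow> u \<in> pverts G"
    "(u, v) \<in> parcs G \<Longrightarrow> v \<in> pverts G" "(u, u) \<notin> parcs G"
proof -
  interpret pair_graph G by fact
  show "finite (pverts G)" by (rule pair_finite_verts)
  show "(u, v) \<in> parcs G \<Longrightarrow> (v, u) \<in> parcs G"
    using pair_sym_arcs by (auto simp: symmetric_def dest: symD)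
  show "(u, v) \<in> parcs G \<Longrightarrow> u \<in> pverts G" by (rule in_arcsD1)
  show "(u, v) \<in> parcs G \<Longrightarrow> v \<in> pverts G" by (rule in_arcsD2)
  show "(u, u) \<notin> parcs G" using pair_no_loops by force
qed

lemma pair_graphI:
  assumes "finite (pverts G)" "\<And>u v. (u, v) \<in> parcs G \<Longrightarrow> (v, u) \<in> parcs G"
    "\<And>u v. (u, v) \<in> parcs G \<Longrightarrow> u \<in> pverts G" "\<And>u. (u, u) \<notin> parcs G"
  shows "pair_graph G"
proof unfold_locales
  show "fst e \<in> pverts G" if "e \<in> parcs G" for e using that assms(3)[of "fst e" "snd e"] by simp
  show "snd e \<in> pverts G" if "e \<in> parcs G" for e
    using that assms(3)[of "snd e" "fst e"] assms(2)[of "fst e" "snd e"] by simp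
  show "fst e \<noteq> snd e" if "e \<in> parcs G" for e using that assms(4)[of "fst e"] by (cases e) auto
  have "parcs G \<subseteq> pverts G \<times> pverts G" using assms(2,3) by fast
  then show "finite (parcs G)" using assms(1) by (meson finite_SigmaI finite_subset)
  show "symmetric (with_proj G)" using assms(2) by (auto simp: symmetric_def sym_def)
qed (rule assms(1))

lemma adj_sym: "pair_graph G \<Longrightarrow> adj G u v = adj G v u"
  unfolding adj_def by (rule arg_cong[where f = of_bool]) (blast intro: pair_graphD(2))

lemma card_vanish_off:
  assumes "finite E"
  shows "card (vanish_off E) = 2 ^ card E" "finite (vanish_off E)"
proof -
  have b: "bij_betw (\<lambda>x. {v. x v = 1}) (vanish_off E) (Pow E)"
  proof (rule bij_betwI[where g = "\<lambda>S v. of_bool (v \<in> S)"])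
    have "v \<in> E" if "x \<in> vanish_off E" "x v = 1" for x v
    proof (rule ccontr)
      assume "v \<notin> E"
      then have "x v = 0" using that(1) by (simp add: vanish_off_def)
      then show False using that(2) by simp
    qed
    then show "(\<lambda>x. {v. x v = 1}) \<in> vanish_off E \<rightarrow> Pow E" by blast
    show "(\<lambda>S v. of_bool (v \<in> S)) \<in> Pow E \<rightarrow> vanish_off E" by (auto simp: vanish_off_def)
    show "(\<lambda>v. of_bool (v \<in> {v. x v = 1})) = x" if "x \<in> vanish_off E" for x
    proof
      fix v show "of_bool (v \<in> {v. x v = 1}) = x v" by (cases "x v") simp_all
    qed
    show "{v. (of_bool (v \<in> S) :: bit) = 1} = S" if "S \<in> Pow E" for S by auto
  qed
  show "card (vanish_off E) = 2 ^ card E" using bij_betw_same_card[OF b] assms by (simp add: card_Pow)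
  show "finite (vanish_off E)" using bij_betw_finite[OF b] assms by simp
qed

lemma gvec_inj: "inj_on (gvec G) (vanish_off (pverts G))"
proof (rule inj_onI)
  fix x y assume x: "x \<in> vanish_off (pverts G)" and y: "y \<in> vanish_off (pverts G)" and eq: "gvec G x = gvec G y"
  show "x = y"
  proof
    fix v show "x v = y v"
      using fun_cong[OF eq, of v] x y by (cases "v \<in> pverts G") (auto simp: gvec_def vanish_off_def)
  qed
qed

lemma gvec_add: "gvec G (\<lambda>v. x v + y v) = gvec G x + gvec G y"
proof
  fix v
  have "(\<Sum>u\<in>pverts G. adj G v u * (x u + y u)) = (\<Sum>u\<in>pverts G. adj G v u * x u) + (\<Sum>u\<in>pverts G. adj G v u * y u)"
    by (simp only: distrib_left sum.distrib)
  then show "gvec G (\<lambda>v. x v + y v) v = (gvec G x + gvec G y) v"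
    by (simp only: gvec_def plus_fun_def split: if_split) (simp add: plus_prod_def)
qed

text \<open>
  Isotropy is the symmetry of the adjacency matrix.\<close>

lemma gsys_lagrangian:
  assumes G: "pair_graph G"
  shows "lagrangian (pverts G) (gsys G)"
proof
  note fin = pair_graphD(1)[OF G]
  show "finite (pverts G)" by (rule fin)
  show c: "card (gsys G) = 2 ^ card (pverts G)"
    unfolding gsys_def card_image[OF gvec_inj] by (rule card_vanish_off(1)[OF fin])
  show "subgrp (gsys G)"
    unfolding subgrp_def
  proof (intro conjI ballI)
    show "finite (gsys G)" unfolding gsys_def using card_vanish_off(2)[OF fin] by simp
    have "gvec G (\<lambda>_. 0) = 0" by (auto simp: gvec_def fun_eq_iff zero_prod_def)
    moreover have "(\<lambda>_. 0) \<in> vanish_off (pverts G)" by (simp add: vanish_off_def)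
    ultimately show "0 \<in> gsys G" unfolding gsys_def by (metis image_eqI)
    fix f g assume "f \<in> gsys G" "g \<in> gsys G"
    then obtain x y where x: "x \<in> vanish_off (pverts G)" "f = gvec G x"
      and y: "y \<in> vanish_off (pverts G)" "g = gvec G y" unfolding gsys_def by blast
    have "(\<lambda>v. x v + y v) \<in> vanish_off (pverts G)" using x y by (simp add: vanish_off_def)
    then show "f + g \<in> gsys G" unfolding gsys_def x y gvec_add[symmetric] by (rule imageI)
  qed
  show "supp f \<subseteq> pverts G" if f: "f \<in> gsys G" for f
    using f unfolding gsys_def by (auto simp: gvec_def supp_def split: if_splits)
  fix f g assume "f \<in> gsys G" "g \<in> gsys G"
  then obtain x y where f: "f = gvec G x" and g: "g = gvec G y" unfolding gsys_def by blast
  have "form (pverts G) f g = (\<Sum>v\<in>pverts G. x v * (\<Sum>u\<in>pverts G. adj G v u * y u) + y v * (\<Sum>u\<in>pverts G. adj G v u * x u))"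
    unfolding form_def f g by (rule sum.cong) (simp_all only: gvec_def symp_def if_True fst_conv snd_conv mult.commute)
  also have "\<dots> = (\<Sum>v\<in>pverts G. \<Sum>u\<in>pverts G. x v * (adj G v u * y u)) + (\<Sum>v\<in>pverts G. \<Sum>u\<in>pverts G. y v * (adj G v u * x u))"
    by (simp only: sum.distrib sum_distrib_left)
  also have "(\<Sum>v\<in>pverts G. \<Sum>u\<in>pverts G. y v * (adj G v u * x u)) = (\<Sum>u\<in>pverts G. \<Sum>v\<in>pverts G. y v * (adj G v u * x u))"
    by (rule sum.swap)
  also have "\<dots> = (\<Sum>u\<in>pverts G. \<Sum>v\<in>pverts G. x u * (adj G u v * y v))"
    by (intro sum.cong refl) (metis adj_sym[OF G] mult.commute mult.left_commute)
  finally show "form (pverts G) f g = 0" by (simp only: bit_double)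
qed

lemma enum_of: "finite X \<Longrightarrow> distinct (enum_of X) \<and> set (enum_of X) = X"
  unfolding enum_of_def by (rule someI_ex) (metis finite_distinct_list)

text \<open>
  Let \<open>Y\<close> be the complement of \<open>X\<close>. The vector \<open>(x, A x)\<close> is supported by \<open>Y\<close> iff \<open>x\<close> vanishes on \<open>X\<close> and
  the \<open>X \<times> Y\<close> submatrix of \<open>A\<close> annihilates it. So \<open>inside (gsys G) Y\<close> is a copy of the kernel of that
  matrix, and its dimension is \<open>card Y\<close> minus the cut-rank. Symmetry of \<open>rk\<close> turns \<open>Y\<close> into \<open>X\<close>.\<close>

lemma cut_rank_eq_rk:
  assumes G: "pair_graph G" and X: "X \<subseteq> pverts G"
  shows "int (cut_rank G X) = rk (gsys G) X"
proof -
  interpret lagrangian "pverts G" "gsys G" by (rule gsys_lagrangian[OF G])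
  define Y where "Y = pverts G - X"
  define xs where "xs = enum_of X"
  define ys where "ys = enum_of Y"
  define M where "M = adj_submatrix G xs ys"
  have fXY: "finite X" "finite Y" using X fin_V finite_subset by (auto simp: Y_def)
  have xs: "distinct xs" "set xs = X" and ys: "distinct ys" "set ys = Y"
    using enum_of[OF fXY(1)] enum_of[OF fXY(2)] by (simp_all add: xs_def ys_def)
  have len: "length xs = card X" "length ys = card Y"
    using distinct_card[OF xs(1)] distinct_card[OF ys(1)] xs(2) ys(2) by simp_all
  have M: "M \<in> carrier_mat (card X) (card Y)" by (simp add: M_def adj_submatrix_def len)
  define E where "E = {x \<in> vanish_off Y. \<forall>v\<in>X. (\<Sum>u\<in>Y. adj G v u * x u) = 0}"
  have sumY: "(\<Sum>u\<in>pverts G. adj G v u * x u) = (\<Sum>u\<in>Y. adj G v u * x u)" if "x \<in> vanish_off Y" for x v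
    by (rule sum.mono_neutral_right[OF fin_V]) (use that in \<open>auto simp: Y_def vanish_off_def\<close>)
  have YV: "vanish_off Y \<subseteq> vanish_off (pverts G)" by (auto simp: vanish_off_def Y_def)
  have "inside (gsys G) Y = gvec G ` E"
  proof (intro equalityI subsetI)
    fix f assume f: "f \<in> inside (gsys G) Y"
    then obtain x where x: "x \<in> vanish_off (pverts G)" "f = gvec G x" unfolding inside_def gsys_def by blast
    have z: "gvec G x v = 0" if "v \<in> X" for v
    proof -
      have "v \<notin> supp f" using f that by (auto simp: inside_def Y_def)
      then show ?thesis by (simp add: x(2) supp_def)
    qed
    have xsv: "x v = 0 \<and> (\<Sum>u\<in>pverts G. adj G v u * x u) = 0" if v: "v \<in> X" for v
      using z[OF v] X v unfolding gvec_def zero_prod_def by (metis Pair_inject subsetD)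
    then have xv: "x v = 0" and sv: "(\<Sum>u\<in>pverts G. adj G v u * x u) = 0" if "v \<in> X" for v
      using that by blast+
    have xY: "x \<in> vanish_off Y" using x(1) xv unfolding vanish_off_def Y_def by blast
    then have "x \<in> E" using sv unfolding E_def sumY[OF xY] by blast
    then show "f \<in> gvec G ` E" using x(2) by blast
  next
    fix f assume "f \<in> gvec G ` E"
    then obtain x where x: "x \<in> vanish_off Y" "\<forall>v\<in>X. (\<Sum>u\<in>Y. adj G v u * x u) = 0" "f = gvec G x"
      unfolding E_def by blast
    have "f v = 0" if v: "v \<notin> Y" for v
    proof (cases "v \<in> X")
      case True
      then have "(\<Sum>u\<in>pverts G. adj G v u * x u) = 0" using x(2) sumY[OF x(1), of v] by simp
      moreover have "x v = 0" using x(1) v by (simp add: vanish_off_def)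
      ultimately show ?thesis by (simp add: x(3) gvec_def zero_prod_def)
    next
      case False
      then have "v \<notin> pverts G" using v by (simp add: Y_def)
      then show ?thesis by (simp add: x(3) gvec_def)
    qed
    then have "supp f \<subseteq> Y" by (auto simp: supp_def)
    moreover have "f \<in> gsys G" unfolding gsys_def x(3) by (rule imageI[OF subsetD[OF YV x(1)]])
    ultimately show "f \<in> inside (gsys G) Y" by (simp add: inside_def)
  qed
  moreover have "inj_on (gvec G) E" 
  proof (rule inj_on_subset[OF gvec_inj])
    have "E \<subseteq> vanish_off Y" unfolding E_def by blast
    then show "E \<subseteq> vanish_off (pverts G)" using YV by (rule subset_trans)
  qed
  ultimately have c1: "card (inside (gsys G) Y) = card E" by (simp add: card_image)
  have bn: "bij_betw ((!) ys) {0..<card Y} Y"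
    using bij_betw_nth[OF ys(1) refl ys(2)[symmetric]] len by (simp add: atLeast0LessThan)
  have mult: "(M *\<^sub>v vec (card Y) (\<lambda>j. x (ys ! j))) $ i = (\<Sum>u\<in>Y. adj G (xs ! i) u * x u)"
    if i: "i < card X" for i x
  proof -
    have "(M *\<^sub>v vec (card Y) (\<lambda>j. x (ys ! j))) $ i = (\<Sum>j = 0..<card Y. row M i $ j * x (ys ! j))"
      using i M by (simp add: scalar_prod_def)
    also have "\<dots> = (\<Sum>j = 0..<card Y. adj G (xs ! i) (ys ! j) * x (ys ! j))"
      by (rule sum.cong) (use i M in \<open>simp_all add: M_def adj_submatrix_def adj_def len\<close>)
    also have "\<dots> = (\<Sum>u\<in>Y. adj G (xs ! i) u * x u)"
      by (rule sum.reindex_bij_betw[OF bn, of "\<lambda>u. adj G (xs ! i) u * x u"])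
    finally show ?thesis .
  qed
  have bj: "bij_betw (\<lambda>x. vec (card Y) (\<lambda>j. x (ys ! j))) E {y \<in> carrier_vec (card Y). M *\<^sub>v y = 0\<^sub>v (card X)}"
  proof -
    have zero: "M *\<^sub>v vec (card Y) (\<lambda>j. x (ys ! j)) = 0\<^sub>v (card X) \<longleftrightarrow> (\<forall>v\<in>X. (\<Sum>u\<in>Y. adj G v u * x u) = 0)" for x
    proof
      assume h: "M *\<^sub>v vec (card Y) (\<lambda>j. x (ys ! j)) = 0\<^sub>v (card X)"
      show "\<forall>v\<in>X. (\<Sum>u\<in>Y. adj G v u * x u) = 0"
      proof
        fix v assume "v \<in> X"
        then obtain i where i: "i < card X" "v = xs ! i" using xs(2) len(1) by (metis in_set_conv_nth)
        show "(\<Sum>u\<in>Y. adj G v u * x u) = 0" using mult[OF i(1), of x] unfolding h i(2) using i(1) by simp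
      qed
    next
      assume h: "\<forall>v\<in>X. (\<Sum>u\<in>Y. adj G v u * x u) = 0"
      show "M *\<^sub>v vec (card Y) (\<lambda>j. x (ys ! j)) = 0\<^sub>v (card X)"
      proof (rule eq_vecI)
        fix i assume "i < dim_vec (0\<^sub>v (card X) :: bit vec)"
        then have i: "i < card X" by simp
        then have "xs ! i \<in> X" using xs(2) len(1) nth_mem by metis
        then show "(M *\<^sub>v vec (card Y) (\<lambda>j. x (ys ! j))) $ i = 0\<^sub>v (card X) $ i"
          using mult[OF i, of x] h i by simp
      qed (use M in simp)
    qed
    show ?thesis
    proof (rule bij_betw_imageI)
      show "inj_on (\<lambda>x. vec (card Y) (\<lambda>j. x (ys ! j))) E"
      proof (rule inj_onI)
        fix x y assume x: "x \<in> E" and y: "y \<in> E"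
          and eq: "vec (card Y) (\<lambda>j. x (ys ! j)) = vec (card Y) (\<lambda>j. y (ys ! j))"
        show "x = y"
        proof
          fix v
          show "x v = y v"
          proof (cases "v \<in> Y")
            case True
            then obtain j where j: "j < card Y" "v = ys ! j" using ys(2) len(2) by (metis in_set_conv_nth)
            have "vec (card Y) (\<lambda>j. x (ys ! j)) $ j = vec (card Y) (\<lambda>j. y (ys ! j)) $ j" by (simp only: eq)
            then show ?thesis using j by simp
          next
            case False
            then show ?thesis using x y by (simp add: E_def vanish_off_def)
          qed
        qed
      qed
      show "(\<lambda>x. vec (card Y) (\<lambda>j. x (ys ! j))) ` E = {y \<in> carrier_vec (card Y). M *\<^sub>v y = 0\<^sub>v (card X)}"
      proof (intro equalityI subsetI)
        fix y assume y: "y \<in> (\<lambda>x. vec (card Y) (\<lambda>j. x (ys ! j))) ` E"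
        show "y \<in> {y \<in> carrier_vec (card Y). M *\<^sub>v y = 0\<^sub>v (card X)}"
        proof
          obtain x where x: "x \<in> E" "y = vec (card Y) (\<lambda>j. x (ys ! j))" using y by blast
          have "\<forall>v\<in>X. (\<Sum>u\<in>Y. adj G v u * x u) = 0" using x(1) unfolding E_def by blast
          then show "y \<in> carrier_vec (card Y) \<and> M *\<^sub>v y = 0\<^sub>v (card X)"
            unfolding x(2) using iffD2[OF zero] by simp
        qed
      next
        fix y assume y: "y \<in> {y \<in> carrier_vec (card Y). M *\<^sub>v y = 0\<^sub>v (card X)}"
        define g where "g = the_inv_into {0..<card Y} ((!) ys)"
        define x where "x = (\<lambda>v. if v \<in> Y then y $ g v else 0)"
        have "x (ys ! j) = y $ j" if j: "j < card Y" for j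
        proof -
          have "ys ! j \<in> Y" using j ys(2) len(2) nth_mem by metis
          moreover have "g (ys ! j) = j" unfolding g_def
            by (rule the_inv_into_f_f) (use bn j in \<open>auto simp: bij_betw_def\<close>)
          ultimately show ?thesis by (simp add: x_def)
        qed
        then have yx: "vec (card Y) (\<lambda>j. x (ys ! j)) = y" using y by (intro eq_vecI) auto
        have "M *\<^sub>v y = 0\<^sub>v (card X)" using y by blast
        then have "M *\<^sub>v vec (card Y) (\<lambda>j. x (ys ! j)) = 0\<^sub>v (card X)" by (subst yx)
        then have "\<forall>v\<in>X. (\<Sum>u\<in>Y. adj G v u * x u) = 0" by (rule iffD1[OF zero])
        moreover have "x \<in> vanish_off Y" by (simp add: vanish_off_def x_def)
        ultimately have "x \<in> E" unfolding E_def by (intro CollectI conjI)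
        then show "y \<in> (\<lambda>x. vec (card Y) (\<lambda>j. x (ys ! j))) ` E"
          by (rule image_eqI[where x = x, rotated]) (rule yx[symmetric])
      qed
    qed
  qed
  have "card (inside (gsys G) Y) * 2 ^ vec_space.rank (card X) M = 2 ^ card Y"
    using card_kernel_rank[OF M] bij_betw_same_card[OF bj] c1 by simp
  then have "(2::nat) ^ (dm (inside (gsys G) Y) + vec_space.rank (card X) M) = 2 ^ card Y"
    by (simp add: card_dm[OF sub_inside] power_add)
  then have "dm (inside (gsys G) Y) + vec_space.rank (card X) M = card Y"
    by (rule power_inject_exp[THEN iffD1, rotated]) simp
  moreover have "cut_rank G X = vec_space.rank (card X) M"
    unfolding cut_rank_def M_def xs_def ys_def Y_def ..
  ultimately have "int (cut_rank G X) = rk (gsys G) Y" by (simp add: rk_def)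
  then show ?thesis using rk_sym[OF X] by (simp add: Y_def)
qed

section \<open>Deletion and pivoting\<close>

definition delete_vertex :: "'a pair_pre_digraph \<Rightarrow> 'a \<Rightarrow> 'a pair_pre_digraph" where
  "delete_vertex G z = \<lparr>pverts = pverts G - {z}, parcs = {(a, b) \<in> parcs G. a \<noteq> z \<and> b \<noteq> z}\<rparr>"

lemma delete_vertex_pair_graph: "pair_graph G \<Longrightarrow> pair_graph (delete_vertex G z)"
proof -
  assume G: "pair_graph G"
  show ?thesis
  proof (rule pair_graphI)
    show "finite (pverts (delete_vertex G z))" using pair_graphD(1)[OF G] by (simp add: delete_vertex_def)
    show "(v, u) \<in> parcs (delete_vertex G z)" if "(u, v) \<in> parcs (delete_vertex G z)" for u v
      using that pair_graphD(2)[OF G, of u v] by (simp add: delete_vertex_def)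
    show "u \<in> pverts (delete_vertex G z)" if "(u, v) \<in> parcs (delete_vertex G z)" for u v
      using that pair_graphD(3)[OF G, of u v] by (simp add: delete_vertex_def)
    show "(u, u) \<notin> parcs (delete_vertex G z)" for u
      using pair_graphD(5)[OF G, of u] by (simp add: delete_vertex_def)
  qed
qed

lemma delete_vertex_induced:
  assumes G: "pair_graph G"
  shows "induced_subgraph (with_proj (delete_vertex G z)) (with_proj G)"
proof -
  have "pair_wf_digraph G" "pair_wf_digraph (delete_vertex G z)"
    using G delete_vertex_pair_graph[OF G, of z]
    by (auto simp: pair_graph_def pair_digraph_def pair_fin_digraph_def)
  then have "wf_digraph (with_proj G)" "wf_digraph (with_proj (delete_vertex G z))"
    by (simp_all add: wf_digraph_wp_iff)
  moreover have "(a, b) \<in> parcs G \<Longrightarrow> a \<in> pverts G \<and> b \<in> pverts G" for a b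
    using pair_graphD(3,4)[OF G] by blast
  ultimately show ?thesis
    unfolding induced_subgraph_def subgraph_def compatible_def by (auto simp: delete_vertex_def)
qed

lemma gvec_delete:
  assumes G: "pair_graph G" and x: "x \<in> vanish_off (pverts G)" "x z = 0"
  shows "gvec (delete_vertex G z) x = (gvec G x)(z := 0)"
proof
  fix v
  show "gvec (delete_vertex G z) x v = ((gvec G x)(z := 0)) v"
  proof (cases "v = z \<or> v \<notin> pverts G")
    case True
    then show ?thesis by (auto simp: gvec_def delete_vertex_def)
  next
    case False
    have "(\<Sum>u\<in>pverts G. adj G v u * x u) = (\<Sum>u\<in>pverts G - {z}. adj G v u * x u)"
      by (rule sum.mono_neutral_right) (use pair_graphD(1)[OF G] x(2) in auto)
    also have "\<dots> = (\<Sum>u\<in>pverts G - {z}. adj (delete_vertex G z) v u * x u)"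
      by (rule sum.cong) (use False in \<open>auto simp: adj_def delete_vertex_def\<close>)
    finally show ?thesis using False by (simp add: gvec_def) (simp add: delete_vertex_def)
  qed
qed

text \<open>
  The first component at \<open>z\<close> is \<open>x z\<close>; so confining the entry to the line of \<open>(0, 1)\<close> means \<open>x z = 0\<close>.\<close>

lemma gsys_delete:
  assumes G: "pair_graph G" and z: "z \<in> pverts G"
  shows "gsys (delete_vertex G z) = removal (gsys G) z (0, 1)"
proof (intro equalityI subsetI)
  fix f assume "f \<in> gsys (delete_vertex G z)"
  then obtain x where x: "x \<in> vanish_off (pverts G - {z})" "f = gvec (delete_vertex G z) x"
    by (auto simp: gsys_def delete_vertex_def)
  have x': "x \<in> vanish_off (pverts G)" "x z = 0" using x(1) by (auto simp: vanish_off_def)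
  have "gvec G x z = 0 \<or> gvec G x z = (0, 1)"
    using x'(2) z by (cases "snd (gvec G x z)") (simp_all add: gvec_def zero_prod_def)
  moreover have "gvec G x \<in> gsys G" unfolding gsys_def using x'(1) by (rule imageI)
  ultimately show "f \<in> removal (gsys G) z (0, 1)"
    unfolding removal_def x(2) gvec_delete[OF G x'] by blast
next
  fix f assume "f \<in> removal (gsys G) z (0, 1)"
  then obtain x where x: "x \<in> vanish_off (pverts G)" "gvec G x z = 0 \<or> gvec G x z = (0, 1)" "f = (gvec G x)(z := 0)"
    unfolding removal_def gsys_def by blast
  have xz: "x z = 0" using x(2) z by (auto simp: gvec_def zero_prod_def)
  have "x \<in> vanish_off (pverts (delete_vertex G z))"
    using x(1) xz by (auto simp: vanish_off_def delete_vertex_def)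
  then show "f \<in> gsys (delete_vertex G z)"
    unfolding gsys_def x(3) gvec_delete[OF G x(1) xz, symmetric] by (rule imageI)
qed

text \<open>
  The computation at a third vertex \<open>u\<close> in \<open>gvec_pivot\<close>. Here \<open>p\<close> and \<open>q\<close> are the adjacencies of \<open>u\<close> to
  \<open>w\<close> and \<open>v\<close>, and \<open>sv\<close>, \<open>sw\<close>, \<open>su\<close> are entries of \<open>A x\<close> without the contributions of \<open>v\<close> and \<open>w\<close>.\<close>

lemma bit_pivot_identity:
  fixes p q sv sw su xv xw :: bit
  shows "p * (sv + xw) + (q * (sw + xv) + (su + (q * sw + p * sv))) = su + (q * xv + p * xw)"
  by (cases p; cases q; cases sv; cases sw; cases su; cases xv; cases xw) simp_all

text \<open>
  The set of ordered pairs whose adjacency \<^const>\<open>pivot\<close> toggles before it exchanges the labels.\<close>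

definition pivot_toggle :: "'a pair_pre_digraph \<Rightarrow> 'a \<Rightarrow> 'a \<Rightarrow> ('a \<times> 'a) set" where
  "pivot_toggle G v w =
    (let S1 = nbrs G v - nbrs G w - {w}; S2 = nbrs G w - nbrs G v - {v}; S3 = nbrs G v \<inter> nbrs G w;
         T = S1 \<times> S2 \<union> S1 \<times> S3 \<union> S2 \<times> S3 in T \<union> T\<inverse>)"

lemma pivot_arcs:
  "(a, b) \<in> parcs (pivot G v w) \<longleftrightarrow>
    ((transpose v w a, transpose v w b) \<in> parcs G) \<noteq> ((transpose v w a, transpose v w b) \<in> pivot_toggle G v w)"
proof -
  let ?t = "transpose v w"
  have "parcs (pivot G v w) = map_prod ?t ?t ` ((parcs G - pivot_toggle G v w) \<union> (pivot_toggle G v w - parcs G))"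
    unfolding pivot_def pivot_toggle_def Let_def by (simp only: pair_pre_digraph.simps)
  moreover have "(a, b) \<in> map_prod ?t ?t ` E \<longleftrightarrow> (?t a, ?t b) \<in> E" for E
  proof
    assume "(?t a, ?t b) \<in> E"
    then have "map_prod ?t ?t (?t a, ?t b) \<in> map_prod ?t ?t ` E" by (rule imageI)
    then show "(a, b) \<in> map_prod ?t ?t ` E" by (simp only: map_prod_simp transpose_involutory)
  next
    assume "(a, b) \<in> map_prod ?t ?t ` E"
    then obtain e where e: "(a, b) = map_prod ?t ?t e" "e \<in> E" by (rule imageE)
    obtain c d where "e = (c, d)" by (cases e)
    then show "(?t a, ?t b) \<in> E" using e by (simp only: map_prod_simp prod.inject transpose_involutory)
  qed
  ultimately show ?thesis by (simp only: Un_iff Diff_iff) argo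
qed

lemma pivot_verts: "pverts (pivot G v w) = pverts G"
  by (simp add: pivot_def Let_def)

context
  fixes G :: "'a pair_pre_digraph" and v w :: 'a
  assumes G: "pair_graph G" and vw: "(v, w) \<in> parcs G"
begin

lemma vw_facts: "v \<noteq> w" "v \<in> pverts G" "w \<in> pverts G" "(w, v) \<in> parcs G"
  using pair_graphD[OF G] vw by blast+

lemma toggle_sym: "(a, b) \<in> pivot_toggle G v w \<Longrightarrow> (b, a) \<in> pivot_toggle G v w"
proof -
  have "(b, a) \<in> R \<union> R\<inverse>" if "(a, b) \<in> R \<union> R\<inverse>" for R using that by blast
  then show "(a, b) \<in> pivot_toggle G v w \<Longrightarrow> (b, a) \<in> pivot_toggle G v w"
    unfolding pivot_toggle_def Let_def .
qed

lemma toggle_in: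
  assumes "(a, b) \<in> pivot_toggle G v w"
  shows "a \<in> pverts G" "a \<noteq> v" "a \<noteq> w" "b \<noteq> v" "b \<noteq> w" "a \<noteq> b"
proof -
  have "a \<in> nbrs G v \<union> nbrs G w" using assms unfolding pivot_toggle_def Let_def by blast
  then show "a \<in> pverts G" using pair_graphD(4)[OF G] by (auto simp: nbrs_def)
  have "v \<notin> nbrs G v" "w \<notin> nbrs G w" using pair_graphD(5)[OF G] by (auto simp: nbrs_def)
  then show "a \<noteq> v" "a \<noteq> w" "b \<noteq> v" "b \<noteq> w" "a \<noteq> b"
    using assms unfolding pivot_toggle_def Let_def by blast+
qed

lemma pivot_pair_graph: "pair_graph (pivot G v w)"
proof (rule pair_graphI)
  let ?t = "transpose v w"
  have tV: "?t a \<in> pverts G \<longleftrightarrow> a \<in> pverts G" for a using vw_facts by (auto simp: transpose_def)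
  show "finite (pverts (pivot G v w))" unfolding pivot_verts by (rule pair_graphD(1)[OF G])
  show "(b, a) \<in> parcs (pivot G v w)" if "(a, b) \<in> parcs (pivot G v w)" for a b
    using that pair_graphD(2)[OF G] toggle_sym unfolding pivot_arcs by blast
  show "a \<in> pverts (pivot G v w)" if "(a, b) \<in> parcs (pivot G v w)" for a b
    using that pair_graphD(3)[OF G] toggle_in(1) unfolding pivot_arcs pivot_verts by (metis tV)
  show "(a, a) \<notin> parcs (pivot G v w)" for a
    using pair_graphD(5)[OF G] toggle_in(6) unfolding pivot_arcs by blast
qed

text \<open>
  The pairs of vertices in different sets among \<open>S1\<close>, \<open>S2\<close>, \<open>S3\<close> are those for which exactly one of the
  products \<open>adj G a v * adj G w b\<close> and \<open>adj G a w * adj G v b\<close> is 1. So over \<open>GF(2)\<close> toggling is the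
  addition of a matrix of rank at most 2.\<close>

lemma toggle_adj:
  assumes "a \<noteq> v" "a \<noteq> w" "b \<noteq> v" "b \<noteq> w"
  shows "of_bool (((a, b) \<in> parcs G) \<noteq> ((a, b) \<in> pivot_toggle G v w)) =
    adj G a b + (adj G a v * adj G w b + adj G a w * adj G v b)"
proof -
  have "(a, b) \<in> pivot_toggle G v w \<longleftrightarrow>
      ((v, a) \<in> parcs G \<and> (w, b) \<in> parcs G) \<noteq> ((w, a) \<in> parcs G \<and> (v, b) \<in> parcs G)"
    unfolding pivot_toggle_def Let_def nbrs_def Un_iff mem_Times_iff converse_iff Diff_iff Int_iff
      mem_Collect_eq fst_conv snd_conv singleton_iff
    using assms by argo
  moreover have "adj G a v = adj G v a" "adj G a w = adj G w a" by (rule adj_sym[OF G])+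
  ultimately show ?thesis
    by (cases "(v, a) \<in> parcs G"; cases "(w, b) \<in> parcs G"; cases "(w, a) \<in> parcs G"; cases "(v, b) \<in> parcs G";
        cases "(a, b) \<in> parcs G") (simp_all add: adj_def)
qed

lemma adj_pivot:
  assumes "a \<noteq> v" "a \<noteq> w"
  shows "b \<noteq> v \<Longrightarrow> b \<noteq> w \<Longrightarrow> adj (pivot G v w) a b = adj G a b + (adj G a v * adj G w b + adj G a w * adj G v b)"
    "adj (pivot G v w) a v = adj G a w" "adj (pivot G v w) a w = adj G a v"
    "adj (pivot G v w) v a = adj G w a" "adj (pivot G v w) w a = adj G v a"
proof -
  have no: "(v, y) \<notin> pivot_toggle G v w" "(w, y) \<notin> pivot_toggle G v w"
    "(y, v) \<notin> pivot_toggle G v w" "(y, w) \<notin> pivot_toggle G v w" for y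
    using toggle_in by blast+
  have ta: "transpose v w a = a" using assms by (simp add: transpose_apply_other)
  show "adj (pivot G v w) a b = adj G a b + (adj G a v * adj G w b + adj G a w * adj G v b)" if "b \<noteq> v" "b \<noteq> w"
  proof -
    have tb: "transpose v w b = b" using that by (simp add: transpose_apply_other)
    show ?thesis
      unfolding adj_def[of "pivot G v w"] pivot_arcs ta tb by (rule toggle_adj[OF assms that])
  qed
  show "adj (pivot G v w) a v = adj G a w" "adj (pivot G v w) a w = adj G a v"
    "adj (pivot G v w) v a = adj G w a" "adj (pivot G v w) w a = adj G v a"
    unfolding adj_def pivot_arcs ta transpose_apply_first transpose_apply_second
    by (simp_all add: no vw vw_facts(4))
qed

end

text \<open>
  Exchanges the roles of \<open>x\<close> and \<open>A x\<close> at the two ends of an edge, the effect of a pivot.\<close>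

definition swap_at :: "'a \<Rightarrow> 'a \<Rightarrow> 'a kvec \<Rightarrow> 'a kvec" where
  "swap_at v w f = (\<lambda>u. if u = v \<or> u = w then prod.swap (f u) else f u)"

lemma swap_at_add: "swap_at v w (f + g) = swap_at v w f + swap_at v w g"
  by (rule ext) (simp add: swap_at_def prod.swap_def plus_prod_def)

lemma swap_at_eq_0_iff: "swap_at v w f u = 0 \<longleftrightarrow> f u = 0"
  by (cases "f u") (simp add: swap_at_def zero_prod_def conj_commute)

lemma supp_swap_at: "supp (swap_at v w f) = supp f"
  by (simp add: supp_def swap_at_eq_0_iff)

lemma swap_at_inj: "inj (swap_at v w)"
proof (rule injI)
  fix f g :: "'a kvec" assume eq: "swap_at v w f = swap_at v w g"
  show "f = g"
  proof
    fix u show "f u = g u"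
      using fun_cong[OF eq, of u] by (cases "f u"; cases "g u") (simp add: swap_at_def split: if_splits)
  qed
qed

context
  fixes G :: "'a pair_pre_digraph" and v w :: 'a
  assumes G: "pair_graph G" and vw: "(v, w) \<in> parcs G"
begin

text \<open>
  The principal pivot: since \<open>v\<close> and \<open>w\<close> are adjacent, the equations \<open>y = A x\<close> at \<open>v\<close> and \<open>w\<close> can be solved
  for \<open>x w\<close> and \<open>x v\<close>. Substituting these in the other equations expresses them through the new
  variables, and by \<open>adj_pivot\<close> the new coefficients are the adjacencies of the pivoted graph.\<close>

lemma gvec_pivot:
  assumes x: "x \<in> vanish_off (pverts G)"
  shows "swap_at v w (gvec G x) \<in> gsys (pivot G v w)"
proof -
  let ?P = "pivot G v w"
  define R where "R = pverts G - {v, w}"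
  \<comment> \<open>The part of \<open>A x\<close> that does not involve \<open>v\<close> and \<open>w\<close>.\<close>
  define s where "s a = (\<Sum>r\<in>R. adj G a r * x r)" for a
  define x' where "x' u = fst (swap_at v w (gvec G x) u)" for u
  note f = vw_facts[OF G vw] and fin = pair_graphD(1)[OF G]
  note ap = adj_pivot[OF G vw]
  have vwP: "adj ?P v w = 1" "adj ?P w v = 1"
  proof -
    have "(v, w) \<notin> pivot_toggle G v w" "(w, v) \<notin> pivot_toggle G v w" using toggle_in(2,3)[OF G vw] by blast+
    then show "adj ?P v w = 1" "adj ?P w v = 1" using vw f(4) by (simp_all add: adj_def pivot_arcs)
  qed
  have loop: "adj H a a = 0" if "pair_graph H" for H :: "'a pair_pre_digraph" and a
    using pair_graphD(5)[OF that] by (simp add: adj_def)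
  have edge: "adj G v w = 1" "adj G w v = 1" using vw f by (simp_all add: adj_def)
  have split: "(\<Sum>u\<in>pverts G. h u) = h v + (h w + (\<Sum>u\<in>R. h u))" for h :: "'a \<Rightarrow> bit"
  proof -
    have "(\<Sum>u\<in>pverts G. h u) = h v + (\<Sum>u\<in>pverts G - {v}. h u)" by (rule sum.remove[OF fin f(2)])
    moreover have "(\<Sum>u\<in>pverts G - {v}. h u) = h w + (\<Sum>u\<in>pverts G - {v} - {w}. h u)"
      by (rule sum.remove) (use fin f in auto)
    moreover have "pverts G - {v} - {w} = R" by (auto simp: R_def)
    ultimately show ?thesis by (simp only:)
  qed
  have y: "(\<Sum>u\<in>pverts G. adj G a u * x u) = adj G a v * x v + (adj G a w * x w + s a)" for a
    by (simp only: split s_def)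
  have x'v: "x' v = s v + x w" and x'w: "x' w = s w + x v"
    using f edge loop[OF G]
    by (simp_all only: x'_def swap_at_def gvec_def y) (simp_all only: simp_thms if_True fst_swap snd_conv mult_zero_left mult_1_left add_0_left add_0_right ac_simps)
  have x'R: "x' r = x r" if "r \<in> R" for r
    using that by (auto simp: x'_def swap_at_def gvec_def R_def)
  have RN: "r \<noteq> v" "r \<noteq> w" if "r \<in> R" for r using that by (auto simp: R_def)
  have y': "(\<Sum>u\<in>pverts G. adj ?P a u * x' u) = adj ?P a v * x' v + (adj ?P a w * x' w + (\<Sum>u\<in>R. adj ?P a u * x u))" for a
  proof -
    have "(\<Sum>u\<in>R. adj ?P a u * x' u) = (\<Sum>u\<in>R. adj ?P a u * x u)" by (rule sum.cong) (simp_all only: x'R)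
    then show ?thesis by (simp only: split)
  qed
  have main: "(\<Sum>u\<in>pverts G. adj ?P a u * x' u) = snd (swap_at v w (gvec G x) a)" if a: "a \<in> pverts G" for a
  proof -
    consider "a = v" | "a = w" | "a \<noteq> v" "a \<noteq> w" by blast
    then show ?thesis
    proof cases
      case 1
      have "(\<Sum>u\<in>R. adj ?P v u * x u) = s w"
        unfolding s_def by (rule sum.cong) (simp_all only: ap(4)[OF RN])
      then have "(\<Sum>u\<in>pverts G. adj ?P v u * x' u) = 0 * x' v + (1 * (s w + x v) + s w)"
        by (simp only: y' loop[OF pivot_pair_graph[OF G vw]] vwP x'w)
      also have "\<dots> = x v" by (cases "s w"; cases "x v") simp_all
      finally show ?thesis using 1 a by (simp add: swap_at_def gvec_def)
    next
      case 2
      have "(\<Sum>u\<in>R. adj ?P w u * x u) = s v"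
        unfolding s_def by (rule sum.cong) (simp_all only: ap(5)[OF RN])
      then have "(\<Sum>u\<in>pverts G. adj ?P w u * x' u) = 1 * (s v + x w) + (0 * x' w + s v)"
        by (simp only: y' loop[OF pivot_pair_graph[OF G vw]] vwP x'v)
      also have "\<dots> = x w" by (cases "s v"; cases "x w") simp_all
      finally show ?thesis using 2 a by (simp add: swap_at_def gvec_def)
    next
      case 3
      have "(\<Sum>u\<in>R. adj ?P a u * x u)
          = (\<Sum>u\<in>R. adj G a u * x u + (adj G a v * (adj G w u * x u) + adj G a w * (adj G v u * x u)))"
        by (rule sum.cong) (simp_all only: ap(1)[OF 3 RN] distrib_right mult.assoc)
      also have "\<dots> = s a + (adj G a v * s w + adj G a w * s v)"
        by (simp only: sum.distrib s_def sum_distrib_left)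
      finally have "(\<Sum>u\<in>pverts G. adj ?P a u * x' u) =
          adj G a w * (s v + x w) + (adj G a v * (s w + x v) + (s a + (adj G a v * s w + adj G a w * s v)))"
        by (simp only: y' ap(2)[OF 3] ap(3)[OF 3] x'v x'w)
      also have "\<dots> = s a + (adj G a v * x v + adj G a w * x w)" by (rule bit_pivot_identity)
      also have "\<dots> = (\<Sum>u\<in>pverts G. adj G a u * x u)" unfolding y by (simp only: ac_simps)
      finally show ?thesis using 3 a by (simp add: swap_at_def gvec_def)
    qed
  qed
  have "swap_at v w (gvec G x) = gvec ?P x'"
  proof
    fix a show "swap_at v w (gvec G x) a = gvec ?P x' a"
    proof (cases "a \<in> pverts G")
      case True
      then have "gvec ?P x' a = (fst (swap_at v w (gvec G x) a), snd (swap_at v w (gvec G x) a))"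
        using main[OF True] by (simp only: gvec_def pivot_verts if_True x'_def)
      then show ?thesis by simp
    next
      case False
      then have "gvec G x a = 0" "gvec ?P x' a = 0" by (simp_all add: gvec_def pivot_verts)
      then have "swap_at v w (gvec G x) a = 0" by (simp only: swap_at_eq_0_iff)
      then show ?thesis using \<open>gvec ?P x' a = 0\<close> by (rule trans[OF _ sym])
    qed
  qed
  moreover have "x' \<in> vanish_off (pverts ?P)"
    unfolding vanish_off_def pivot_verts
  proof (intro CollectI allI impI)
    fix a assume "a \<notin> pverts G"
    then have "swap_at v w (gvec G x) a = 0" unfolding swap_at_eq_0_iff by (simp add: gvec_def)
    then show "x' a = 0" by (simp add: x'_def)
  qed
  ultimately show ?thesis unfolding gsys_def by (simp only: imageI)
qed

lemma gsys_pivot: "gsys (pivot G v w) = swap_at v w ` gsys G"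
proof (rule sym, rule card_subset_eq)
  interpret L: lagrangian "pverts G" "gsys G" by (rule gsys_lagrangian[OF G])
  interpret P: lagrangian "pverts G" "gsys (pivot G v w)"
    using gsys_lagrangian[OF pivot_pair_graph[OF G vw]] unfolding pivot_verts .
  show "finite (gsys (pivot G v w))" using P.sub_L by (rule subgrpD(1))
  show "swap_at v w ` gsys G \<subseteq> gsys (pivot G v w)" using gvec_pivot unfolding gsys_def[of G] by blast
  show "card (swap_at v w ` gsys G) = card (gsys (pivot G v w))"
    by (simp only: card_image[OF inj_on_subset[OF swap_at_inj subset_UNIV]] L.card_L P.card_L)
qed

lemma prk_pivot: "prk (gsys (pivot G v w)) v (0, 1) A = prk (gsys G) v (1, 0) A"
proof -
  interpret L: lagrangian "pverts G" "gsys G" by (rule gsys_lagrangian[OF G])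
  have v: "swap_at v w f v = (0, 1) \<longleftrightarrow> f v = (1, 0)" for f
    by (cases "f v") (auto simp: swap_at_def)
  have "pin (gsys (pivot G v w)) v (0, 1) X = swap_at v w ` pin (gsys G) v (1, 0) X" for X
  proof -
    have "pin (swap_at v w ` gsys G) v (0, 1) X = swap_at v w `
        {f \<in> gsys G. supp (swap_at v w f) \<subseteq> X \<and> (swap_at v w f v = 0 \<or> swap_at v w f v = (0, 1))}"
      unfolding pin_def inside_def by blast
    then show ?thesis
      by (simp only: gsys_pivot supp_swap_at swap_at_eq_0_iff v pin_def inside_def mem_Collect_eq conj_assoc)
  qed
  moreover have "dm (swap_at v w ` pin (gsys G) v (1, 0) X) = dm (pin (gsys G) v (1, 0) X)" for X
  proof (rule dm_inj_image[OF L.sub_pin swap_at_add])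
    fix f assume "swap_at v w f = 0"
    then have "supp f = {}" using supp_swap_at[of v w f] by simp
    then show "f = 0" by simp
  qed
  ultimately show ?thesis by (simp only: prk_def)
qed

end

section \<open>From systems back to graphs\<close>

text \<open>
  Deleting \<open>z\<close> realises the line of \<open>(0, 1)\<close>. For \<open>(1, 0)\<close> an edge at \<open>z\<close> is needed to pivot on. If \<open>z\<close> had no
  neighbour, the vector of the indicator function of \<open>z\<close> would be supported by \<open>z\<close> alone.\<close>

lemma exists_single_vertex_pivot_minor:
  assumes G: "pair_graph G" and z: "z \<in> pverts G" and ns: "\<And>f. f \<in> gsys G \<Longrightarrow> supp f \<subseteq> {z} \<Longrightarrow> f = 0"
    and r: "r \<in> {(0, 1), (1, 0)}"
  shows "\<exists>H. pair_graph H \<and> pivot_minor H G \<and> pverts H = pverts G - {z} \<and>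
    (\<forall>A \<subseteq> pverts G - {z}. int (cut_rank H A) = prk (gsys G) z r A)"
proof -
  have del: "pair_graph (delete_vertex K z)" "pverts (delete_vertex K z) = pverts G - {z}"
    "\<And>A. A \<subseteq> pverts G - {z} \<Longrightarrow> int (cut_rank (delete_vertex K z) A) = prk (gsys K) z (0, 1) A"
    if K: "pair_graph K" "pverts K = pverts G" "\<And>f. f \<in> gsys K \<Longrightarrow> supp f \<subseteq> {z} \<Longrightarrow> f = 0" for K
  proof -
    show g: "pair_graph (delete_vertex K z)" by (rule delete_vertex_pair_graph[OF K(1)])
    show p: "pverts (delete_vertex K z) = pverts G - {z}" by (simp add: delete_vertex_def K(2))
    interpret K: lagrangian "pverts G" "gsys K" using gsys_lagrangian[OF K(1)] unfolding K(2) .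
    fix A assume A: "A \<subseteq> pverts G - {z}"
    have "int (cut_rank (delete_vertex K z) A) = rk (gsys (delete_vertex K z)) A"
      by (rule cut_rank_eq_rk[OF g]) (use A p in simp)
    also have "gsys (delete_vertex K z) = removal (gsys K) z (0, 1)"
      by (rule gsys_delete[OF K(1)]) (use z K(2) in simp)
    also have "rk (removal (gsys K) z (0, 1)) A = prk (gsys K) z (0, 1) A"
      by (rule K.removal_lagrangian(2)[OF z _ K(3) A]) (auto simp: zero_prod_def)
    finally show "int (cut_rank (delete_vertex K z) A) = prk (gsys K) z (0, 1) A" .
  qed
  show ?thesis
  proof (cases "r = (0, 1)")
    case True
    have "pivot_minor (delete_vertex G z) G"
      unfolding pivot_minor_def pivot_equivalent_def using delete_vertex_induced[OF G] by blast
    then show ?thesis using del[OF G refl ns] True by blast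
  next
    case False
    then have r: "r = (1, 0)" using r by blast
    have "\<exists>w. (z, w) \<in> parcs G"
    proof (rule ccontr)
      assume no: "\<nexists>w. (z, w) \<in> parcs G"
      define x where "x u = (if u = z then 1 else 0 :: bit)" for u
      have x: "x \<in> vanish_off (pverts G)" using z by (auto simp: vanish_off_def x_def)
      have "(u, z) \<notin> parcs G" for u
        by (rule notI) (use no pair_graphD(2)[OF G, of u z] in blast)
      then have "adj G u a * x a = 0" for u a
        by (cases "a = z") (simp_all add: adj_def x_def)
      then have e: "gvec G x = (\<lambda>u. if u = z then (1, 0) else 0)"
        using z by (auto simp: gvec_def fun_eq_iff x_def zero_prod_def)
      have "supp (gvec G x) \<subseteq> {z}" by (auto simp: e supp_def)
      moreover have "gvec G x \<in> gsys G" unfolding gsys_def using x by (rule imageI)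
      ultimately have "gvec G x = 0" using ns by blast
      then have "gvec G x z = 0" by simp
      moreover have "gvec G x z = (1, 0)" by (simp add: e)
      ultimately show False by (simp add: zero_prod_def)
    qed
    then obtain w where w: "(z, w) \<in> parcs G" by blast
    let ?P = "pivot G z w"
    note P = pivot_pair_graph[OF G w]
    have nsP: "f = 0" if f: "f \<in> gsys ?P" "supp f \<subseteq> {z}" for f
    proof -
      obtain g where g: "g \<in> gsys G" "f = swap_at z w g" using f(1) unfolding gsys_pivot[OF G w] by blast
      then have "g = 0" using ns[OF g(1)] f(2) by (simp add: supp_swap_at)
      then have "supp f = {}" using g(2) by (simp add: supp_swap_at)
      then show ?thesis by simp
    qed
    have "pivot_equivalent G ?P"
      unfolding pivot_equivalent_def
    proof (rule r_into_rtranclp)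
      show "pivot_step G ?P" unfolding pivot_step_def using w by blast
    qed
    then have "pivot_minor (delete_vertex ?P z) G"
      unfolding pivot_minor_def using delete_vertex_induced[OF P] by blast
    moreover have "int (cut_rank (delete_vertex ?P z) A) = prk (gsys G) z r A" if "A \<subseteq> pverts G - {z}" for A
      unfolding r prk_pivot[OF G w, symmetric] by (rule del(3)[OF P pivot_verts nsP that])
    ultimately show ?thesis using del(1,2)[OF P pivot_verts nsP] by blast
  qed
qed

text \<open>
  No edges leave the set \<open>A\<close> of vertices reachable from a vertex, so \<open>A\<close> and its complement have
  rank 0. This contradicts the hypothesis unless one of them is a single vertex; but then any 2-set
  containing this vertex has rank at most 1.\<close>

lemma connected_if_no_small_cut:
  assumes G: "pair_graph G" and c: "4 \<le> card (pverts G)"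
    and r: "\<And>X. X \<subseteq> pverts G \<Longrightarrow> 2 \<le> card X \<Longrightarrow> 2 \<le> card (pverts G - X) \<Longrightarrow> 2 \<le> rk (gsys G) X"
  shows "connected (with_proj G)"
proof -
  interpret lagrangian "pverts G" "gsys G" by (rule gsys_lagrangian[OF G])
  let ?V = "pverts G"
  have sym: "(parcs G)\<^sup>s = parcs G" 
    unfolding symcl_def by (rule Un_absorb2) (auto intro: pair_graphD(2)[OF G])
  have "(u, u') \<in> rtrancl_on ?V (parcs G)" if u: "u \<in> ?V" and u': "u' \<in> ?V" for u u'
  proof (rule ccontr)
    assume nr: "(u, u') \<notin> rtrancl_on ?V (parcs G)"
    define A where "A = {x. (u, x) \<in> rtrancl_on ?V (parcs G)}"
    have AV: "A \<subseteq> ?V" using in_rtrancl_on_in_F(2) unfolding A_def by fast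
    have uA: "u \<in> A" and u'A: "u' \<in> ?V - A" using u u' nr by (simp_all add: A_def)
    have closed: "b \<in> A" if "a \<in> A" "(a, b) \<in> parcs G" for a b
      using that pair_graphD(4)[OF G that(2)] unfolding A_def by (auto intro: rtrancl_on_into_rtrancl_on)
    have full: "gvec G x \<in> inside (gsys G) B"
      if B: "B = A \<or> B = ?V - A" and x: "x \<in> vanish_off B" for B x
    proof -
      have BV: "B \<subseteq> ?V" using B AV by blast
      have xV: "x \<in> vanish_off ?V" using x BV by (auto simp: vanish_off_def)
      have "gvec G x a = 0" if a: "a \<notin> B" for a
      proof (cases "a \<in> ?V")
        case True
        have "adj G a b * x b = 0" for b
        proof (cases "b \<in> B")
          case bB: True
          have "(a, b) \<notin> parcs G"
          proof
            assume e: "(a, b) \<in> parcs G"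
            then have "(b, a) \<in> parcs G" by (rule pair_graphD(2)[OF G])
            then show False using closed[of a b] closed[of b a] e B a bB True by blast
          qed
          then show ?thesis by (simp add: adj_def)
        next
          case False
          then show ?thesis using x by (simp add: vanish_off_def)
        qed
        then have "(\<Sum>u\<in>?V. adj G a u * x u) = 0" by (simp only: sum.neutral_const)
        moreover have "x a = 0" using x a by (simp add: vanish_off_def)
        ultimately show ?thesis using True by (simp only: gvec_def zero_prod_def if_True)
      next
        case False
        then show ?thesis by (simp add: gvec_def)
      qed
      then have "supp (gvec G x) \<subseteq> B" by (auto simp: supp_def)
      then show ?thesis using xV by (simp add: inside_def gsys_def)
    qed
    have rk0: "rk (gsys G) B \<le> 0" if B: "B = A \<or> B = ?V - A" for B
    proof -
      have BV: "B \<subseteq> ?V" using B AV by blast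
      have fB: "finite B" by (rule fin[OF BV])
      have "vanish_off B \<subseteq> vanish_off ?V" using BV by (auto simp: vanish_off_def)
      then have "card (gvec G ` vanish_off B) = 2 ^ card B"
        by (simp only: card_image[OF inj_on_subset[OF gvec_inj]] card_vanish_off(1)[OF fB])
      moreover have "card (gvec G ` vanish_off B) \<le> card (inside (gsys G) B)"
        by (rule card_mono[OF subgrpD(1)[OF sub_inside]]) (use full[OF B] in blast)
      ultimately have "(2::nat) ^ card B \<le> 2 ^ dm (inside (gsys G) B)" by (simp only: card_dm[OF sub_inside])
      then have "card B \<le> dm (inside (gsys G) B)" by (rule power_le_imp_le_exp[rotated]) simp
      then show ?thesis by (simp add: rk_def)
    qed
    have no1: "card B \<noteq> 1" if B: "B = A \<or> B = ?V - A" for B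
    proof
      assume c1: "card B = 1"
      have BV: "B \<subseteq> ?V" using B AV by blast
      obtain X where X: "B \<subseteq> X" "X \<subseteq> ?V" "card X = 2"
        using exists_subset_between[of B 2 ?V] BV c1 c fin_V by auto
      have "1 \<le> dm (inside (gsys G) B)" using rk0[OF B] c1 by (simp add: rk_def)
      also have "\<dots> \<le> dm (inside (gsys G) X)" by (rule dm_mono[OF sub_inside sub_inside inside_mono[OF X(1)]])
      finally have "rk (gsys G) X \<le> 1" using X(3) by (simp add: rk_def)
      moreover have "2 \<le> card (?V - X)" using X c by (simp add: card_Diff_subset fin)
      ultimately show False using r[OF X(2)] X(3) by simp
    qed
    have "A \<noteq> {}" "?V - A \<noteq> {}" "finite A" "finite (?V - A)" using uA u'A fin[OF AV] fin_V by auto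
    then have "0 < card A" "0 < card (?V - A)" by (simp_all add: card_gt_0_iff)
    then have "2 \<le> card A" "2 \<le> card (?V - A)" using no1[of A] no1[of "?V - A"] by auto
    then have "2 \<le> rk (gsys G) A" by (rule r[OF AV])
    then show False using rk0[of A] by simp
  qed
  moreover have "?V \<noteq> {}" using c by auto
  ultimately show ?thesis unfolding connected_conv with_proj_simps sym by blast
qed

theorem theorem4p1:
  fixes G :: "'a pair_pre_digraph"
  assumes "pair_graph G"
    and "prime_graph G"
    and "rank_connected 3 2 G"
    and "card (pverts G) \<ge> 10"
  shows "\<exists>H. pivot_minor H G \<and> prime_graph H \<and> rank_connected 3 3 H \<and>
             card (pverts H) = card (pverts G) - 1"
proof -
  let ?V = "pverts G" and ?L = "gsys G"
  interpret lagrangian ?V ?L by (rule gsys_lagrangian[OF assms(1)])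
  interpret weakly_connected_system ?V ?L
  proof unfold_locales
    show "10 \<le> card ?V" by (rule assms(4))
    fix X assume X: "X \<subseteq> ?V"
    have eq: "int (cut_rank G X) = rk ?L X" by (rule cut_rank_eq_rk[OF assms(1) X])
    show "2 \<le> rk ?L X" if "2 \<le> card X" "2 \<le> card (?V - X)"
    proof (rule ccontr)
      assume "\<not> 2 \<le> rk ?L X"
      then have "is_split G X (?V - X)" unfolding is_split_def using X that eq by auto
      then show False using assms(2) unfolding prime_graph_def by blast
    qed
    show "3 \<le> rk ?L X" if "5 \<le> card X" "5 \<le> card (?V - X)"
    proof (rule ccontr)
      assume "\<not> 3 \<le> rk ?L X"
      then have "int (min (card X) (card (?V - X))) < 3 + 2"
        using assms(3) X eq unfolding rank_connected_def by auto
      then show False using that by simp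
    qed
  qed
  have "\<exists>z\<in>?V. \<exists>r\<in>{(0, 1), (1, 0)}. prime_removal z r \<and> weak_removal z r"
    by (rule exists_removal) (simp_all add: zero_prod_def)
  then obtain z r where z: "z \<in> ?V" and r: "r \<in> {(0, 1), (1, 0)}" "prime_removal z r" "weak_removal z r" by blast
  have "\<exists>H. pair_graph H \<and> pivot_minor H G \<and> pverts H = ?V - {z} \<and>
    (\<forall>A \<subseteq> ?V - {z}. int (cut_rank H A) = prk ?L z r A)"
    by (rule exists_single_vertex_pivot_minor[OF assms(1) z _ r(1)]) (rule no_single)
  then obtain H where H: "pair_graph H" "pivot_minor H G" "pverts H = ?V - {z}"
    and all: "\<forall>A \<subseteq> ?V - {z}. int (cut_rank H A) = prk ?L z r A"
    by (elim exE conjE) (rule that; assumption)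
  note cr = all[rule_format]
  have cH: "card (pverts H) = card ?V - 1" using H(3) z by simp
  have ge2: "2 \<le> int (cut_rank H A)" if "A \<subseteq> pverts H" "2 \<le> card A" "2 \<le> card (pverts H - A)" for A
    using r(2) that cr[of A] unfolding prime_removal_def H(3) by auto
  have "connected (with_proj H)"
  proof (rule connected_if_no_small_cut[OF H(1)])
    show "4 \<le> card (pverts H)" using cH card_V by simp
    show "2 \<le> rk (gsys H) X" if "X \<subseteq> pverts H" "2 \<le> card X" "2 \<le> card (pverts H - X)" for X
      using ge2[OF that] cut_rank_eq_rk[OF H(1) that(1)] by simp
  qed
  moreover have "\<not> is_split H A B" for A B
  proof
    assume s: "is_split H A B"
    then have "A \<subseteq> pverts H" "B = pverts H - A" unfolding is_split_def by blast+
    then show False using ge2[of A] s unfolding is_split_def by simp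
  qed
  ultimately have "prime_graph H" unfolding prime_graph_def by blast
  moreover have "rank_connected 3 3 H"
    unfolding rank_connected_def
  proof (intro allI impI)
    fix X assume X: "X \<subseteq> pverts H" and lt: "int (cut_rank H X) < 3"
    show "int (min (card X) (card (pverts H - X))) < 3 + 3"
    proof (rule ccontr)
      assume "\<not> ?thesis"
      then have "6 \<le> card X" "6 \<le> card (pverts H - X)" by simp_all
      then have "3 \<le> prk ?L z r X" using r(3) X unfolding weak_removal_def H(3) by blast
      then show False using cr[of X] X lt unfolding H(3) by simp
    qed
  qed
  ultimately show ?thesis using H(2) cH by blast
qed

end
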